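(* Let $\Omega\subset\mathbb{R}^N$, $N\ge 2$, be a bounded domain with $\partial\Omega\in C^2$, $0<T<\infty$, $Q_T=\Omega\times(0,T]$, $\Gamma_T=\partial\Omega\times(0,T)$. Let $p,q\in C^{0,1}(\overline Q_T)$ satisfy, for some constants $p^\pm,q^\pm$, $$\frac{2N}{N+2}<p^-\le p(z)\le p^+,\qquad \frac{2N}{N+2}<q^-\le q(z)\le q^+\quad\text{in }\overline Q_T,\qquad \max_{z\in\overline Q_T}|p(z)-q(z)|<\frac{2}{N+2}.$$ Let $a,b\in C^{0,1}(\overline Q_T)$ be nonnegative with $a(z)+b(z)\ge\alpha>0$ in $\overline Q_T$, $\alpha$ constant, and put $\mathcal F(z,\xi)=a(z)|\xi|^{p(z)-2}+b(z)|\xi|^{q(z)-2}$, $\underline s(z)=\min\{p(z),q(z)\}$. Call a pair $(u_0,f)$ admissible if $f\in L^2(0,T;W^{1,2}_0(\Omega))$, $u_0\in W^{1,\mathcal H}_0(\Omega)$ and $\|\nabla u_0\|_{2,\Omega}^2+\int_\Omega\mathcal F((x,0),\nabla u_0)|\nabla u_0|^2dx<\infty$. For an admissible pair let $u$ be the unique strong solution of $$u_t-\operatorname{div}(\mathcal F(z,\nabla u)\nabla u)=f\ \text{in }Q_T,\qquad u=0\ \text{on }\Gamma_T,\qquad u(x,0)=u_0(x)\ \text{in }\Omega.$$ (a) The solution satisfies the energy equality: for every $t\in[0,T]$, with $Q_t=\Omega\times(0,t)$, $$\frac12\|u(t)\|_{2,\Omega}^2+\int_{Q_t}\mathcal F(z,\nabla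 u)|\nabla u|^2\,dz=\frac12\|u_0\|_{2,\Omega}^2+\int_{Q_t}uf\,dz.$$ (b) The solution is continuous with respect to the data: if $u$, $v$ are two strong solutions corresponding to the admissible data $(u_0,f)$ and $(v_0,g)$, then $$\sup_{t\in(0,T)}\|u-v\|_{2,\Omega}^2(t)+\int_{Q_T}\mathcal F(z,\nabla(u-v))|\nabla(u-v)|^2\,dz\to0\quad\text{and}\quad\int_{Q_T}|\nabla(u-v)|^{\underline s(z)}\,dz\to0$$ as $\|u_0-v_0\|_{2,\Omega}+\|f-g\|_{2,Q_T}\to0$ (that is, for fixed $(u_0,f)$ and any sequence of admissible data $(v_0,g)$ converging to $(u_0,f)$ in $L^2(\Omega)\times L^2(Q_T)$, both quantities tend to zero along the corresponding solutions $v$).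
   Context: Notation: $z=(x,t)$; $\nabla$ is the gradient in $x$; $\|\cdot\|_{2,D}$ is the $L^2(D)$ norm; $\overline s(z)=\max\{p(z),q(z)\}$. $\mathcal F(z,\xi)\xi$ is understood as $0$ at $\xi=0$. Variable Lebesgue spaces: for a measurable exponent $r$ with $1<r^-\le r\le r^+<\infty$ on a set $D$, $L^{r(\cdot)}(D)$ is the set of measurable $f$ with $\int_D|f|^{r}<\infty$, with Luxemburg norm $\|f\|_{r(\cdot),D}=\inf\{\lambda>0:\int_D|f/\lambda|^{r}\le1\}$. For $r\in C^{0,1}(\overline Q_T)$: $\mathbb V_{r(\cdot,t)}(\Omega)=\{u\in L^2(\Omega)\cap W^{1,1}_0(\Omega): |\nabla u|^{r(x,t)}\in L^1(\Omega)\}$ and $\mathbb W_{r(\cdot)}(Q_T)=\{u:(0,T)\to\mathbb V_{r(\cdot,t)}(\Omega)\ |\ u\in L^2(Q_T),\ |\nabla u|^{r(z)}\in L^1(Q_T)\}$, with norm $\|u\|_{2,Q_T}+\|\nabla u\|_{r(\cdot),Q_T}$. Musielak–Sobolev space of the initial data: let $p_0,q_0,a_0,b_0$ be $p,q,a,b$ taken at $t=0$; $s(x)=\max\{2,\min\{p_0(x),q_0(x)\}\}$, $r(x)=\max\{2,p_0(x)\}$, $\sigma(x)=\max\{2,q_0(x)\}$, and $\mathcal H(x,\tau)=\tau^{s(x)}+a_0(x)\tau^{r(x)}+b_0(x)\tau^{\sigma(x)}$, $\tau\ge0$. $L^{\mathcal H}(\Omega)$ is the set of measurable $u$ with $\int_\Omega\mathcal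 H(x,|u|)dx<\infty$, with the Luxemburg norm; $W^{1,\mathcal H}(\Omega)=\{u\in L^{\mathcal H}(\Omega):|\nabla u|\in L^{\mathcal H}(\Omega)\}$ with norm $\|u\|_{\mathcal H}+\|\nabla u\|_{\mathcal H}$; $W^{1,\mathcal H}_0(\Omega)$ is the closure of $C_0^\infty(\Omega)$ in $W^{1,\mathcal H}(\Omega)$. Strong solution: a function $u:Q_T\to\mathbb R$ such that (1) $u\in\mathbb W_{\overline s(\cdot)}(Q_T)$, $u_t\in L^2(Q_T)$, $|\nabla u|\in L^\infty(0,T;L^{r(\cdot)}(\Omega))$ with $r(z)=\max\{2,\underline s(z)\}$; (2) for every $\phi\in\mathbb W_{\overline s(\cdot)}(Q_T)$, $\int_{Q_T}u_t\phi\,dz+\int_{Q_T}\mathcal F(z,\nabla u)\nabla u\cdot\nabla\phi\,dz=\int_{Q_T}f\phi\,dz$; (3) for every $\psi\in C_0^1(\Omega)$, $\int_\Omega(u(x,t)-u_0(x))\psi\,dx\to0$ as $t\to0$. Under the stated hypotheses a unique strong solution exists for every admissible pair; it is identified with its representative in $C([0,T];L^2(\Omega))$. *)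

theory Defs
  imports "HOL-Analysis.Analysis"
begin

section \<open>Smooth functions, test functions and domains with C^2 boundary\<close>

primrec C_diff :: "nat \<Rightarrow> ('a::euclidean_space \<Rightarrow> real) \<Rightarrow> bool" where
  "C_diff 0 f \<longleftrightarrow> continuous_on UNIV f"
| "C_diff (Suc k) f \<longleftrightarrow> (\<forall>x. f differentiable (at x)) \<and>
     (\<forall>b\<in>Basis. C_diff k (\<lambda>x. frechet_derivative f (at x) b))"

definition compact_support_in :: "'a::euclidean_space set \<Rightarrow> ('a \<Rightarrow> real) \<Rightarrow> bool" where
  "compact_support_in D f \<longleftrightarrow>
     compact (closure {x. f x \<noteq> 0}) \<and> closure {x. f x \<noteq> 0} \<subseteq> D"

definition test_fun :: "'a::euclidean_space set \<Rightarrow> ('a \<Rightarrow> real) set" where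
  "test_fun D = {\<phi>. (\<forall>k. C_diff k \<phi>) \<and> compact_support_in D \<phi>}"

text \<open>Near each boundary point the domain is, in suitable orthonormal coordinates with last axis
  \<open>e\<close>, the set above the graph of a C^2 function. Here \<open>x - (x \<bullet> e) *\<^sub>R e\<close> stands for the remaining
  coordinates, so only the values of \<open>\<gamma>\<close> on the hyperplane orthogonal to \<open>e\<close> matter.\<close>

definition C2_boundary :: "'a::euclidean_space set \<Rightarrow> bool" where
  "C2_boundary \<Omega> \<longleftrightarrow> (\<forall>x0\<in>frontier \<Omega>. \<exists>\<rho>>0. \<exists>e \<gamma>. norm e = 1 \<and> C_diff 2 \<gamma> \<and>
     \<Omega> \<inter> ball x0 \<rho> = {x \<in> ball x0 \<rho>. x \<bullet> e > \<gamma> (x - (x \<bullet> e) *\<^sub>R e)})"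

definition bounded_C2_domain :: "'a::euclidean_space set \<Rightarrow> bool" where
  "bounded_C2_domain \<Omega> \<longleftrightarrow>
     open \<Omega> \<and> connected \<Omega> \<and> \<Omega> \<noteq> {} \<and> bounded \<Omega> \<and> C2_boundary \<Omega>"

section \<open>Musielak--Orlicz and Lebesgue spaces\<close>

definition L2_norm :: "'a measure \<Rightarrow> ('a \<Rightarrow> real) \<Rightarrow> real" where
  "L2_norm M f = sqrt (\<integral>x. (f x)\<^sup>2 \<partial>M)"

definition musielak :: "'a measure \<Rightarrow> ('a \<Rightarrow> real \<Rightarrow> real) \<Rightarrow> ('a \<Rightarrow> real) set" where
  "musielak M \<Phi> = {f \<in> borel_measurable M. (\<integral>\<^sup>+x. ennreal (\<Phi> x \<bar>f x\<bar>) \<partial>M) < \<infinity>}"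

definition luxemburg :: "'a measure \<Rightarrow> ('a \<Rightarrow> real \<Rightarrow> real) \<Rightarrow> ('a \<Rightarrow> real) \<Rightarrow> real" where
  "luxemburg M \<Phi> f = Inf {l. 0 < l \<and> (\<integral>\<^sup>+x. ennreal (\<Phi> x (\<bar>f x\<bar> / l)) \<partial>M) \<le> 1}"

text \<open>The variable Lebesgue space with exponent \<open>r\<close> is \<open>musielak M (power_fun r)\<close>. For a constant
  exponent this is the usual Lebesgue space and \<open>luxemburg\<close> is its usual norm.\<close>

definition power_fun :: "('a \<Rightarrow> real) \<Rightarrow> 'a \<Rightarrow> real \<Rightarrow> real" where
  "power_fun r x \<tau> = \<tau> powr r x"

abbreviation L_var :: "'a measure \<Rightarrow> ('a \<Rightarrow> real) \<Rightarrow> ('a \<Rightarrow> real) set" where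
  "L_var M r \<equiv> musielak M (power_fun r)"

section \<open>Weak derivatives and Sobolev spaces\<close>

definition loc_integrable ::
    "'a::euclidean_space set \<Rightarrow> ('a \<Rightarrow> 'b::euclidean_space) \<Rightarrow> bool" where
  "loc_integrable D f \<longleftrightarrow> (\<forall>K. compact K \<and> K \<subseteq> D \<longrightarrow> integrable (lebesgue_on K) f)"

definition is_weak_grad :: "'a::euclidean_space set \<Rightarrow> ('a \<Rightarrow> real) \<Rightarrow> ('a \<Rightarrow> 'a) \<Rightarrow> bool" where
  "is_weak_grad \<Omega> u w \<longleftrightarrow> loc_integrable \<Omega> u \<and> loc_integrable \<Omega> w \<and>
     (\<forall>\<phi>\<in>test_fun \<Omega>. \<forall>b\<in>Basis.
        (\<integral>x. u x * frechet_derivative \<phi> (at x) b \<partial>lebesgue_on \<Omega>)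
          = - (\<integral>x. (w x \<bullet> b) * \<phi> x \<partial>lebesgue_on \<Omega>))"

text \<open>Weak gradients are unique up to null sets; the choice is immaterial below.\<close>

definition weak_grad :: "'a::euclidean_space set \<Rightarrow> ('a \<Rightarrow> real) \<Rightarrow> 'a \<Rightarrow> 'a" where
  "weak_grad \<Omega> u = (SOME w. is_weak_grad \<Omega> u w)"

definition W1 :: "'a::euclidean_space set \<Rightarrow> ('a \<Rightarrow> real \<Rightarrow> real) \<Rightarrow> ('a \<Rightarrow> real) set" where
  "W1 \<Omega> \<Phi> = {u \<in> musielak (lebesgue_on \<Omega>) \<Phi>. (\<exists>w. is_weak_grad \<Omega> u w) \<and>
     (\<lambda>x. norm (weak_grad \<Omega> u x)) \<in> musielak (lebesgue_on \<Omega>) \<Phi>}"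

definition W1_norm ::
    "'a::euclidean_space set \<Rightarrow> ('a \<Rightarrow> real \<Rightarrow> real) \<Rightarrow> ('a \<Rightarrow> real) \<Rightarrow> real" where
  "W1_norm \<Omega> \<Phi> u = luxemburg (lebesgue_on \<Omega>) \<Phi> u
     + luxemburg (lebesgue_on \<Omega>) \<Phi> (\<lambda>x. norm (weak_grad \<Omega> u x))"

definition W1_0 :: "'a::euclidean_space set \<Rightarrow> ('a \<Rightarrow> real \<Rightarrow> real) \<Rightarrow> ('a \<Rightarrow> real) set" where
  "W1_0 \<Omega> \<Phi> = {u \<in> W1 \<Omega> \<Phi>. \<forall>\<epsilon>>0. \<exists>\<phi>\<in>test_fun \<Omega>. W1_norm \<Omega> \<Phi> (\<lambda>x. u x - \<phi> x) < \<epsilon>}"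

section \<open>Functions on the space-time cylinder\<close>

abbreviation cyl :: "'a set \<Rightarrow> real \<Rightarrow> ('a \<times> real) set" where
  "cyl \<Omega> T \<equiv> \<Omega> \<times> {0<..T}"

text \<open>The gradient in \<open>x\<close> is taken slice by slice, but must be jointly measurable; this makes it
  unique up to null sets of the cylinder.\<close>

definition is_space_grad :: "'a::euclidean_space set \<Rightarrow> real \<Rightarrow> ('a \<times> real \<Rightarrow> real)
    \<Rightarrow> ('a \<times> real \<Rightarrow> 'a) \<Rightarrow> bool" where
  "is_space_grad \<Omega> T u G \<longleftrightarrow> G \<in> borel_measurable (lebesgue_on (cyl \<Omega> T)) \<and>
     (AE t in lebesgue_on {0<..<T}. is_weak_grad \<Omega> (\<lambda>x. u (x, t)) (\<lambda>x. G (x, t)))"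

definition space_grad :: "'a::euclidean_space set \<Rightarrow> real \<Rightarrow> ('a \<times> real \<Rightarrow> real)
    \<Rightarrow> 'a \<times> real \<Rightarrow> 'a" where
  "space_grad \<Omega> T u = (SOME G. is_space_grad \<Omega> T u G)"

definition is_time_deriv :: "'a::euclidean_space set \<Rightarrow> real \<Rightarrow> ('a \<times> real \<Rightarrow> real)
    \<Rightarrow> ('a \<times> real \<Rightarrow> real) \<Rightarrow> bool" where
  "is_time_deriv \<Omega> T u w \<longleftrightarrow>
     loc_integrable (\<Omega> \<times> {0<..<T}) u \<and> loc_integrable (\<Omega> \<times> {0<..<T}) w \<and>
     (\<forall>\<phi>\<in>test_fun (\<Omega> \<times> {0<..<T}).
        (\<integral>z. u z * frechet_derivative \<phi> (at z) (0, 1) \<partial>lebesgue_on (cyl \<Omega> T))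
          = - (\<integral>z. w z * \<phi> z \<partial>lebesgue_on (cyl \<Omega> T)))"

definition time_deriv :: "'a::euclidean_space set \<Rightarrow> real \<Rightarrow> ('a \<times> real \<Rightarrow> real)
    \<Rightarrow> 'a \<times> real \<Rightarrow> real" where
  "time_deriv \<Omega> T u = (SOME w. is_time_deriv \<Omega> T u w)"

definition V_space :: "'a::euclidean_space set \<Rightarrow> ('a \<Rightarrow> real) \<Rightarrow> ('a \<Rightarrow> real) set" where
  "V_space \<Omega> r = {u \<in> L_var (lebesgue_on \<Omega>) (\<lambda>_. 2) \<inter> W1_0 \<Omega> (power_fun (\<lambda>_. 1)).
     (\<lambda>x. norm (weak_grad \<Omega> u x)) \<in> L_var (lebesgue_on \<Omega>) r}"

definition W_space :: "'a::euclidean_space set \<Rightarrow> real \<Rightarrow> ('a \<times> real \<Rightarrow> real)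
    \<Rightarrow> ('a \<times> real \<Rightarrow> real) set" where
  "W_space \<Omega> T r = {u \<in> L_var (lebesgue_on (cyl \<Omega> T)) (\<lambda>_. 2).
     (AE t in lebesgue_on {0<..<T}. (\<lambda>x. u (x, t)) \<in> V_space \<Omega> (\<lambda>x. r (x, t))) \<and>
     (\<exists>G. is_space_grad \<Omega> T u G) \<and>
     (\<lambda>z. norm (space_grad \<Omega> T u z)) \<in> L_var (lebesgue_on (cyl \<Omega> T)) r}"

text \<open>The Bochner space of square integrable functions of time with values in the Sobolev space
  of order one, exponent two and zero trace, realised by functions on the cylinder.\<close>

definition L2_W12_0 :: "'a::euclidean_space set \<Rightarrow> real \<Rightarrow> ('a \<times> real \<Rightarrow> real) set" where
  "L2_W12_0 \<Omega> T = {f \<in> L_var (lebesgue_on (cyl \<Omega> T)) (\<lambda>_. 2).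
     (AE t in lebesgue_on {0<..<T}. (\<lambda>x. f (x, t)) \<in> W1_0 \<Omega> (power_fun (\<lambda>_. 2))) \<and>
     (\<exists>G. is_space_grad \<Omega> T f G) \<and>
     (\<lambda>z. norm (space_grad \<Omega> T f z)) \<in> L_var (lebesgue_on (cyl \<Omega> T)) (\<lambda>_. 2)}"

definition Linf_L_var :: "'a::euclidean_space set \<Rightarrow> real \<Rightarrow> ('a \<times> real \<Rightarrow> real)
    \<Rightarrow> ('a \<times> real \<Rightarrow> real) set" where
  "Linf_L_var \<Omega> T r = {h \<in> borel_measurable (lebesgue_on (cyl \<Omega> T)).
     \<exists>C. AE t in lebesgue_on {0<..<T}.
       (\<lambda>x. h (x, t)) \<in> L_var (lebesgue_on \<Omega>) (\<lambda>x. r (x, t)) \<and>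
       luxemburg (lebesgue_on \<Omega>) (power_fun (\<lambda>x. r (x, t))) (\<lambda>x. h (x, t)) \<le> C}"

definition C_L2 :: "'a::euclidean_space set \<Rightarrow> real \<Rightarrow> ('a \<times> real \<Rightarrow> real) set" where
  "C_L2 \<Omega> T = {u. \<forall>t\<in>{0..T}. (\<lambda>x. u (x, t)) \<in> L_var (lebesgue_on \<Omega>) (\<lambda>_. 2) \<and>
     ((\<lambda>\<tau>. L2_norm (lebesgue_on \<Omega>) (\<lambda>x. u (x, \<tau>) - u (x, t))) \<longlongrightarrow> 0) (at t within {0..T})}"

section \<open>The double phase problem\<close>

text \<open>Since \<open>0 powr c = 0\<close>, the flux vanishes at \<open>\<xi> = 0\<close> also for exponents below two.\<close>

definition flux_coeff :: "('z \<Rightarrow> real) \<Rightarrow> ('z \<Rightarrow> real) \<Rightarrow> ('z \<Rightarrow> real) \<Rightarrow> ('z \<Rightarrow> real)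
    \<Rightarrow> 'z \<Rightarrow> 'a::euclidean_space \<Rightarrow> real" where
  "flux_coeff p q a b z \<xi> = a z * norm \<xi> powr (p z - 2) + b z * norm \<xi> powr (q z - 2)"

definition H_init :: "('a \<times> real \<Rightarrow> real) \<Rightarrow> ('a \<times> real \<Rightarrow> real) \<Rightarrow> ('a \<times> real \<Rightarrow> real)
    \<Rightarrow> ('a \<times> real \<Rightarrow> real) \<Rightarrow> 'a \<Rightarrow> real \<Rightarrow> real" where
  "H_init p q a b x \<tau> = \<tau> powr max 2 (min (p (x, 0)) (q (x, 0)))
     + a (x, 0) * \<tau> powr max 2 (p (x, 0)) + b (x, 0) * \<tau> powr max 2 (q (x, 0))"

definition admissible :: "'a::euclidean_space set \<Rightarrow> real
    \<Rightarrow> ('a \<times> real \<Rightarrow> real) \<Rightarrow> ('a \<times> real \<Rightarrow> real) \<Rightarrow> ('a \<times> real \<Rightarrow> real) \<Rightarrow> ('a \<times> real \<Rightarrow> real)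
    \<Rightarrow> ('a \<Rightarrow> real) \<Rightarrow> ('a \<times> real \<Rightarrow> real) \<Rightarrow> bool" where
  "admissible \<Omega> T p q a b u0 f \<longleftrightarrow>
     f \<in> L2_W12_0 \<Omega> T \<and> u0 \<in> W1_0 \<Omega> (H_init p q a b) \<and>
     (\<integral>\<^sup>+x. ennreal ((norm (weak_grad \<Omega> u0 x))\<^sup>2) \<partial>lebesgue_on \<Omega>)
       + (\<integral>\<^sup>+x. ennreal (flux_coeff p q a b (x, 0) (weak_grad \<Omega> u0 x)
             * (norm (weak_grad \<Omega> u0 x))\<^sup>2) \<partial>lebesgue_on \<Omega>) < \<infinity>"

text \<open>The boundary condition is contained in the membership in \<open>W_space\<close>.\<close>

definition strong_solution :: "'a::euclidean_space set \<Rightarrow> real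
    \<Rightarrow> ('a \<times> real \<Rightarrow> real) \<Rightarrow> ('a \<times> real \<Rightarrow> real) \<Rightarrow> ('a \<times> real \<Rightarrow> real) \<Rightarrow> ('a \<times> real \<Rightarrow> real)
    \<Rightarrow> ('a \<Rightarrow> real) \<Rightarrow> ('a \<times> real \<Rightarrow> real) \<Rightarrow> ('a \<times> real \<Rightarrow> real) \<Rightarrow> bool" where
  "strong_solution \<Omega> T p q a b u0 f u \<longleftrightarrow>
     (u \<in> W_space \<Omega> T (\<lambda>z. max (p z) (q z)) \<and>
      (\<exists>w. is_time_deriv \<Omega> T u w) \<and>
      time_deriv \<Omega> T u \<in> L_var (lebesgue_on (cyl \<Omega> T)) (\<lambda>_. 2) \<and>
      (\<lambda>z. norm (space_grad \<Omega> T u z)) \<in> Linf_L_var \<Omega> T (\<lambda>z. max 2 (min (p z) (q z)))) \<and>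
     (\<forall>\<phi>\<in>W_space \<Omega> T (\<lambda>z. max (p z) (q z)).
        (\<integral>z. time_deriv \<Omega> T u z * \<phi> z \<partial>lebesgue_on (cyl \<Omega> T))
          + (\<integral>z. (flux_coeff p q a b z (space_grad \<Omega> T u z) *\<^sub>R space_grad \<Omega> T u z)
                \<bullet> space_grad \<Omega> T \<phi> z \<partial>lebesgue_on (cyl \<Omega> T))
          = (\<integral>z. f z * \<phi> z \<partial>lebesgue_on (cyl \<Omega> T))) \<and>
     (\<forall>\<psi>. C_diff 1 \<psi> \<and> compact_support_in \<Omega> \<psi> \<longrightarrow>
        ((\<lambda>t. \<integral>x. (u (x, t) - u0 x) * \<psi> x \<partial>lebesgue_on \<Omega>) \<longlongrightarrow> 0) (at_right 0))"

end

theory Submission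
  imports Defs
begin

text \<open>
  The proof is the energy method. The test functions of the equation have no regularity in time, so a
  solution may be tested with itself, cut off at a time \<open>\<tau>\<close>, and the difference of two equations
  with the difference of the solutions, cut off in the same way. Three ingredients turn this into the theorem.

  The first one is the identity \<open>\<integral> u\<^sub>t u = (\<parallel>u(\<tau>)\<parallel>\<^sup>2 - \<parallel>u(0)\<parallel>\<^sup>2) / 2\<close> (\<open>energy_identity\<close>) for a square integrable \<open>u\<^sub>t\<close> that is a derivative
  in the weak sense only. Testing with products \<open>\<psi>(x) \<eta>(t)\<close>, where \<open>\<eta>\<close> approximates the indicator of an
  interval, shows that \<open>u(x, t)\<close> is \<open>u(x, 0)\<close> plus the integral of \<open>u\<^sub>t(x, \<cdot>)\<close> over \<open>(0, t)\<close>, for every \<open>t\<close> and almost every \<open>x\<close>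
  (\<open>slice_representation\<close>). On each time line the identity is then the equality of the integrals of a
  symmetric function over the two halves of a square. The condition at \<open>t = 0\<close> identifies \<open>u(0)\<close> with the
  initial datum, and part (a) is the weak formulation tested with \<open>u\<close>.

  The second one is monotonicity. In the energy identity for \<open>u - v\<close> the flux contributes a nonnegative
  gap. Young's inequality and an integration in time bound \<open>sup \<parallel>u - v\<parallel>\<^sup>2\<close>, and afterwards also the integral of
  the gap, by a multiple of the squared distance of the data (\<open>stability\<close>).

  The third one leads from the gap to the gradients. For every \<open>\<epsilon> > 0\<close> there is a \<open>C\<close> such that
  \<open>|\<xi> - \<eta>|\<^sup>p \<le> C (|\<xi>|\<^sup>p\<^sup>-\<^sup>2 \<xi> - |\<eta>|\<^sup>p\<^sup>-\<^sup>2 \<eta>) \<bullet> (\<xi> - \<eta>) + \<epsilon> |\<xi>|\<^sup>p\<close>, uniformly for \<open>p\<close> in a compact subset of \<open>(1, \<infinity>)\<close>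
  (\<open>norm_diff_powr_le_mono_gap\<close>); this follows from strict monotonicity by homogeneity and compactness. Taking for \<open>\<xi>\<close>
  the gradient of the fixed solution, the error term is \<open>\<epsilon>\<close> times a fixed finite energy. Since
  \<open>a + b \<ge> \<alpha>\<close>, convergence of the energy of \<open>\<nabla>(u - v)\<close> implies convergence of the integral of
  \<open>|\<nabla>(u - v)|\<close> with the smaller exponent (\<open>powr_min_le_energy\<close>).

  Gradients are given by a choice among all functions with the right integrals against test functions.
  They can be computed with because these integrals determine a function up to null sets
  (\<open>fundamental_lemma\<close>, \<open>is_weak_grad_unique\<close>, \<open>is_space_grad_unique\<close>).
\<close>

section \<open>Calculus of smooth functions\<close>

lemma C_diff_Suc_D: "C_diff (Suc k) f \<Longrightarrow> C_diff k f"
proof (induction k arbitrary: f)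
  case 0
  then have "\<forall>x. f differentiable (at x)" by simp
  then show ?case
    by (simp add: continuous_on_eq_continuous_at differentiable_imp_continuous_within)
next
  case (Suc k)
  from Suc.prems have *: "\<forall>x. f differentiable (at x)"
      "\<forall>b\<in>Basis. C_diff (Suc k) (\<lambda>x. frechet_derivative f (at x) b)"
    unfolding C_diff.simps(2)[of "Suc k"] by blast+
  show ?case
    unfolding C_diff.simps(2)[of k] using * Suc.IH by blast
qed

lemma C_diff_le: "C_diff k f \<Longrightarrow> j \<le> k \<Longrightarrow> C_diff j f"
  by (induction k) (auto simp: le_Suc_eq dest: C_diff_Suc_D simp del: C_diff.simps)

lemma C_diff_continuous: "C_diff k f \<Longrightarrow> continuous_on UNIV f"
  using C_diff_le[of k f 0] by simp

lemma C_diff_const [simp]: "C_diff k (\<lambda>_. c)"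
  by (induction k arbitrary: c) (auto simp: frechet_derivative_const)

lemma C_diff_add:
  assumes "C_diff k f" "C_diff k g"
  shows "C_diff k (\<lambda>x. f x + g x)"
  using assms
proof (induction k arbitrary: f g)
  case 0
  then show ?case by (auto intro: continuous_intros)
next
  case (Suc k)
  then have df: "\<And>x. f differentiable (at x)" and dg: "\<And>x. g differentiable (at x)" by auto
  have "frechet_derivative (\<lambda>x. f x + g x) (at x) =
      (\<lambda>b. frechet_derivative f (at x) b + frechet_derivative g (at x) b)" for x
    using df dg by (intro frechet_derivative_at[symmetric] has_derivative_add)
      (auto simp: frechet_derivative_works)
  then show ?case using Suc by auto
qed

lemma C_diff_mult:
  assumes "C_diff k f" "C_diff k g"
  shows "C_diff k (\<lambda>x. f x * g x)"
  using assms
proof (induction k arbitrary: f g)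
  case 0
  then show ?case by (auto intro: continuous_intros)
next
  case (Suc k)
  then have df: "\<And>x. f differentiable (at x)" and dg: "\<And>x. g differentiable (at x)" by auto
  have "frechet_derivative (\<lambda>x. f x * g x) (at x) =
      (\<lambda>b. f x * frechet_derivative g (at x) b + frechet_derivative f (at x) b * g x)" for x
    using df dg by (intro frechet_derivative_at[symmetric] has_derivative_mult)
      (auto simp: frechet_derivative_works)
  moreover have "C_diff k f" "C_diff k g" using Suc.prems C_diff_Suc_D by blast+
  ultimately show ?case using Suc by (auto intro!: C_diff_add)
qed

lemma C_diff_cmult: "C_diff k f \<Longrightarrow> C_diff k (\<lambda>x. c * f x)"
  by (rule C_diff_mult) auto

lemma C_diff_diff: "C_diff k f \<Longrightarrow> C_diff k g \<Longrightarrow> C_diff k (\<lambda>x. f x - g x)"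
  using C_diff_add[of k f "\<lambda>x. (-1) * g x"] C_diff_cmult[of k g "-1"] by simp

lemma C_diff_sum:
  "finite I \<Longrightarrow> (\<And>i. i \<in> I \<Longrightarrow> C_diff k (f i)) \<Longrightarrow> C_diff k (\<lambda>x. \<Sum>i\<in>I. f i x)"
  by (induction I rule: finite_induct) (auto intro!: C_diff_add)

lemma C_diff_prod:
  "finite I \<Longrightarrow> (\<And>i. i \<in> I \<Longrightarrow> C_diff k (f i)) \<Longrightarrow> C_diff k (\<lambda>x. \<Prod>i\<in>I. f i x)"
  by (induction I rule: finite_induct) (auto intro!: C_diff_mult)

lemma frechet_derivative_affine:
  fixes f :: "'b::euclidean_space \<Rightarrow> real" and L :: "'a::euclidean_space \<Rightarrow> 'b"
  assumes "\<And>x. f differentiable (at x)" "bounded_linear L"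
  shows "((\<lambda>x. f (L x + d)) has_derivative (\<lambda>b. frechet_derivative f (at (L x + d)) (L b))) (at x)"
proof -
  have "((\<lambda>x. L x + d) has_derivative L) (at x)"
    using assms(2) by (auto intro!: derivative_eq_intros bounded_linear_imp_has_derivative)
  moreover have "(f has_derivative frechet_derivative f (at (L x + d))) (at (L x + d))"
    using assms(1) frechet_derivative_works by blast
  ultimately show ?thesis
    using diff_chain_at[of "\<lambda>x. L x + d" L x f] by (simp add: o_def)
qed

text \<open>The derivative of \<open>f (L x + d)\<close> in a basis direction is a linear combination of partial
derivatives of \<open>f\<close> at \<open>L x + d\<close>, each of which has one order of smoothness less, so the
induction hypothesis applies to it.\<close>
lemma C_diff_affine:
  fixes f :: "'b::euclidean_space \<Rightarrow> real" and L :: "'a::euclidean_space \<Rightarrow> 'b"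
  assumes L: "bounded_linear L" and "C_diff k f"
  shows "C_diff k (\<lambda>x. f (L x + d))"
  using assms(2)
proof (induction k arbitrary: f)
  case 0
  then have "continuous_on UNIV f" by simp
  moreover have "continuous_on UNIV (\<lambda>x. L x + d)"
    using L by (intro continuous_intros linear_continuous_on)
  ultimately show ?case using continuous_on_compose2[of UNIV f UNIV "\<lambda>x. L x + d"] by simp
next
  case (Suc k)
  then have df: "\<And>x. f differentiable (at x)" by auto
  note D = frechet_derivative_affine[OF df L, where d=d]
  have "frechet_derivative (\<lambda>x. f (L x + d)) (at x) b =
      (\<Sum>i\<in>Basis. (L b \<bullet> i) * frechet_derivative f (at (L x + d)) i)" for x b
  proof -
    have "linear (frechet_derivative f (at (L x + d)))"
      using df by (rule linear_frechet_derivative)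
    then have "frechet_derivative f (at (L x + d)) (\<Sum>i\<in>Basis. (L b \<bullet> i) *\<^sub>R i) =
      (\<Sum>i\<in>Basis. (L b \<bullet> i) * frechet_derivative f (at (L x + d)) i)"
      by (simp add: linear_sum linear_cmul)
    then show ?thesis
      using frechet_derivative_at[OF D, of x] by (metis euclidean_representation)
  qed
  moreover have "\<And>x. (\<lambda>x. f (L x + d)) differentiable (at x)"
    using D differentiable_def by blast
  moreover have "C_diff k (\<lambda>x. frechet_derivative f (at (L x + d)) i)" if "i \<in> Basis" for i
    using Suc.IH[of "\<lambda>y. frechet_derivative f (at y) i"] Suc.prems that by simp
  ultimately show ?case by (auto intro!: C_diff_sum C_diff_cmult)
qed

lemma C_diff_inner:
  fixes f :: "real \<Rightarrow> real"
  assumes "C_diff k f"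
  shows "C_diff k (\<lambda>x::'a::euclidean_space. f (c * (x \<bullet> i) + d))"
proof -
  have "bounded_linear (\<lambda>x::'a. c * (x \<bullet> i))"
    by (intro bounded_linear_intros)
  from C_diff_affine[OF this assms] show ?thesis .
qed

text \<open>On the real line the derivative is multiplication by a number, so smoothness can be checked on
ordinary derivatives.\<close>
lemma C_diff_real_Suc:
  fixes f :: "real \<Rightarrow> real"
  assumes "\<And>x. (f has_real_derivative f' x) (at x)" "C_diff k f'"
  shows "C_diff (Suc k) f"
proof -
  have D: "(f has_derivative (\<lambda>h. f' x * h)) (at x)" for x
    using assms(1)[of x] by (simp add: has_field_derivative_def)
  have "frechet_derivative f (at x) = (\<lambda>h. f' x * h)" for x
    using frechet_derivative_at[OF D] by simp
  then show ?thesis using assms(2) D by (auto simp: differentiable_def)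
qed

lemma C_diff_real_Suc_D:
  fixes f :: "real \<Rightarrow> real"
  assumes "C_diff (Suc k) f"
  shows "(f has_real_derivative frechet_derivative f (at x) 1) (at x)"
    and "C_diff k (\<lambda>x. frechet_derivative f (at x) 1)"
proof -
  have "f differentiable (at x)" using assms by simp
  then have D: "(f has_derivative frechet_derivative f (at x)) (at x)"
    by (simp add: frechet_derivative_works)
  then have "linear (frechet_derivative f (at x))" by (rule has_derivative_linear)
  then have "frechet_derivative f (at x) = (\<lambda>h. frechet_derivative f (at x) 1 * h)"
    by (metis linear_cmul mult.commute mult.right_neutral real_scaleR_def)
  with D show "(f has_real_derivative frechet_derivative f (at x) 1) (at x)"
    by (simp add: has_field_derivative_def)
  show "C_diff k (\<lambda>x. frechet_derivative f (at x) 1)" using assms by simp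
qed

lemma C_diff_inverse:
  fixes f :: "real \<Rightarrow> real"
  assumes "C_diff k f" "\<And>x. f x \<noteq> 0"
  shows "C_diff k (\<lambda>x. inverse (f x))"
  using assms(1)
proof (induction k)
  case 0
  then show ?case using assms(2) by (auto intro!: continuous_intros)
next
  case (Suc k)
  let ?d = "\<lambda>x. frechet_derivative f (at x) 1"
  have "((\<lambda>x. inverse (f x)) has_real_derivative (-1) * (inverse (f x) * ?d x * inverse (f x))) (at x)" for x
    using DERIV_inverse'[OF C_diff_real_Suc_D(1)[OF Suc.prems, of x]] assms(2) by simp
  moreover have "C_diff k (\<lambda>x. (-1) * (inverse (f x) * ?d x * inverse (f x)))"
    using Suc.IH[OF C_diff_Suc_D[OF Suc.prems]] C_diff_real_Suc_D(2)[OF Suc.prems]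
    by (intro C_diff_cmult C_diff_mult)
  ultimately show ?case by (rule C_diff_real_Suc)
qed

section \<open>A smooth step function\<close>

text \<open>The functions \<open>x\<^sup>-\<^sup>m exp (- 1 / x)\<close>, extended by zero to \<open>x \<le> 0\<close>. The family is used instead of the
single function with \<open>m = 0\<close> because differentiation maps it into its own span.\<close>
definition flat_exp :: "nat \<Rightarrow> real \<Rightarrow> real" where
  "flat_exp m x = (if x \<le> 0 then 0 else inverse x ^ m * exp (- inverse x))"

lemma flat_exp_tendsto_0: "(flat_exp m \<longlongrightarrow> 0) (at 0)"
proof -
  have "((\<lambda>y::real. y ^ m / exp y) \<longlongrightarrow> 0) at_top" by (rule tendsto_power_div_exp_0)
  then have "((\<lambda>x::real. inverse x ^ m / exp (inverse x)) \<longlongrightarrow> 0) (at_right 0)"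
    by (rule filterlim_compose) (rule filterlim_inverse_at_top_right)
  moreover have "\<forall>\<^sub>F x in at_right 0. inverse x ^ m / exp (inverse x) = flat_exp m x"
    by (auto simp: flat_exp_def eventually_at_right_less exp_minus field_simps
        intro!: eventually_mono[OF eventually_at_right_less])
  ultimately have "(flat_exp m \<longlongrightarrow> 0) (at_right 0)" by (rule Lim_transform_eventually)
  moreover have "(flat_exp m \<longlongrightarrow> 0) (at_left 0)"
  proof (rule Lim_transform_eventually[OF tendsto_const[of 0]])
    show "\<forall>\<^sub>F x in at_left 0. 0 = flat_exp m x"
      using eventually_at_left_real[of "-1" 0] by (rule eventually_mono) (auto simp: flat_exp_def)
  qed
  ultimately show ?thesis by (simp add: filterlim_split_at)
qed

lemma flat_exp_deriv:
  "(flat_exp m has_real_derivative (flat_exp (m + 2) x - real m * flat_exp (m + 1) x)) (at x)"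
proof -
  consider "x < 0" | "x = 0" | "x > 0" by linarith
  then show ?thesis
  proof cases
    case 1
    have "((\<lambda>_. 0) has_real_derivative 0) (at x)" by simp
    then have "(flat_exp m has_real_derivative 0) (at x)"
      by (rule DERIV_cong_ev[THEN iffD1, rotated -1])
        (use 1 in \<open>auto simp: flat_exp_def intro!: eventually_mono[OF eventually_nhds_in_open[of "{..<0}"]]\<close>)
    then show ?thesis using 1 by (simp add: flat_exp_def)
  next
    case 2
    have "((\<lambda>h. (flat_exp m (0 + h) - flat_exp m 0) / h) \<longlongrightarrow> 0) (at 0)"
    proof (rule Lim_transform_eventually[OF flat_exp_tendsto_0[of "m + 1"]])
      show "\<forall>\<^sub>F h in at 0. flat_exp (m + 1) h = (flat_exp m (0 + h) - flat_exp m 0) / h"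
        by (auto simp: flat_exp_def field_simps eventually_at_filter)
    qed
    then show ?thesis using 2 by (simp add: DERIV_def flat_exp_def)
  next
    case 3
    have "((\<lambda>x. inverse x ^ m * exp (- inverse x)) has_real_derivative
        (flat_exp (m + 2) x - real m * flat_exp (m + 1) x)) (at x)"
      using 3 by (auto intro!: derivative_eq_intros simp: flat_exp_def field_simps power2_eq_square)
        (cases m; simp add: field_simps)
    then show ?thesis
      by (rule DERIV_cong_ev[THEN iffD1, rotated -1])
        (use 3 in \<open>auto simp: flat_exp_def intro!: eventually_mono[OF eventually_nhds_in_open[of "{0<..}"]]\<close>)
  qed
qed

text \<open>The derivative of a member of the family is a combination of two other members, which makes the
induction on the order of smoothness go through for all \<open>m\<close> at once.\<close>
lemma C_diff_flat_exp: "C_diff k (flat_exp m)"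
proof (induction k arbitrary: m)
  case 0
  show ?case using flat_exp_deriv DERIV_continuous
    by (auto simp: continuous_on_eq_continuous_at intro: DERIV_isCont)
next
  case (Suc k)
  show ?case by (rule C_diff_real_Suc[OF flat_exp_deriv]) (intro C_diff_diff C_diff_cmult Suc)
qed

definition smooth_step :: "real \<Rightarrow> real" where
  "smooth_step x = flat_exp 0 x / (flat_exp 0 x + flat_exp 0 (1 - x))"

lemma flat_exp_0_pos: "x > 0 \<Longrightarrow> flat_exp 0 x > 0" and flat_exp_0_nonneg: "flat_exp 0 x \<ge> 0"
  by (auto simp: flat_exp_def)

lemma smooth_step_denom: "flat_exp 0 x + flat_exp 0 (1 - x) > 0"
  using flat_exp_0_pos[of x] flat_exp_0_pos[of "1 - x"] flat_exp_0_nonneg[of x] flat_exp_0_nonneg[of "1 - x"]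
  by (cases "x > 0") (auto simp: add_pos_nonneg add_nonneg_pos)

lemma smooth_step_le_0 [simp]: "x \<le> 0 \<Longrightarrow> smooth_step x = 0"
  and smooth_step_ge_1 [simp]: "x \<ge> 1 \<Longrightarrow> smooth_step x = 1"
  and smooth_step_nonneg [simp]: "0 \<le> smooth_step x"
  and smooth_step_le_1 [simp]: "smooth_step x \<le> 1"
  using smooth_step_denom[of x] flat_exp_0_nonneg[of x] flat_exp_0_nonneg[of "1 - x"]
  by (auto simp: smooth_step_def flat_exp_def divide_simps)

lemma C_diff_smooth_step: "C_diff k smooth_step"
proof -
  have "C_diff k (\<lambda>x::real. flat_exp 0 (1 - x))"
    using C_diff_inner[OF C_diff_flat_exp[of k 0], where ?'a=real and c="-1" and d=1 and i=1]
    by (simp add: add.commute)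
  then have "C_diff k (\<lambda>x. inverse (flat_exp 0 x + flat_exp 0 (1 - x)))"
    using smooth_step_denom by (intro C_diff_inverse C_diff_add C_diff_flat_exp) (auto simp: less_le)
  then have "C_diff k (\<lambda>x. flat_exp 0 x * inverse (flat_exp 0 x + flat_exp 0 (1 - x)))"
    by (intro C_diff_mult C_diff_flat_exp)
  then show ?thesis by (simp add: smooth_step_def[abs_def] divide_inverse)
qed

section \<open>The fundamental lemma of the calculus of variations\<close>

lemma compact_support_vanish: "compact_support_in D f \<Longrightarrow> x \<notin> closure {x. f x \<noteq> 0} \<Longrightarrow> f x = 0"
  using closure_subset[of "{x. f x \<noteq> 0}"] by (metis (mono_tags) mem_Collect_eq subsetD)

lemma compact_support_inI:
  assumes "compact K" "K \<subseteq> D" and supp: "\<And>x. f x \<noteq> 0 \<Longrightarrow> x \<in> K"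
  shows "compact_support_in D f"
proof -
  have sub: "closure {x. f x \<noteq> 0} \<subseteq> K"
    using supp compact_imp_closed[OF assms(1)] by (intro closure_minimal) auto
  then have "compact (closure {x. f x \<noteq> 0})"
    using compact_Int_closed[OF assms(1) closed_closure[of "{x. f x \<noteq> 0}"]] by (simp add: inf.absorb2)
  then show ?thesis using sub assms(2) by (auto simp: compact_support_in_def)
qed

lemma compact_support_bounded:
  assumes "continuous_on UNIV f" "compact_support_in D f"
  obtains B where "\<And>x. \<bar>f x\<bar> \<le> B" "0 \<le> B"
proof -
  let ?K = "closure {x. f x \<noteq> 0}"
  have "compact (f ` ?K)"
    using assms by (intro compact_continuous_image) (auto simp: compact_support_in_def intro: continuous_on_subset)
  then have "bounded (f ` ?K)" by (rule compact_imp_bounded)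
  then obtain B where B: "\<And>x. x \<in> ?K \<Longrightarrow> \<bar>f x\<bar> \<le> B" by (auto simp: bounded_iff)
  have "\<bar>f x\<bar> \<le> max B 0" for x
    using B[of x] compact_support_vanish[OF assms(2), of x] by (cases "x \<in> ?K") auto
  then show ?thesis using that[of "max B 0"] by auto
qed

text \<open>The product lives on the compact support of \<open>\<phi>\<close>, where \<open>f\<close> is integrable and \<open>\<phi>\<close> is bounded.\<close>
lemma loc_integrable_times_test:
  fixes f :: "'a::euclidean_space \<Rightarrow> 'b::euclidean_space"
  assumes \<Omega>: "\<Omega> \<in> sets lebesgue" and f: "loc_integrable \<Omega> f"
    and cont: "continuous_on UNIV \<phi>" and supp: "compact_support_in \<Omega> \<phi>"
  shows "integrable (lebesgue_on \<Omega>) (\<lambda>x. \<phi> x *\<^sub>R f x)"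
proof -
  let ?K = "closure {x. \<phi> x \<noteq> 0}"
  have K: "compact ?K" "?K \<subseteq> \<Omega>" using supp by (auto simp: compact_support_in_def)
  then have KL: "?K \<in> sets lebesgue" by (simp add: borel_closed)
  have fK: "integrable (lebesgue_on ?K) f" using f K by (auto simp: loc_integrable_def)
  obtain B where B: "\<And>x. \<bar>\<phi> x\<bar> \<le> B" "0 \<le> B" using compact_support_bounded[OF cont supp] by blast
  have "\<phi> \<in> borel_measurable borel" using cont by (rule borel_measurable_continuous_onI)
  then have m: "\<phi> \<in> borel_measurable (lebesgue_on ?K)"
    by (simp add: measurable_completion measurable_restrict_space1)
  have "integrable (lebesgue_on ?K) (\<lambda>x. \<phi> x *\<^sub>R f x)"
  proof (rule Bochner_Integration.integrable_bound)
    show "integrable (lebesgue_on ?K) (\<lambda>x. B *\<^sub>R f x)" using fK by simp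
    show "(\<lambda>x. \<phi> x *\<^sub>R f x) \<in> borel_measurable (lebesgue_on ?K)"
      using m fK by (intro borel_measurable_scaleR) auto
    show "AE x in lebesgue_on ?K. norm (\<phi> x *\<^sub>R f x) \<le> norm (B *\<^sub>R f x)"
    proof (intro always_eventually allI)
      show "norm (\<phi> x *\<^sub>R f x) \<le> norm (B *\<^sub>R f x)" for x
        using mult_right_mono[OF B(1)[of x], of "norm (f x)"] B(2) by simp
    qed
  qed
  then have "integrable lebesgue (\<lambda>x. indicator ?K x *\<^sub>R (\<phi> x *\<^sub>R f x))"
    using KL by (subst (asm) integrable_restrict_space) auto
  also have "(\<lambda>x. indicator ?K x *\<^sub>R (\<phi> x *\<^sub>R f x)) = (\<lambda>x. indicator \<Omega> x *\<^sub>R (\<phi> x *\<^sub>R f x))"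
  proof
    show "indicator ?K x *\<^sub>R (\<phi> x *\<^sub>R f x) = indicator \<Omega> x *\<^sub>R (\<phi> x *\<^sub>R f x)" for x
    proof (cases "x \<in> ?K")
      case True
      then have "x \<in> \<Omega>" using K(2) by blast
      then show ?thesis using True by simp
    next
      case False
      then have "\<phi> x = 0" by (rule compact_support_vanish[OF supp])
      then show ?thesis by simp
    qed
  qed
  finally show ?thesis using \<Omega> by (subst integrable_restrict_space) auto
qed

text \<open>Boxes form an intersection-stable generator of the Borel sets, so by a Dynkin argument the integral
of \<open>F\<close> vanishes over every Borel set.\<close>
lemma AE_zero_if_box_integrals_zero:
  fixes F :: "'a::euclidean_space \<Rightarrow> real"
  assumes F: "integrable lborel F" and zero: "\<And>a b. (\<integral>x. indicator (box a b) x * F x \<partial>lborel) = 0"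
    and out: "\<And>x. x \<notin> box l u \<Longrightarrow> F x = 0"
  shows "AE x in lborel. F x = 0"
proof -
  have int: "integrable lborel (\<lambda>x. indicator A x * F x)" if "A \<in> sets borel" for A
    using integrable_mult_indicator[of A lborel F] F that by simp
  have tot: "(\<integral>x. F x \<partial>lborel) = 0"
  proof -
    have "(\<lambda>x. indicator (box l u) x * F x) = F" using out by (auto simp: indicator_def fun_eq_iff)
    then show ?thesis using zero[of l u] by simp
  qed
  let ?P = "\<lambda>A. (\<integral>x. indicator A x * F x \<partial>lborel) = 0"
  have "?P A" if "A \<in> sets borel" for A
  proof -
    have "Int_stable (range (\<lambda>(a::'a, b). box a b))"
      by (auto simp: Int_stable_def box_Int_box)
    moreover have "range (\<lambda>(a::'a, b). box a b) \<subseteq> Pow UNIV" by auto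
    moreover have "A \<in> sigma_sets UNIV (range (\<lambda>(a::'a, b). box a b))"
      using that by (simp add: borel_eq_box)
    ultimately show ?thesis
    proof (induction rule: sigma_sets_induct_disjoint)
      case (basic A)
      then show ?case using zero by auto
    next
      case empty
      show ?case by simp
    next
      case (compl A)
      then have A: "A \<in> sets borel" by (simp add: borel_eq_box)
      have "(\<integral>x. indicator (UNIV - A) x * F x \<partial>lborel) = (\<integral>x. F x - indicator A x * F x \<partial>lborel)"
        by (intro Bochner_Integration.integral_cong) (auto simp: indicator_def)
      also have "\<dots> = 0" using F int[OF A] tot compl by simp
      finally show ?case .
    next
      case (union A)
      then have A: "\<And>i. A i \<in> sets borel" by (auto simp: borel_eq_box)
      have "(\<integral>x. indicator (\<Union>i. A i) x * F x \<partial>lborel) = 0"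
      proof -
        have "(LINT x : (\<Union>i. A i) | lborel. F x) = (\<Sum>i. (LINT x : A i | lborel. F x))"
          using A union(1) int[of "\<Union>i. A i"]
          by (intro lebesgue_integral_countable_add) (auto simp: set_integrable_def disjoint_family_on_def)
        then show ?thesis using union by (simp add: set_lebesgue_integral_def)
      qed
      then show ?case .
    qed
  qed
  then show ?thesis
    using density_unique_real[OF F, of "\<lambda>_. 0"] by (simp add: set_lebesgue_integral_def)
qed

text \<open>Smooth approximations of the indicator function of an open box from below; every factor becomes
exactly 1 once \<open>n\<close> exceeds the reciprocal of the distance to the corresponding face.\<close>
definition box_bump :: "'a::euclidean_space \<Rightarrow> 'a \<Rightarrow> nat \<Rightarrow> 'a \<Rightarrow> real" where
  "box_bump l u n x = (\<Prod>i\<in>Basis. smooth_step (real n * (x \<bullet> i - l \<bullet> i)) * smooth_step (real n * (u \<bullet> i - x \<bullet> i)))"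

lemma C_diff_box_bump: "C_diff k (box_bump l u n)"
proof -
  have "C_diff k (\<lambda>x::'a. smooth_step (real n * (x \<bullet> i - l \<bullet> i)))" for i
    using C_diff_inner[OF C_diff_smooth_step, where c="real n" and d="- real n * (l \<bullet> i)" and i=i and k=k]
    by (simp add: algebra_simps)
  moreover have "C_diff k (\<lambda>x::'a. smooth_step (real n * (u \<bullet> i - x \<bullet> i)))" for i
    using C_diff_inner[OF C_diff_smooth_step, where c="- real n" and d="real n * (u \<bullet> i)" and i=i and k=k]
    by (simp add: algebra_simps)
  ultimately show ?thesis
    unfolding box_bump_def[abs_def] by (intro C_diff_prod C_diff_mult) auto
qed

lemma box_bump_bounds: "0 \<le> box_bump l u n x" "box_bump l u n x \<le> 1"
  unfolding box_bump_def by (auto intro!: prod_nonneg prod_le_1 mult_le_one)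

lemma box_bump_outside: "x \<notin> box l u \<Longrightarrow> box_bump l u n x = 0"
proof -
  assume "x \<notin> box l u"
  then obtain i where i: "i \<in> Basis" "x \<bullet> i - l \<bullet> i \<le> 0 \<or> u \<bullet> i - x \<bullet> i \<le> 0"
    by (force simp: mem_box)
  then have "smooth_step (real n * (x \<bullet> i - l \<bullet> i)) * smooth_step (real n * (u \<bullet> i - x \<bullet> i)) = 0"
    by (auto simp: mult_nonneg_nonpos)
  then show ?thesis unfolding box_bump_def using i(1) by (intro prod_zero) auto
qed

lemma box_bump_tendsto: "(\<lambda>n. box_bump l u n x) \<longlonglongrightarrow> indicator (box l u) x"
proof (cases "x \<in> box l u")
  case False
  then show ?thesis by (simp add: box_bump_outside)
next
  case True
  have *: "\<forall>\<^sub>F n in sequentially. smooth_step (real n * c) = 1" if "c > 0" for c :: real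
  proof -
    have "\<forall>\<^sub>F n in sequentially. 1 / c \<le> real n"
      using filterlim_real_sequentially by (simp add: filterlim_at_top)
    then show ?thesis using that by (auto elim!: eventually_mono simp: field_simps)
  qed
  have "\<forall>\<^sub>F n in sequentially. \<forall>i\<in>Basis. smooth_step (real n * (x \<bullet> i - l \<bullet> i)) = 1 \<and> smooth_step (real n * (u \<bullet> i - x \<bullet> i)) = 1"
    using True by (intro eventually_ball_finite ballI eventually_conj *) (auto simp: mem_box)
  then have "\<forall>\<^sub>F n in sequentially. indicator (box l u) x = box_bump l u n x"
    using True by (auto elim!: eventually_mono simp: box_bump_def)
  then show ?thesis by (rule Lim_transform_eventually[OF tendsto_const])
qed

lemma box_bump_test_fun:
  assumes "cbox l u \<subseteq> \<Omega>"
  shows "box_bump l u n \<in> test_fun \<Omega>"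
proof -
  have "compact_support_in \<Omega> (box_bump l u n)"
  proof (rule compact_support_inI[OF compact_cbox assms])
    show "x \<in> cbox l u" if "box_bump l u n x \<noteq> 0" for x
      using that box_bump_outside[of x l u n] box_subset_cbox[of l u] by blast
  qed
  then show ?thesis by (simp add: test_fun_def C_diff_box_bump)
qed

text \<open>Dominated convergence along the bumps \<open>box_bump\<close> turns the hypothesis into vanishing integrals over
all boxes whose closure lies in \<open>\<Omega>\<close>; countably many of these boxes cover \<open>\<Omega>\<close>.\<close>
lemma fundamental_lemma:
  fixes f :: "'a::euclidean_space \<Rightarrow> real"
  assumes \<Omega>: "open \<Omega>" and f: "loc_integrable \<Omega> f"
    and zero: "\<And>\<phi>. \<phi> \<in> test_fun \<Omega> \<Longrightarrow> (\<integral>x. f x * \<phi> x \<partial>lebesgue_on \<Omega>) = 0"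
  shows "AE x in lebesgue_on \<Omega>. f x = 0"
proof -
  have \<Omega>L: "\<Omega> \<in> sets lebesgue" using \<Omega> by (simp add: borel_open)
  have boxes: "(\<integral>x. indicator (box l u) x * f x \<partial>lebesgue) = 0"
    and int_box: "integrable lebesgue (\<lambda>x. indicator (box l u) x * f x)" if "cbox l u \<subseteq> \<Omega>" for l u
  proof -
    have "integrable (lebesgue_on (cbox l u)) f"
      using f that by (auto simp: loc_integrable_def)
    then have intK: "integrable lebesgue (\<lambda>x. indicator (cbox l u) x * f x)"
      by (subst (asm) integrable_restrict_space) auto
    have fm: "(\<lambda>x. indicator (cbox l u) x * f x) \<in> borel_measurable lebesgue"
      using intK by auto
    have bump_m: "box_bump l u n \<in> borel_measurable lebesgue" for n
      using borel_measurable_continuous_onI[OF C_diff_continuous[OF C_diff_box_bump[of 0]]]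
      by (intro measurable_completion) simp
    have eq: "box_bump l u n x * (indicator (cbox l u) x * f x) = indicator \<Omega> x * (f x * box_bump l u n x)" for n x
      using that box_bump_outside[of x l u n] box_subset_cbox[of l u]
      by (cases "x \<in> box l u") (auto simp: indicator_def)
    have "(\<lambda>n. \<integral>x. box_bump l u n x * (indicator (cbox l u) x * f x) \<partial>lebesgue)
        \<longlonglongrightarrow> (\<integral>x. indicator (box l u) x * (indicator (cbox l u) x * f x) \<partial>lebesgue)"
    proof (rule integral_dominated_convergence)
      show "integrable lebesgue (\<lambda>x. norm (indicator (cbox l u) x * f x))" using intK by simp
      show "(\<lambda>x. indicator (box l u) x * (indicator (cbox l u) x * f x)) \<in> borel_measurable lebesgue"
        by (rule borel_measurable_times[OF _ fm]) (intro borel_measurable_indicator, simp)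
      show "(\<lambda>x. box_bump l u n x * (indicator (cbox l u) x * f x)) \<in> borel_measurable lebesgue" for n
        using borel_measurable_times[OF bump_m fm] .
      show "AE x in lebesgue. (\<lambda>n. box_bump l u n x * (indicator (cbox l u) x * f x))
          \<longlonglongrightarrow> indicator (box l u) x * (indicator (cbox l u) x * f x)"
        by (intro always_eventually allI tendsto_mult_right box_bump_tendsto)
      show "AE x in lebesgue. norm (box_bump l u n x * (indicator (cbox l u) x * f x))
          \<le> norm (indicator (cbox l u) x * f x)" for n
        using box_bump_bounds[of l u n]
      proof (intro always_eventually allI)
        show "norm (box_bump l u n x * (indicator (cbox l u) x * f x)) \<le> norm (indicator (cbox l u) x * f x)" for x
          unfolding norm_mult[of "box_bump l u n x"] real_norm_def[of "box_bump l u n x"]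
            abs_of_nonneg[OF box_bump_bounds(1)]
          by (rule mult_left_le_one_le[OF norm_ge_zero box_bump_bounds])
      qed
    qed
    moreover have "(\<integral>x. box_bump l u n x * (indicator (cbox l u) x * f x) \<partial>lebesgue) = 0" for n
    proof -
      have "(\<integral>x. indicator \<Omega> x * (f x * box_bump l u n x) \<partial>lebesgue) = 0"
        using zero[OF box_bump_test_fun[OF that, of n]] \<Omega>L by (subst (asm) integral_restrict_space) auto
      then show ?thesis by (simp only: eq)
    qed
    moreover have "indicator (box l u) x * (indicator (cbox l u) x * f x) = indicator (box l u) x * f x" for x
      using box_subset_cbox[of l u] by (auto simp: indicator_def)
    ultimately show "(\<integral>x. indicator (box l u) x * f x \<partial>lebesgue) = 0"
      by (simp add: LIMSEQ_const_iff)
    have "integrable lebesgue (\<lambda>x. indicator (box l u) x *\<^sub>R (indicator (cbox l u) x * f x))"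
      using intK by (intro integrable_mult_indicator) auto
    moreover have "(\<lambda>x. indicator (box l u) x *\<^sub>R (indicator (cbox l u) x * f x)) = (\<lambda>x. indicator (box l u) x * f x)"
      using box_subset_cbox[of l u] by (auto simp: indicator_def fun_eq_iff)
    ultimately show "integrable lebesgue (\<lambda>x. indicator (box l u) x * f x)" by simp
  qed
  have AE_box: "AE x in lebesgue. x \<in> box l u \<longrightarrow> f x = 0" if sub: "cbox l u \<subseteq> \<Omega>" for l u
  proof -
    let ?g = "\<lambda>x. indicator (box l u) x * f x"
    obtain g0 where g0: "g0 \<in> borel_measurable lborel" "AE x in lborel. ?g x = g0 x"
      using completion_ex_borel_measurable_real[OF borel_measurable_integrable[OF int_box[OF sub]]] by blast
    define F where "F x = indicator (box l u) x * g0 x" for x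
    have Fm: "F \<in> borel_measurable lborel" unfolding F_def using g0(1) by measurable
    have "AE x in lborel. ?g x = F x" using g0(2) by eventually_elim (auto simp: F_def indicator_def)
    then have AEF': "AE x in lebesgue. ?g x = F x" by (rule AE_completion)
    have intF: "integrable lborel F"
    proof -
      have "integrable lebesgue F"
        using int_box[OF sub] AEF' Fm by (subst integrable_cong_AE[symmetric, of ?g]) (auto simp: measurable_completion)
      then show ?thesis using integrable_completion[OF Fm] by simp
    qed
    have "AE x in lborel. F x = 0"
    proof (rule AE_zero_if_box_integrals_zero[OF intF])
      show "F x = 0" if "x \<notin> box l u" for x using that by (simp add: F_def)
      show "(\<integral>x. indicator (box a b) x * F x \<partial>lborel) = 0" for a b
      proof -
        obtain c d where cd: "box a b \<inter> box l u = box c d" using box_Int_box[of a b l u] by blast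
        have "\<exists>c d. box a b \<inter> box l u = box c d \<and> cbox c d \<subseteq> \<Omega>"
        proof (cases "box a b \<inter> box l u = {}")
          case True
          (* box One 0 is an empty box whose closed box is empty as well *)
          have "cbox (One::'a) 0 = {}" by (rule empty_as_interval[symmetric])
          then have "box a b \<inter> box l u = box (One::'a) 0 \<and> cbox (One::'a) 0 \<subseteq> \<Omega>"
            using True box_subset_cbox[of "One::'a" 0] by auto
          then show ?thesis by blast
        next
          case False
          then have "closure (box c d) = cbox c d" "box c d \<subseteq> cbox l u"
            using cd box_subset_cbox[of l u] by auto
          then have "cbox c d \<subseteq> cbox l u" using closure_minimal[OF _ closed_cbox, of "box c d" l u] by simp
          then show ?thesis using cd sub by blast
        qed
        then obtain c d where cd: "box a b \<inter> box l u = box c d" "cbox c d \<subseteq> \<Omega>" by blast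
        have "(\<integral>x. indicator (box a b) x * F x \<partial>lborel) = (\<integral>x. indicator (box a b) x * F x \<partial>lebesgue)"
          using Fm by (subst integral_completion) auto
        also have "\<dots> = (\<integral>x. indicator (box c d) x * f x \<partial>lebesgue)"
        proof (rule integral_cong_AE)
          show "(\<lambda>x. indicator (box a b) x * F x) \<in> borel_measurable lebesgue"
            using Fm by (intro borel_measurable_times) (auto simp: measurable_completion)
          show "(\<lambda>x. indicator (box c d) x * f x) \<in> borel_measurable lebesgue"
            using int_box[OF cd(2)] by auto
          show "AE x in lebesgue. indicator (box a b) x * F x = indicator (box c d) x * f x"
            using AEF'
          proof eventually_elim
            case (elim x)
            have "indicator (box c d) x = (indicator (box a b) x * indicator (box l u) x :: real)"
              unfolding cd(1)[symmetric] by (rule indicator_inter_arith)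
            then show ?case using elim by simp
          qed
        qed
        also have "\<dots> = 0" using boxes[OF cd(2)] .
        finally show ?thesis .
      qed
    qed
    then have "AE x in lebesgue. F x = 0" by (rule AE_completion)
    with AEF' show ?thesis by eventually_elim (auto simp: indicator_def)
  qed
  obtain \<D> where \<D>: "countable \<D>" "\<And>X. X \<in> \<D> \<Longrightarrow> \<exists>a b. X = box a b \<and> cbox a b \<subseteq> \<Omega>" "\<Union>\<D> = \<Omega>"
  proof -

    let ?C = "{X. \<exists>a b. X = box a b \<and> cbox a b \<subseteq> \<Omega>}"
    have "\<Union>?C = \<Omega>"
    proof
      show "\<Union>?C \<subseteq> \<Omega>" using box_subset_cbox by blast
      show "\<Omega> \<subseteq> \<Union>?C"
      proof
        fix x assume x: "x \<in> \<Omega>"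
        obtain a b where "cbox a b \<subseteq> \<Omega>" "x \<in> box a b"
          by (rule open_contains_cbox[OF \<Omega> x])
        then have "box a b \<in> ?C" "x \<in> box a b" by auto
        then show "x \<in> \<Union>?C" by (rule UnionI)
      qed
    qed
    moreover obtain \<F> where "\<F> \<subseteq> ?C" "countable \<F>" "\<Union>\<F> = \<Union>?C"
    proof (rule Lindelof[of ?C])
      fix S assume "S \<in> ?C"
      then obtain a b where "S = box a b" by blast
      then show "open S" by (simp add: open_box)
    qed
    ultimately show ?thesis by (intro that[of \<F>]) auto
  qed
  have "AE x in lebesgue. \<forall>X\<in>\<D>. x \<in> X \<longrightarrow> f x = 0"
  proof (subst AE_ball_countable[OF \<D>(1)], intro ballI)
    fix X assume "X \<in> \<D>"
    then obtain a b where "X = box a b" "cbox a b \<subseteq> \<Omega>" using \<D>(2) by blast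
    then show "AE x in lebesgue. x \<in> X \<longrightarrow> f x = 0" using AE_box by simp
  qed
  then have "AE x in lebesgue. x \<in> \<Omega> \<longrightarrow> f x = 0"
    by eventually_elim (use \<D>(3) in blast)
  then show ?thesis using \<Omega>L by (subst AE_restrict_space_iff) auto
qed

section \<open>Integration by parts for test functions\<close>

lemma compact_support_subset_union:
  assumes "compact_support_in D f" "compact_support_in D g" "\<And>x. h x \<noteq> 0 \<Longrightarrow> f x \<noteq> 0 \<or> g x \<noteq> 0"
  shows "compact_support_in D h"
proof (rule compact_support_inI[of "closure {x. f x \<noteq> 0} \<union> closure {x. g x \<noteq> 0}"])
  show "x \<in> closure {x. f x \<noteq> 0} \<union> closure {x. g x \<noteq> 0}" if "h x \<noteq> 0" for x
    using assms(3)[OF that] closure_subset[of "{x. f x \<noteq> 0}"] closure_subset[of "{x. g x \<noteq> 0}"] by blast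
qed (use assms(1,2) in \<open>auto simp: compact_support_in_def\<close>)

lemma test_fun_diff: "\<phi> \<in> test_fun D \<Longrightarrow> \<psi> \<in> test_fun D \<Longrightarrow> (\<lambda>x. \<phi> x - \<psi> x) \<in> test_fun D"
  unfolding test_fun_def using compact_support_subset_union[of D \<phi> \<psi> "\<lambda>x. \<phi> x - \<psi> x"]
  by (auto intro!: C_diff_diff)

lemma test_fun_mult: "\<phi> \<in> test_fun D \<Longrightarrow> \<psi> \<in> test_fun D \<Longrightarrow> (\<lambda>x. \<phi> x * \<psi> x) \<in> test_fun D"
  unfolding test_fun_def using compact_support_subset_union[of D \<phi> \<psi> "\<lambda>x. \<phi> x * \<psi> x"]
  by (auto intro!: C_diff_mult)

lemma test_fun_zero [simp]: "(\<lambda>_. 0) \<in> test_fun D"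
  by (simp add: test_fun_def compact_support_in_def)

lemma test_fun_D:
  assumes "\<phi> \<in> test_fun D"
  shows "C_diff k \<phi>" "continuous_on UNIV \<phi>" "compact_support_in D \<phi>" "\<phi> differentiable (at x)"
    "b \<in> Basis \<Longrightarrow> continuous_on UNIV (\<lambda>x. frechet_derivative \<phi> (at x) b)"
proof -
  show "C_diff k \<phi>" "compact_support_in D \<phi>" for k using assms by (auto simp: test_fun_def)
  then have "C_diff 1 \<phi>" by blast
  then show "continuous_on UNIV \<phi>" "\<phi> differentiable (at x)"
    "b \<in> Basis \<Longrightarrow> continuous_on UNIV (\<lambda>x. frechet_derivative \<phi> (at x) b)"
    using C_diff_continuous[of 1 \<phi>] by (auto simp: One_nat_def)
qed

lemma derivative_compact_support:
  assumes "compact_support_in D h" "\<And>x. h differentiable (at x)"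
  shows "compact_support_in D (\<lambda>x. frechet_derivative h (at x) b)"
proof -
  let ?K = "closure {x. h x \<noteq> 0}"
  have "frechet_derivative h (at x) b = 0" if x: "x \<notin> ?K" for x
  proof -
    have "(h has_derivative (\<lambda>_. 0)) (at x)"
    proof (rule has_derivative_transform_within_open[of "\<lambda>_. 0" _ _ _ "- ?K"])
      show "0 = h y" if "y \<in> - ?K" for y
        using compact_support_vanish[OF assms(1)] that by (metis ComplD)
    qed (use x in auto)
    then show ?thesis by (metis frechet_derivative_at)
  qed
  then have supp: "x \<in> ?K" if "frechet_derivative h (at x) b \<noteq> 0" for x using that by blast
  have "compact ?K" "?K \<subseteq> D" using assms(1) by (auto simp: compact_support_in_def)
  then show ?thesis by (rule compact_support_inI[OF _ _ supp])
qed

lemma lborel_integral_translation: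
  fixes f :: "'a::euclidean_space \<Rightarrow> real"
  assumes "integrable lborel f"
  shows "integrable lborel (\<lambda>x. f (x + c))" "(\<integral>x. f (x + c) \<partial>lborel) = (\<integral>x. f x \<partial>lborel)"
proof -
  have "integrable (distr lborel borel ((+) c)) f" using assms by (simp add: lborel_distr_plus)
  then show "integrable lborel (\<lambda>x. f (x + c))"
    using assms by (subst (asm) integrable_distr_eq) (auto simp: add.commute)
  have "(\<integral>x. f x \<partial>lborel) = (\<integral>x. f x \<partial>distr lborel borel ((+) c))" by (simp add: lborel_distr_plus)
  also have "\<dots> = (\<integral>x. f (c + x) \<partial>lborel)" using assms by (intro integral_distr) auto
  finally show "(\<integral>x. f (x + c) \<partial>lborel) = (\<integral>x. f x \<partial>lborel)" by (simp add: add.commute)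
qed

text \<open>By translation invariance the difference quotients of \<open>h\<close> have integral zero. They converge to the
derivative and, by the mean value theorem, are dominated by a multiple of the indicator of a ball.\<close>
lemma integral_derivative_compact_support:
  fixes h :: "'a::euclidean_space \<Rightarrow> real"
  assumes h: "C_diff 1 h" "compact_support_in UNIV h" and b: "b \<in> Basis"
  shows "(\<integral>x. frechet_derivative h (at x) b \<partial>lborel) = 0"
proof -
  let ?D = "\<lambda>x. frechet_derivative h (at x) b"
  have hc: "continuous_on UNIV h" using C_diff_continuous[OF h(1)] .
  have hd: "h differentiable (at x)" for x using h(1) by simp
  have Dc: "continuous_on UNIV ?D" using h(1) b by simp
  obtain B where B: "\<And>x. \<bar>?D x\<bar> \<le> B" "0 \<le> B"
    using compact_support_bounded[OF Dc derivative_compact_support[OF h(2) hd]] by blast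
  have "bounded (closure {x. h x \<noteq> 0})"
    using h(2) by (auto simp: compact_support_in_def intro: compact_imp_bounded)
  then obtain R where R: "\<And>x. x \<in> closure {x. h x \<noteq> 0} \<Longrightarrow> norm x \<le> R" by (auto simp: bounded_iff)
  have h0: "h x = 0" if "norm x > R" for x
    using R[of x] that compact_support_vanish[OF h(2), of x] by force
  have h_int: "integrable lborel h"
  proof -
    have "integrable lborel (\<lambda>x. indicator (cball 0 R) x *\<^sub>R h x)"
      using hc by (intro borel_integrable_compact) (auto intro: continuous_on_subset)
    moreover have "(\<lambda>x. indicator (cball 0 R) x *\<^sub>R h x) = h"
      using h0 by (fastforce simp: indicator_def not_le)
    ultimately show ?thesis by simp
  qed
  have line: "((\<lambda>t. h (x + t *\<^sub>R b)) has_real_derivative ?D (x + t *\<^sub>R b)) (at t)" for x t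
  proof -
    have "((\<lambda>t. x + t *\<^sub>R b) has_derivative (\<lambda>t. t *\<^sub>R b)) (at t)"
      by (auto intro!: derivative_eq_intros)
    moreover have "(h has_derivative frechet_derivative h (at (x + t *\<^sub>R b))) (at (x + t *\<^sub>R b))"
      using hd frechet_derivative_works by blast
    ultimately have "((\<lambda>t. h (x + t *\<^sub>R b)) has_derivative
        (\<lambda>s. frechet_derivative h (at (x + t *\<^sub>R b)) (s *\<^sub>R b))) (at t)"
      using diff_chain_at[of "\<lambda>t. x + t *\<^sub>R b" "\<lambda>t. t *\<^sub>R b" t h] by (simp add: o_def)
    moreover have "frechet_derivative h (at (x + t *\<^sub>R b)) (s *\<^sub>R b) = ?D (x + t *\<^sub>R b) * s" for s
      using linear_cmul[OF linear_frechet_derivative[OF hd]] by (simp add: mult.commute)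
    ultimately show ?thesis by (simp add: has_field_derivative_def)
  qed
  define s :: "nat \<Rightarrow> real" where "s n = inverse (real (Suc n))" for n
  have s: "0 < s n" "s n \<le> 1" for n by (auto simp: s_def inverse_le_1_iff)
  have s0: "filterlim s (at 0) sequentially"
    using LIMSEQ_inverse_real_of_nat s(1) by (auto simp: filterlim_at s_def[abs_def])
  define q where "q n x = (h (x + s n *\<^sub>R b) - h x) / s n" for n x
  have "(\<lambda>n. \<integral>x. q n x \<partial>lborel) \<longlonglongrightarrow> (\<integral>x. ?D x \<partial>lborel)"
  proof (rule integral_dominated_convergence)
    show "?D \<in> borel_measurable lborel" using borel_measurable_continuous_onI[OF Dc] by simp
    have hm: "h \<in> borel_measurable borel" using hc by (rule borel_measurable_continuous_onI)
    show "q n \<in> borel_measurable lborel" for n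
      unfolding q_def[abs_def] using hm by measurable
    have "integrable lborel (indicator (cball (0::'a) (R + 1)) :: 'a \<Rightarrow> real)"
      using emeasure_lborel_cball_finite[of "0::'a" "R + 1"] by (intro integrable_real_indicator) auto
    then show "integrable lborel (\<lambda>x. B * indicator (cball (0::'a) (R + 1)) x)" by simp
    show "AE x in lborel. (\<lambda>n. q n x) \<longlonglongrightarrow> ?D x"
    proof (intro always_eventually allI)
      fix x
      have "((\<lambda>t. (h (x + (0 + t) *\<^sub>R b) - h (x + 0 *\<^sub>R b)) / t) \<longlongrightarrow> ?D (x + 0 *\<^sub>R b)) (at 0)"
        using line[of x 0] unfolding DERIV_def .
      from filterlim_compose[OF this s0] show "(\<lambda>n. q n x) \<longlonglongrightarrow> ?D x" by (simp add: q_def)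
    qed
    show "AE x in lborel. norm (q n x) \<le> B * indicator (cball (0::'a) (R + 1)) x" for n
    proof (intro always_eventually allI)
      fix x
      show "norm (q n x) \<le> B * indicator (cball (0::'a) (R + 1)) x"
      proof (cases "norm x \<le> R + 1")
        case True
        obtain z where "h (x + s n *\<^sub>R b) - h (x + 0 *\<^sub>R b) = (s n - 0) * ?D (x + z *\<^sub>R b)"
          using MVT2[OF s(1)[of n], of "\<lambda>t. h (x + t *\<^sub>R b)" "\<lambda>t. ?D (x + t *\<^sub>R b)"] line by blast
        then have "q n x = ?D (x + z *\<^sub>R b)" using s(1)[of n] by (simp add: q_def)
        then show ?thesis using B(1) True by simp
      next
        case False
        (* steps have length at most 1, so both points of the quotient miss the support *)
        have "norm x \<le> norm (x + s n *\<^sub>R b) + norm (s n *\<^sub>R b)"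
          using norm_triangle_ineq4[of "x + s n *\<^sub>R b" "s n *\<^sub>R b"] by simp
        also have "norm (s n *\<^sub>R b) \<le> 1" using s[of n] b by simp
        finally have "norm (x + s n *\<^sub>R b) > R" using False by simp
        then have "q n x = 0" using False h0 by (simp add: q_def)
        then show ?thesis using False by simp
      qed
    qed
  qed
  moreover have "(\<integral>x. q n x \<partial>lborel) = 0" for n
    using lborel_integral_translation[OF h_int, of "s n *\<^sub>R b"] h_int by (simp add: q_def)
  ultimately show ?thesis by (simp add: LIMSEQ_const_iff)
qed

section \<open>Weak gradients\<close>

lemma loc_integrable_continuous:
  fixes f :: "'a::euclidean_space \<Rightarrow> 'b::euclidean_space"
  assumes "continuous_on UNIV f" shows "loc_integrable D f"
  unfolding loc_integrable_def
proof (intro allI impI)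
  fix K assume K: "compact K \<and> K \<subseteq> D"
  then have "integrable lborel (\<lambda>x. indicator K x *\<^sub>R f x)"
    using assms by (intro borel_integrable_compact) (auto intro: continuous_on_subset)
  then have "integrable lebesgue (\<lambda>x. indicator K x *\<^sub>R f x)"
    by (subst integrable_completion) auto
  then show "integrable (lebesgue_on K) f"
    using K by (subst integrable_restrict_space) (auto simp: borel_compact)
qed

lemma loc_integrable_diff:
  "loc_integrable D f \<Longrightarrow> loc_integrable D g \<Longrightarrow> loc_integrable D (\<lambda>x. f x - g x)"
  by (auto simp: loc_integrable_def)

lemma loc_integrable_inner: "loc_integrable D f \<Longrightarrow> loc_integrable D (\<lambda>x. f x \<bullet> b)"
  by (auto simp: loc_integrable_def)

definition classical_grad :: "('a::euclidean_space \<Rightarrow> real) \<Rightarrow> 'a \<Rightarrow> 'a" where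
  "classical_grad \<phi> x = (\<Sum>b\<in>Basis. frechet_derivative \<phi> (at x) b *\<^sub>R b)"

lemma integrable_loc_times_test:
  fixes f :: "'a::euclidean_space \<Rightarrow> real"
  assumes "open \<Omega>" "loc_integrable \<Omega> f" "\<phi> \<in> test_fun \<Omega>"
  shows "integrable (lebesgue_on \<Omega>) (\<lambda>x. f x * \<phi> x)"
    and "b \<in> Basis \<Longrightarrow> integrable (lebesgue_on \<Omega>) (\<lambda>x. f x * frechet_derivative \<phi> (at x) b)"
proof -
  have \<Omega>: "\<Omega> \<in> sets lebesgue" using assms(1) by simp
  show "integrable (lebesgue_on \<Omega>) (\<lambda>x. f x * \<phi> x)"
    using loc_integrable_times_test[OF \<Omega> assms(2) test_fun_D(2,3)[OF assms(3)]] by (simp add: mult.commute)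
  show "integrable (lebesgue_on \<Omega>) (\<lambda>x. f x * frechet_derivative \<phi> (at x) b)" if "b \<in> Basis"
    using loc_integrable_times_test[OF \<Omega> assms(2) test_fun_D(5)[OF assms(3) that]
      derivative_compact_support[OF test_fun_D(3,4)[OF assms(3)]]] by (simp add: mult.commute)
qed

text \<open>For a product of test functions the integral of its derivative vanishes, which is the rule of
integration by parts. It identifies the weak gradients of the approximating test functions in the
definition of \<open>W1_0\<close>.\<close>
lemma is_weak_grad_test_fun:
  assumes \<Omega>: "open \<Omega>" and \<phi>: "\<phi> \<in> test_fun \<Omega>"
  shows "is_weak_grad \<Omega> \<phi> (classical_grad \<phi>)"
  unfolding is_weak_grad_def
proof (intro conjI ballI)
  show 1: "loc_integrable \<Omega> \<phi>" by (rule loc_integrable_continuous[OF test_fun_D(2)[OF \<phi>]])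
  have "continuous_on UNIV (classical_grad \<phi>)"
    unfolding classical_grad_def[abs_def] by (intro continuous_intros test_fun_D(5)[OF \<phi>])
  then show 2: "loc_integrable \<Omega> (classical_grad \<phi>)" by (rule loc_integrable_continuous)
  fix \<psi> :: "'a \<Rightarrow> real" and b :: 'a assume \<psi>: "\<psi> \<in> test_fun \<Omega>" and b: "b \<in> Basis"
  have grad: "classical_grad \<phi> x \<bullet> b = frechet_derivative \<phi> (at x) b" for x
    using b unfolding classical_grad_def by (simp add: inner_sum_left inner_Basis if_distrib sum.delta cong: if_cong)
  let ?h = "\<lambda>x. \<phi> x * \<psi> x"
  have h: "?h \<in> test_fun \<Omega>" using \<phi> \<psi> by (rule test_fun_mult)
  have D: "frechet_derivative ?h (at x) b = \<phi> x * frechet_derivative \<psi> (at x) b + frechet_derivative \<phi> (at x) b * \<psi> x" for x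
  proof -
    have "(?h has_derivative (\<lambda>b. \<phi> x * frechet_derivative \<psi> (at x) b + frechet_derivative \<phi> (at x) b * \<psi> x)) (at x)"
      using test_fun_D(4)[OF \<phi>] test_fun_D(4)[OF \<psi>]
      by (intro has_derivative_mult) (auto simp: frechet_derivative_works)
    from frechet_derivative_at[OF this] show ?thesis by metis
  qed
  have hsupp: "compact_support_in \<Omega> ?h" using test_fun_D(3)[OF h] .
  then have "(\<integral>x. frechet_derivative ?h (at x) b \<partial>lborel) = 0"
    using test_fun_D(1)[OF h] b by (intro integral_derivative_compact_support) (auto simp: compact_support_in_def)
  moreover have "(\<lambda>x. indicator \<Omega> x *\<^sub>R frechet_derivative ?h (at x) b) = (\<lambda>x. frechet_derivative ?h (at x) b)"
  proof
    fix x
    show "indicator \<Omega> x *\<^sub>R frechet_derivative ?h (at x) b = frechet_derivative ?h (at x) b"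
      using compact_support_vanish[OF derivative_compact_support[OF hsupp test_fun_D(4)[OF h]], of x b]
        derivative_compact_support[OF hsupp test_fun_D(4)[OF h], of b]
      by (cases "x \<in> \<Omega>") (auto simp: compact_support_in_def)
  qed
  moreover have "(\<lambda>x. frechet_derivative ?h (at x) b) \<in> borel_measurable lborel"
    using borel_measurable_continuous_onI[OF test_fun_D(5)[OF h b]] by simp
  ultimately have "(\<integral>x. frechet_derivative ?h (at x) b \<partial>lebesgue_on \<Omega>) = 0"
    using \<Omega> by (subst integral_restrict_space) (auto simp: integral_completion)
  then have "(\<integral>x. \<phi> x * frechet_derivative \<psi> (at x) b + (classical_grad \<phi> x \<bullet> b) * \<psi> x \<partial>lebesgue_on \<Omega>) = 0"
    by (simp only: D grad)
  then show "(\<integral>x. \<phi> x * frechet_derivative \<psi> (at x) b \<partial>lebesgue_on \<Omega>)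
      = - (\<integral>x. (classical_grad \<phi> x \<bullet> b) * \<psi> x \<partial>lebesgue_on \<Omega>)"
    using integrable_loc_times_test(2)[OF \<Omega> 1 \<psi> b]
      integrable_loc_times_test(1)[OF \<Omega> loc_integrable_inner[OF 2] \<psi>, of b]
    by simp
qed

text \<open>The reason why a weak gradient picked by the choice operator can be computed with, up to null sets.\<close>
lemma is_weak_grad_unique:
  assumes \<Omega>: "open \<Omega>" and 1: "is_weak_grad \<Omega> u v" and 2: "is_weak_grad \<Omega> u w"
  shows "AE x in lebesgue_on \<Omega>. v x = w x"
proof -
  have loc: "loc_integrable \<Omega> v" "loc_integrable \<Omega> w" using 1 2 by (auto simp: is_weak_grad_def)
  have "AE x in lebesgue_on \<Omega>. v x \<bullet> b - w x \<bullet> b = 0" if b: "b \<in> Basis" for b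
  proof (rule fundamental_lemma[OF \<Omega>])
    show "loc_integrable \<Omega> (\<lambda>x. v x \<bullet> b - w x \<bullet> b)"
      by (intro loc_integrable_diff loc_integrable_inner loc)
    fix \<phi> assume \<phi>: "\<phi> \<in> test_fun \<Omega>"
    have "(\<integral>x. (v x \<bullet> b) * \<phi> x \<partial>lebesgue_on \<Omega>) = (\<integral>x. (w x \<bullet> b) * \<phi> x \<partial>lebesgue_on \<Omega>)"
    proof -
      have "(\<integral>x. u x * frechet_derivative \<phi> (at x) b \<partial>lebesgue_on \<Omega>) = - (\<integral>x. (v x \<bullet> b) * \<phi> x \<partial>lebesgue_on \<Omega>)"
        using 1 \<phi> b unfolding is_weak_grad_def by blast
      moreover have "(\<integral>x. u x * frechet_derivative \<phi> (at x) b \<partial>lebesgue_on \<Omega>) = - (\<integral>x. (w x \<bullet> b) * \<phi> x \<partial>lebesgue_on \<Omega>)"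
        using 2 \<phi> b unfolding is_weak_grad_def by blast
      ultimately show ?thesis by linarith
    qed
    then show "(\<integral>x. (v x \<bullet> b - w x \<bullet> b) * \<phi> x \<partial>lebesgue_on \<Omega>) = 0"
      using integrable_loc_times_test(1)[OF \<Omega> loc_integrable_inner[OF loc(1)] \<phi>, of b]
        integrable_loc_times_test(1)[OF \<Omega> loc_integrable_inner[OF loc(2)] \<phi>, of b]
      by (simp add: left_diff_distrib)
  qed
  then have "AE x in lebesgue_on \<Omega>. \<forall>b\<in>Basis. v x \<bullet> b - w x \<bullet> b = 0"
    by (intro AE_finite_allI) auto
  then show ?thesis by eventually_elim (simp add: euclidean_eq_iff[of "v _"])
qed

lemma weak_grad_AE_eq:
  assumes "open \<Omega>" "is_weak_grad \<Omega> u w"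
  shows "AE x in lebesgue_on \<Omega>. weak_grad \<Omega> u x = w x"
  unfolding weak_grad_def
  by (rule is_weak_grad_unique[OF assms(1) someI[of "is_weak_grad \<Omega> u", OF assms(2)] assms(2)])

lemma is_weak_grad_diff:
  assumes \<Omega>: "open \<Omega>" and 1: "is_weak_grad \<Omega> u1 w1" and 2: "is_weak_grad \<Omega> u2 w2"
  shows "is_weak_grad \<Omega> (\<lambda>x. u1 x - u2 x) (\<lambda>x. w1 x - w2 x)"
  unfolding is_weak_grad_def
proof (intro conjI ballI)
  have l: "loc_integrable \<Omega> u1" "loc_integrable \<Omega> u2" "loc_integrable \<Omega> w1" "loc_integrable \<Omega> w2"
    using 1 2 by (auto simp: is_weak_grad_def)
  then show "loc_integrable \<Omega> (\<lambda>x. u1 x - u2 x)" "loc_integrable \<Omega> (\<lambda>x. w1 x - w2 x)"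
    by (auto intro: loc_integrable_diff)
  fix \<phi> :: "'a \<Rightarrow> real" and b :: 'a assume \<phi>: "\<phi> \<in> test_fun \<Omega>" and b: "b \<in> Basis"
  note I = integrable_loc_times_test(2)[OF \<Omega> _ \<phi> b] integrable_loc_times_test(1)[OF \<Omega> loc_integrable_inner \<phi>]
  have "(\<integral>x. u1 x * frechet_derivative \<phi> (at x) b \<partial>lebesgue_on \<Omega>) = - (\<integral>x. (w1 x \<bullet> b) * \<phi> x \<partial>lebesgue_on \<Omega>)"
    "(\<integral>x. u2 x * frechet_derivative \<phi> (at x) b \<partial>lebesgue_on \<Omega>) = - (\<integral>x. (w2 x \<bullet> b) * \<phi> x \<partial>lebesgue_on \<Omega>)"
    using 1 2 \<phi> b by (auto simp: is_weak_grad_def)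
  then show "(\<integral>x. (u1 x - u2 x) * frechet_derivative \<phi> (at x) b \<partial>lebesgue_on \<Omega>)
      = - (\<integral>x. ((w1 x - w2 x) \<bullet> b) * \<phi> x \<partial>lebesgue_on \<Omega>)"
    using I(1)[OF l(1)] I(1)[OF l(2)] I(2)[OF l(3), of b] I(2)[OF l(4), of b]
    by (simp add: left_diff_distrib inner_diff_left)
qed

lemma is_weak_grad_zero: "open \<Omega> \<Longrightarrow> is_weak_grad \<Omega> (\<lambda>_. 0) (\<lambda>_. 0)"
  by (auto simp: is_weak_grad_def loc_integrable_def)

section \<open>Fubini's theorem for Lebesgue measurable functions\<close>

lemma sets_lborel_prod_Times:
  fixes A :: "'a::euclidean_space set" and B :: "'b::euclidean_space set"
  assumes "A \<in> sets borel" "B \<in> sets borel"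
  shows "A \<times> B \<in> sets borel"
proof -
  have "A \<times> B \<in> sets (borel \<Otimes>\<^sub>M borel)" using assms by (rule pair_measureI)
  then show ?thesis by (simp only: borel_prod)
qed

lemma AE_lebesgue_on_iff:
  "A \<in> sets borel \<Longrightarrow> (AE x in lebesgue_on A. P x) \<longleftrightarrow> (AE x in lborel. x \<in> A \<longrightarrow> P x)"
  by (subst AE_restrict_space_iff) (auto simp: AE_completion_iff)

text \<open>On the product, \<open>lborel\<close> is the product measure, so a Borel set is null if and only if almost all of
its horizontal slices are. Statements for the completed measure are reduced to this one.\<close>
lemma AE_lborel_swap:
  fixes N :: "('a::euclidean_space \<times> 'b::euclidean_space) set"
  assumes "N \<in> sets borel"
  shows "(AE z in lborel. z \<notin> N) \<longleftrightarrow> (AE y in lborel. AE x in lborel. (x, y) \<notin> N)"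
proof -
  have N: "N \<in> sets ((lborel :: 'a measure) \<Otimes>\<^sub>M (lborel :: 'b measure))"
    using assms by (simp only: lborel_prod sets_lborel)
  have m: "{z \<in> space ((lborel :: 'a measure) \<Otimes>\<^sub>M (lborel :: 'b measure)). (fst z, snd z) \<notin> N}
      \<in> sets ((lborel :: 'a measure) \<Otimes>\<^sub>M (lborel :: 'b measure))"
    using sets.compl_sets[OF N] by (simp add: set_diff_eq)
  have "(AE z in lborel. z \<notin> N) \<longleftrightarrow> (AE z in (lborel :: 'a measure) \<Otimes>\<^sub>M (lborel :: 'b measure). (fst z, snd z) \<notin> N)"
    unfolding lborel_prod by simp
  also have "\<dots> \<longleftrightarrow> (AE x in lborel. AE y in lborel. (x, y) \<notin> N)"
    using lborel_pair.AE_pair_iff[OF m] by simp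
  also have "\<dots> \<longleftrightarrow> (AE y in lborel. AE x in lborel. (x, y) \<notin> N)"
    using lborel_pair.AE_commute[OF m] by simp
  finally show ?thesis .
qed

lemma AE_lborel_slices:
  assumes "AE z in lborel. P z"
  shows "AE y in lborel. AE x in lborel. P (x :: 'a::euclidean_space, y :: 'b::euclidean_space)"
proof -
  obtain N where N: "N \<in> null_sets lborel" "{z. \<not> P z} \<subseteq> N"
    using assms by (auto simp: eventually_ae_filter)
  then have "AE z in lborel. z \<notin> N" "N \<in> sets borel" by (auto intro: AE_not_in)
  then have "AE y in lborel. AE x in lborel. (x, y) \<notin> N" using AE_lborel_swap by blast
  then show ?thesis
  proof eventually_elim
    case (elim y)
    then show ?case by eventually_elim (use N(2) in auto)
  qed
qed

text \<open>By measurability the exceptional set differs from a Borel set by a subset of a null set, and Borel sets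
are covered by \<open>AE_lborel_swap\<close>.\<close>
lemma AE_from_slices:
  fixes A :: "'a::euclidean_space set" and B :: "'b::euclidean_space set"
  assumes A: "A \<in> sets borel" and B: "B \<in> sets borel"
    and m: "{z \<in> A \<times> B. P z} \<in> sets lebesgue"
    and ae: "AE y in lebesgue_on B. AE x in lebesgue_on A. P (x, y)"
  shows "AE z in lebesgue_on (A \<times> B). P z"
proof -
  have AB: "A \<times> B \<in> sets borel" using A B by (rule sets_lborel_prod_Times)
  have "A \<times> B - {z \<in> A \<times> B. P z} \<in> sets lebesgue"
    using AB m by (intro sets.Diff) auto
  then obtain S N N' where SN: "A \<times> B - {z \<in> A \<times> B. P z} = S \<union> N" "S \<in> sets lborel" "N' \<in> null_sets lborel" "N \<subseteq> N'"
    by (rule sets_completionE)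
  have "AE y in lborel. y \<in> B \<longrightarrow> (AE x in lborel. x \<in> A \<longrightarrow> P (x, y))"
    using ae A B by (simp add: AE_lebesgue_on_iff)
  then have "AE y in lborel. AE x in lborel. (x, y) \<notin> S"
  proof eventually_elim
    case (elim y)
    show ?case
    proof (cases "y \<in> B")
      case True
      with elim have "AE x in lborel. x \<in> A \<longrightarrow> P (x, y)" by blast
      then show ?thesis by eventually_elim (use SN(1) in auto)
    next
      case False
      then have "(x, y) \<notin> S" for x using SN(1) by auto
      then show ?thesis by simp
    qed
  qed
  then have "AE z in lborel. z \<notin> S" using AE_lborel_swap[of S] SN(2) by auto
  moreover have "AE z in lborel. z \<notin> N'" using SN(3) by (rule AE_not_in)
  ultimately have "AE z in lborel. z \<in> A \<times> B \<longrightarrow> P z"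
    by eventually_elim (use SN(1,4) in blast)
  then show ?thesis using AB by (simp add: AE_lebesgue_on_iff)
qed

text \<open>Lebesgue measurable functions on the product need not have measurable slices and need not be
measurable for the product of the Borel algebras. Passing to a Borel function that vanishes outside the
domain removes both difficulties; \<open>lebesgue_on_borel_version\<close> is the way back.\<close>
lemma borel_version:
  fixes f :: "'a::euclidean_space \<Rightarrow> real"
  assumes A: "A \<in> sets borel" and f: "f \<in> borel_measurable (lebesgue_on A)"
  obtains g where "g \<in> borel_measurable borel" "\<And>x. x \<notin> A \<Longrightarrow> g x = 0"
    "AE x in lborel. x \<in> A \<longrightarrow> f x = g x"
proof -
  have AL: "A \<in> sets lebesgue" using A by simp
  have "(\<lambda>x. indicator A x *\<^sub>R f x) \<in> borel_measurable lebesgue"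
    using f AL by (subst (asm) borel_measurable_restrict_space_iff) auto
  from completion_ex_borel_measurable_real[OF this]
  obtain g0 where g0: "g0 \<in> borel_measurable lborel" "AE x in lborel. indicator A x *\<^sub>R f x = g0 x" by blast
  show ?thesis
  proof (rule that[of "\<lambda>x. indicator A x * g0 x"])
    show "(\<lambda>x. indicator A x * g0 x) \<in> borel_measurable borel"
      using g0(1) A by auto
    show "AE x in lborel. x \<in> A \<longrightarrow> f x = indicator A x * g0 x"
      using g0(2) by eventually_elim auto
  qed auto
qed

lemma lebesgue_on_borel_version:
  fixes f g :: "'a::euclidean_space \<Rightarrow> real"
  assumes A: "A \<in> sets borel" and g: "g \<in> borel_measurable borel" "\<And>x. x \<notin> A \<Longrightarrow> g x = 0"
    and ae: "AE x in lborel. x \<in> A \<longrightarrow> f x = g x"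
  shows "f \<in> borel_measurable (lebesgue_on A)"
    and "integrable (lebesgue_on A) f \<longleftrightarrow> integrable lborel g"
    and "(\<integral>x. f x \<partial>lebesgue_on A) = (\<integral>x. g x \<partial>lborel)"
proof -
  have AL: "A \<in> sets lebesgue" using A by simp
  have gL: "g \<in> borel_measurable lebesgue" using g(1) by (intro measurable_completion) simp
  have ae': "AE x in lebesgue. g x = indicator A x *\<^sub>R f x"
    using AE_completion[OF ae] by eventually_elim (auto simp: indicator_def g(2))
  have m: "(\<lambda>x. indicator A x *\<^sub>R f x) \<in> borel_measurable lebesgue"
  proof (rule measurableI)
    fix S :: "real set" assume "S \<in> sets borel"
    then have "g -` S \<inter> space lebesgue \<in> sets lebesgue" using gL by (rule measurable_sets[rotated])
    moreover have "AE x in lebesgue. x \<in> g -` S \<inter> space lebesgue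
        \<longleftrightarrow> x \<in> (\<lambda>x. indicator A x *\<^sub>R f x) -` S \<inter> space lebesgue"
      using ae' by eventually_elim auto
    ultimately show "(\<lambda>x. indicator A x *\<^sub>R f x) -` S \<inter> space lebesgue \<in> sets lebesgue"
      using completion.in_sets_AE[of "g -` S \<inter> space lebesgue"] by blast
  qed simp
  show "f \<in> borel_measurable (lebesgue_on A)"
    using m AL borel_measurable_restrict_space_iff[of A lebesgue f] by simp
  have "integrable (lebesgue_on A) f \<longleftrightarrow> integrable lebesgue (\<lambda>x. indicator A x *\<^sub>R f x)"
    using AL by (subst integrable_restrict_space) auto
  also have "\<dots> \<longleftrightarrow> integrable lebesgue g"
    using m gL ae' by (intro integrable_cong_AE) auto
  also have "\<dots> \<longleftrightarrow> integrable lborel g"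
    using g(1) by (intro integrable_completion) simp
  finally show "integrable (lebesgue_on A) f \<longleftrightarrow> integrable lborel g" .
  have "(\<integral>x. f x \<partial>lebesgue_on A) = (\<integral>x. indicator A x *\<^sub>R f x \<partial>lebesgue)"
    using AL by (subst integral_restrict_space) auto
  also have "\<dots> = (\<integral>x. g x \<partial>lebesgue)"
    using m gL ae' by (intro integral_cong_AE) auto
  also have "\<dots> = (\<integral>x. g x \<partial>lborel)"
    using g(1) by (intro integral_completion) simp
  finally show "(\<integral>x. f x \<partial>lebesgue_on A) = (\<integral>x. g x \<partial>lborel)" .
qed

lemma lborel_Fubini:
  fixes g :: "'a::euclidean_space \<times> 'b::euclidean_space \<Rightarrow> real"
  assumes "integrable lborel g"
  shows "AE x in lborel. integrable lborel (\<lambda>y. g (x, y))"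
    and "integrable lborel (\<lambda>x. \<integral>y. g (x, y) \<partial>lborel)"
    and "(\<integral>x. (\<integral>y. g (x, y) \<partial>lborel) \<partial>lborel) = (\<integral>z. g z \<partial>lborel)"
    and "integrable lborel (\<lambda>y. \<integral>x. g (x, y) \<partial>lborel)"
    and "(\<integral>y. (\<integral>x. g (x, y) \<partial>lborel) \<partial>lborel) = (\<integral>z. g z \<partial>lborel)"
proof -
  have g: "integrable (lborel \<Otimes>\<^sub>M lborel) g" using assms by (simp add: lborel_prod)
  have g': "integrable (lborel \<Otimes>\<^sub>M lborel) (\<lambda>(y, x). g (x, y))"
    using lborel_pair.integrable_product_swap[OF g] .
  show "AE x in lborel. integrable lborel (\<lambda>y. g (x, y))" "integrable lborel (\<lambda>x. \<integral>y. g (x, y) \<partial>lborel)"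
    using lborel_pair.AE_integrable_fst'[OF g] lborel_pair.integrable_fst'[OF g] by auto
  show "(\<integral>x. (\<integral>y. g (x, y) \<partial>lborel) \<partial>lborel) = (\<integral>z. g z \<partial>lborel)"
    using lborel_pair.integral_fst'[OF g] by (simp add: lborel_prod)
  show "integrable lborel (\<lambda>y. \<integral>x. g (x, y) \<partial>lborel)"
    using lborel_pair.integrable_fst'[OF g'] by simp
  have "(\<integral>y. (\<integral>x. g (x, y) \<partial>lborel) \<partial>lborel) = (\<integral>z. (\<lambda>(y, x). g (x, y)) z \<partial>(lborel \<Otimes>\<^sub>M lborel))"
    using lborel_pair.integral_fst'[OF g'] by simp
  also have "\<dots> = (\<integral>z. g z \<partial>(lborel \<Otimes>\<^sub>M lborel))"
    using lborel_pair.integral_product_swap[of g] borel_measurable_integrable[OF g] by simp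
  finally show "(\<integral>y. (\<integral>x. g (x, y) \<partial>lborel) \<partial>lborel) = (\<integral>z. g z \<partial>lborel)" by (simp add: lborel_prod)
qed

lemma Fubini_lebesgue_on:
  fixes A :: "'a::euclidean_space set" and B :: "'b::euclidean_space set" and f :: "'a \<times> 'b \<Rightarrow> real"
  assumes A: "A \<in> sets borel" and B: "B \<in> sets borel" and f: "integrable (lebesgue_on (A \<times> B)) f"
  shows "integrable (lebesgue_on B) (\<lambda>y. \<integral>x. f (x, y) \<partial>lebesgue_on A)"
    and "(\<integral>y. (\<integral>x. f (x, y) \<partial>lebesgue_on A) \<partial>lebesgue_on B) = (\<integral>z. f z \<partial>lebesgue_on (A \<times> B))"
proof -
  note AB = sets_lborel_prod_Times[OF A B]
  obtain g where g: "g \<in> borel_measurable borel" "\<And>x. x \<notin> A \<times> B \<Longrightarrow> g x = 0"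
      "AE x in lborel. x \<in> A \<times> B \<longrightarrow> f x = g x"
    using borel_version[OF AB borel_measurable_integrable[OF f]] by blast
  have gm: "(\<lambda>x. g (x, y)) \<in> borel_measurable borel" for y
    by (intro measurable_compose[OF _ g(1)]) (simp add: borel_prod[symmetric])
  have "integrable lborel g" using lebesgue_on_borel_version(2)[OF AB g] f by simp
  note G = lborel_Fubini(4,5)[OF this]
  let ?G = "\<lambda>y. \<integral>x. g (x, y) \<partial>lborel"
  have "AE y in lborel. y \<in> B \<longrightarrow> (\<integral>x. f (x, y) \<partial>lebesgue_on A) = ?G y"
    using AE_lborel_slices[OF g(3)]
  proof eventually_elim
    case (elim y)
    show ?case
    proof
      assume "y \<in> B"
      with elim have "AE x in lborel. x \<in> A \<longrightarrow> f (x, y) = g (x, y)" by simp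
      then show "(\<integral>x. f (x, y) \<partial>lebesgue_on A) = ?G y"
        by (intro lebesgue_on_borel_version(3)[OF A gm]) (simp_all add: g(2))
    qed
  qed
  note V = lebesgue_on_borel_version[OF B borel_measurable_integrable[OF G(1), simplified] _ this]
  show "integrable (lebesgue_on B) (\<lambda>y. \<integral>x. f (x, y) \<partial>lebesgue_on A)"
    using V(2) G(1) by (simp add: g(2))
  show "(\<integral>y. (\<integral>x. f (x, y) \<partial>lebesgue_on A) \<partial>lebesgue_on B) = (\<integral>z. f z \<partial>lebesgue_on (A \<times> B))"
    using V(3) G(2) lebesgue_on_borel_version(3)[OF AB g] by (simp add: g(2))
qed

section \<open>Strict monotonicity of the power flux\<close>

text \<open>The monotonicity expression of the vector field \<open>|\<xi>|\<^sup>p\<^sup>-\<^sup>2 \<xi>\<close>.\<close>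
definition mono_gap :: "real \<Rightarrow> 'a::euclidean_space \<Rightarrow> 'a \<Rightarrow> real" where
  "mono_gap p \<xi> \<eta> = (norm \<xi> powr (p - 2) *\<^sub>R \<xi> - norm \<eta> powr (p - 2) *\<^sub>R \<eta>) \<bullet> (\<xi> - \<eta>)"

lemma norm_powr_minus_1: "norm \<xi> powr (p - 2) * norm \<xi> = norm (\<xi>::'a::euclidean_space) powr (p - 1)"
  using powr_mult_base[of "norm \<xi>" "p - 2"] by (cases "\<xi> = 0") (auto simp: mult.commute algebra_simps)

lemma norm_powr_mult_sq: "norm \<xi> powr (p - 2) * (norm \<xi>)\<^sup>2 = norm (\<xi>::'a::euclidean_space) powr p"
proof (cases "\<xi> = 0")
  case False
  then have "(norm \<xi>)\<^sup>2 = norm \<xi> powr 2" by simp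
  then show ?thesis by (simp only: powr_add[symmetric]) simp
qed simp

text \<open>A splitting into two terms that are nonnegative for \<open>p > 1\<close>: one measures the difference of the lengths,
the other one the difference of the directions.\<close>
lemma mono_gap_eq:
  "mono_gap p \<xi> \<eta> = (norm \<xi> powr (p - 1) - norm \<eta> powr (p - 1)) * (norm \<xi> - norm \<eta>)
     + (norm \<xi> powr (p - 2) + norm \<eta> powr (p - 2)) * (norm \<xi> * norm \<eta> - \<xi> \<bullet> \<eta>)"
proof -
  have "mono_gap p \<xi> \<eta> = norm \<xi> powr (p - 2) * (norm \<xi>)\<^sup>2 + norm \<eta> powr (p - 2) * (norm \<eta>)\<^sup>2
      - (norm \<xi> powr (p - 2) + norm \<eta> powr (p - 2)) * (\<xi> \<bullet> \<eta>)"
    by (simp add: mono_gap_def inner_diff_left inner_diff_right power2_norm_eq_inner inner_commute algebra_simps)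
  also have "\<dots> = (norm \<xi> powr (p - 2) * norm \<xi> - norm \<eta> powr (p - 2) * norm \<eta>) * (norm \<xi> - norm \<eta>)
     + (norm \<xi> powr (p - 2) + norm \<eta> powr (p - 2)) * (norm \<xi> * norm \<eta> - \<xi> \<bullet> \<eta>)"
    by (simp add: algebra_simps power2_eq_square)
  finally show ?thesis by (simp only: norm_powr_minus_1)
qed

lemma powr_diff_mult_nonneg:
  fixes s t :: real
  assumes "0 < r" "0 \<le> s" "0 \<le> t"
  shows "0 \<le> (s powr r - t powr r) * (s - t)"
  using assms powr_mono2[of r s t] powr_mono2[of r t s]
  by (cases "s \<le> t") (auto simp: mult_nonneg_nonneg mult_nonpos_nonpos)

lemma mono_gap_nonneg: "1 < p \<Longrightarrow> 0 \<le> mono_gap p \<xi> \<eta>"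
  unfolding mono_gap_eq using powr_diff_mult_nonneg[of "p - 1" "norm \<xi>" "norm \<eta>"] norm_cauchy_schwarz[of \<xi> \<eta>]
  by (intro add_nonneg_nonneg[OF _ mult_nonneg_nonneg]) auto

lemma mono_gap_pos:
  fixes \<xi> \<eta> :: "'a::euclidean_space"
  assumes p: "1 < p" and ne: "\<xi> \<noteq> \<eta>"
  shows "0 < mono_gap p \<xi> \<eta>"
proof (cases "norm \<xi> = norm \<eta>")
  case False
  have "0 < (s powr r - t powr r) * (s - t)" if "0 < r" "0 \<le> s" "0 \<le> t" "s \<noteq> t" for r s t :: real
    using that powr_less_mono2[of r s t] powr_less_mono2[of r t s]
    by (cases "s \<le> t") (auto simp: mult_pos_pos mult_neg_neg)
  then have "0 < (norm \<xi> powr (p - 1) - norm \<eta> powr (p - 1)) * (norm \<xi> - norm \<eta>)"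
    using p False by simp
  moreover have "0 \<le> (norm \<xi> powr (p - 2) + norm \<eta> powr (p - 2)) * (norm \<xi> * norm \<eta> - \<xi> \<bullet> \<eta>)"
    using norm_cauchy_schwarz[of \<xi> \<eta>] by (intro mult_nonneg_nonneg) auto
  ultimately show ?thesis unfolding mono_gap_eq by linarith
next
  case True
  then have "\<xi> \<noteq> 0" using ne by auto
  have "\<xi> \<bullet> \<eta> \<noteq> norm \<xi> * norm \<eta>"
    using ne True \<open>\<xi> \<noteq> 0\<close> norm_cauchy_schwarz_eq[of \<xi> \<eta>] by auto
  then have "0 < norm \<xi> * norm \<eta> - \<xi> \<bullet> \<eta>"
    using norm_cauchy_schwarz[of \<xi> \<eta>] by linarith
  moreover have "0 < norm \<xi> powr (p - 2) + norm \<eta> powr (p - 2)"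
    using \<open>\<xi> \<noteq> 0\<close> by (intro add_pos_nonneg) auto
  ultimately show ?thesis unfolding mono_gap_eq using True by (simp add: mult_pos_pos)
qed

text \<open>Only continuity at \<open>\<xi> = 0\<close> is not immediate; there the norm of the field is \<open>|\<xi>|\<^sup>p\<^sup>-\<^sup>1\<close>, and the exponent
stays positive near \<open>p > 1\<close>.\<close>
lemma continuous_on_power_vector:
  "continuous_on ({1<..} \<times> UNIV) (\<lambda>(p, \<xi>::'a::euclidean_space). norm \<xi> powr (p - 2) *\<^sub>R \<xi>)"
  unfolding continuous_on_def
proof
  fix z :: "real \<times> 'a" assume z: "z \<in> {1<..} \<times> UNIV"
  let ?S = "{1<..} \<times> (UNIV::'a set)"
  let ?f = "\<lambda>(p, \<xi>::'a). norm \<xi> powr (p - 2) *\<^sub>R \<xi>"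
  show "(?f \<longlongrightarrow> ?f z) (at z within ?S)"
  proof (cases "snd z = 0")
    case False
    have "((\<lambda>w. norm (snd w) powr (fst w - 2) *\<^sub>R snd w) \<longlongrightarrow> norm (snd z) powr (fst z - 2) *\<^sub>R snd z) (at z within ?S)"
      using False by (auto intro!: tendsto_intros)
    then show ?thesis by (simp add: case_prod_unfold)
  next
    case True
    have "((\<lambda>w. norm (snd w) powr (fst w - 1)) \<longlongrightarrow> norm (snd z) powr (fst z - 1)) (at z within ?S)"
    proof (rule tendsto_powr')
      show "((\<lambda>w. norm (snd w)) \<longlongrightarrow> norm (snd z)) (at z within ?S)" by (auto intro!: tendsto_intros)
      show "((\<lambda>w. fst w - 1) \<longlongrightarrow> fst z - 1) (at z within ?S)" by (auto intro!: tendsto_intros)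
    qed (use z in auto)
    then have "((\<lambda>w. norm (?f w)) \<longlongrightarrow> 0) (at z within ?S)"
      using True by (simp add: case_prod_unfold norm_powr_minus_1)
    then have "(?f \<longlongrightarrow> 0) (at z within ?S)" by (rule tendsto_norm_zero_cancel)
    then show ?thesis using True by (simp add: case_prod_unfold)
  qed
qed

lemma mono_gap_scale:
  fixes \<xi> \<eta> :: "'a::euclidean_space"
  assumes t: "0 < t"
  shows "mono_gap p (t *\<^sub>R \<xi>) (t *\<^sub>R \<eta>) = t powr p * mono_gap p \<xi> \<eta>"
proof -
  have 1: "norm (t *\<^sub>R \<xi>) powr (p - 2) *\<^sub>R (t *\<^sub>R \<xi>) = (t powr (p - 2) * t) *\<^sub>R (norm \<xi> powr (p - 2) *\<^sub>R \<xi>)" for \<xi> :: 'a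
    using t by (simp add: powr_mult ac_simps)
  have "mono_gap p (t *\<^sub>R \<xi>) (t *\<^sub>R \<eta>) = (t powr (p - 2) * t * t) * mono_gap p \<xi> \<eta>"
    unfolding mono_gap_def 1 by (simp add: algebra_simps flip: scaleR_diff_right)
  also have "t powr (p - 2) * t * t = t powr p"
    using norm_powr_mult_sq[of t p] t by (simp add: power2_eq_square mult.assoc)
  finally show ?thesis .
qed

text \<open>After scaling, \<open>|\<xi> - \<eta>| = 1\<close> and \<open>|\<xi>| \<le> K\<close>. On this compact set of exponents and vectors the gap is
continuous and positive, hence bounded away from zero, uniformly in the exponent.\<close>
lemma mono_gap_lower_bound:
  assumes pm: "1 < pm" and K: "0 \<le> K"
  obtains c where "0 < c" "\<And>p (\<xi>::'a::euclidean_space) \<eta>. pm \<le> p \<Longrightarrow> p \<le> pp \<Longrightarrow>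
     norm \<xi> \<le> K * norm (\<xi> - \<eta>) \<Longrightarrow> c * norm (\<xi> - \<eta>) powr p \<le> mono_gap p \<xi> \<eta>"
proof -
  let ?C = "{pm..pp} \<times> (cball (0::'a) K \<times> sphere (0::'a) 1)"
  let ?g = "\<lambda>(p, \<xi>, \<zeta>). mono_gap p (\<xi>::'a) (\<xi> - \<zeta>)"
  have comp: "compact ?C" by (intro compact_Times) auto
  have v: "continuous_on ?C (\<lambda>z. norm (h z) powr (fst z - 2) *\<^sub>R h z)" if "continuous_on ?C h" for h :: "_ \<Rightarrow> 'a"
  proof -
    have "continuous_on ?C (\<lambda>z. (\<lambda>(p, \<xi>). norm \<xi> powr (p - 2) *\<^sub>R \<xi>) (fst z, h z))"
      using that pm by (intro continuous_on_compose2[OF continuous_on_power_vector] continuous_intros) auto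
    then show ?thesis by simp
  qed
  have "continuous_on ?C (\<lambda>z. (norm (fst (snd z)) powr (fst z - 2) *\<^sub>R fst (snd z)
      - norm (fst (snd z) - snd (snd z)) powr (fst z - 2) *\<^sub>R (fst (snd z) - snd (snd z))) \<bullet> snd (snd z))"
    by (intro continuous_intros v)
  then have cont: "continuous_on ?C ?g" by (simp add: case_prod_unfold mono_gap_def)
  obtain c where c: "0 < c" "\<And>z. z \<in> ?C \<Longrightarrow> c \<le> ?g z"
  proof (cases "?C = {}")
    case True
    then show ?thesis using that[of 1] by auto
  next
    case False
    obtain z0 where z0: "z0 \<in> ?C" "\<And>z. z \<in> ?C \<Longrightarrow> ?g z0 \<le> ?g z"
      using continuous_attains_inf[OF comp False cont] by blast
    have "0 < ?g z0"
      using z0(1) pm by (auto intro!: mono_gap_pos)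
    then show ?thesis using that z0(2) by blast
  qed
  show ?thesis
  proof (rule that[OF c(1)])
    fix p and \<xi> \<eta> :: 'a
    assume p: "pm \<le> p" "p \<le> pp" and le: "norm \<xi> \<le> K * norm (\<xi> - \<eta>)"
    show "c * norm (\<xi> - \<eta>) powr p \<le> mono_gap p \<xi> \<eta>"
    proof (cases "\<xi> = \<eta>")
      case True
      then show ?thesis by (simp add: mono_gap_def)
    next
      case False
      define t where "t = norm (\<xi> - \<eta>)"
      have t: "t > 0" using False by (simp add: t_def)
      let ?x = "(1 / t) *\<^sub>R \<xi>" and ?z = "(1 / t) *\<^sub>R (\<xi> - \<eta>)"
      have "(p, ?x, ?z) \<in> ?C"
        using p le t by (auto simp: t_def[symmetric] divide_simps mult.commute)
      from c(2)[OF this] have "c \<le> mono_gap p ?x (?x - ?z)" by simp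
      also have "?x - ?z = (1 / t) *\<^sub>R \<eta>" by (simp add: algebra_simps)
      finally have "c \<le> mono_gap p ?x ((1 / t) *\<^sub>R \<eta>)" .
      then have "c * t powr p \<le> t powr p * mono_gap p ?x ((1 / t) *\<^sub>R \<eta>)"
        by (subst mult.commute) (rule mult_left_mono, auto)
      also have "\<dots> = mono_gap p (t *\<^sub>R ?x) (t *\<^sub>R ((1 / t) *\<^sub>R \<eta>))" by (simp only: mono_gap_scale[OF t])
      also have "\<dots> = mono_gap p \<xi> \<eta>" using t by simp
      finally show ?thesis by (simp add: t_def)
    qed
  qed
qed

text \<open>Replaces the usual case distinction between \<open>p \<ge> 2\<close> and \<open>p < 2\<close>. With \<open>\<delta> = min \<epsilon> 1\<close>, the last
term alone is enough if \<open>|\<xi> - \<eta>| \<le> \<delta> |\<xi>|\<close>; otherwise \<open>mono_gap_lower_bound\<close> applies with \<open>K = 1 / \<delta>\<close>. Only \<open>\<xi>\<close> occurs in the error term: in the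
application it is the gradient of the fixed solution, so the error is bounded along the sequence.\<close>
lemma norm_diff_powr_le_mono_gap:
  assumes pm: "1 < pm" and \<epsilon>: "0 < \<epsilon>"
  obtains C where "0 \<le> C" "\<And>p (\<xi>::'a::euclidean_space) \<eta>. pm \<le> p \<Longrightarrow> p \<le> pp \<Longrightarrow>
     norm (\<xi> - \<eta>) powr p \<le> C * mono_gap p \<xi> \<eta> + \<epsilon> * norm \<xi> powr p"
proof -
  define \<delta> where "\<delta> = min \<epsilon> 1"
  have \<delta>: "0 < \<delta>" "\<delta> \<le> \<epsilon>" "\<delta> \<le> 1" using \<epsilon> by (auto simp: \<delta>_def)
  obtain c where c: "0 < c" "\<And>p (\<xi>::'a) \<eta>. pm \<le> p \<Longrightarrow> p \<le> pp \<Longrightarrow>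
     norm \<xi> \<le> (1 / \<delta>) * norm (\<xi> - \<eta>) \<Longrightarrow> c * norm (\<xi> - \<eta>) powr p \<le> mono_gap p \<xi> \<eta>"
    using mono_gap_lower_bound[OF pm, of "1 / \<delta>"] \<delta> by auto
  show ?thesis
  proof (rule that[of "1 / c"])
    show "0 \<le> 1 / c" using c by simp
    fix p and \<xi> \<eta> :: 'a assume p: "pm \<le> p" "p \<le> pp"
    show "norm (\<xi> - \<eta>) powr p \<le> 1 / c * mono_gap p \<xi> \<eta> + \<epsilon> * norm \<xi> powr p"
    proof (cases "norm \<xi> \<le> (1 / \<delta>) * norm (\<xi> - \<eta>)")
      case True
      have "norm (\<xi> - \<eta>) powr p \<le> 1 / c * mono_gap p \<xi> \<eta>"
        using c(2)[OF p True] c(1) by (simp add: field_simps)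
      moreover have "0 \<le> \<epsilon> * norm \<xi> powr p" using \<epsilon> by simp
      ultimately show ?thesis by linarith
    next
      case False
      then have "norm (\<xi> - \<eta>) \<le> \<delta> * norm \<xi>" using \<delta> by (simp add: field_simps)
      then have "norm (\<xi> - \<eta>) powr p \<le> (\<delta> * norm \<xi>) powr p" using p pm by (intro powr_mono2) auto
      also have "\<dots> = \<delta> powr p * norm \<xi> powr p" using \<delta> by (simp add: powr_mult)
      also have "\<dots> \<le> \<delta> powr 1 * norm \<xi> powr p"
        using \<delta> p pm by (intro mult_right_mono powr_mono') auto
      also have "\<dots> \<le> \<epsilon> * norm \<xi> powr p" using \<delta> by (simp add: mult_right_mono)
      finally show ?thesis using mono_gap_nonneg[of p \<xi> \<eta>] c(1) p pm by (simp add: add_increasing)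
    qed
  qed
qed

section \<open>Square integrable functions and Sobolev spaces in the space variable\<close>

lemma L2_iff: "f \<in> L_var M (\<lambda>_. 2) \<longleftrightarrow> f \<in> borel_measurable M \<and> integrable M (\<lambda>x. (f x)\<^sup>2)"
proof -
  have "\<bar>y\<bar> powr 2 = y\<^sup>2" for y :: real by (cases "y = 0") auto
  then show ?thesis
    by (auto simp: musielak_def power_fun_def integrable_iff_bounded)
qed

lemma L1_iff: "f \<in> L_var M (\<lambda>_. 1) \<longleftrightarrow> integrable M f"
  by (auto simp: musielak_def power_fun_def integrable_iff_bounded)

lemma L2_mult_integrable:
  fixes f g :: "'a \<Rightarrow> real"
  assumes "f \<in> L_var M (\<lambda>_. 2)" "g \<in> L_var M (\<lambda>_. 2)"
  shows "integrable M (\<lambda>x. f x * g x)"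
proof (rule Bochner_Integration.integrable_bound)
  show "integrable M (\<lambda>x. (f x)\<^sup>2 + (g x)\<^sup>2)" using assms by (auto simp: L2_iff)
  show "(\<lambda>x. f x * g x) \<in> borel_measurable M" using assms by (auto simp: L2_iff)
  have "\<bar>a * b\<bar> \<le> \<bar>a\<^sup>2 + b\<^sup>2\<bar>" for a b :: real
  proof -
    have "2 * \<bar>a * b\<bar> \<le> a\<^sup>2 + b\<^sup>2"
      using sum_squares_bound[of "\<bar>a\<bar>" "\<bar>b\<bar>"] by (simp add: abs_mult mult.assoc)
    then show ?thesis by linarith
  qed
  then show "AE x in M. norm (f x * g x) \<le> norm ((f x)\<^sup>2 + (g x)\<^sup>2)" by simp
qed

lemma L2_diff:
  assumes f: "f \<in> L_var M (\<lambda>_. 2)" and g: "g \<in> L_var M (\<lambda>_. 2)"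
  shows "(\<lambda>x. f x - g x) \<in> L_var M (\<lambda>_. 2)"
proof -
  have "(\<lambda>x. (f x - g x)\<^sup>2) = (\<lambda>x. (f x)\<^sup>2 + (g x)\<^sup>2 - 2 * (f x * g x))"
    by (auto simp: power2_diff)
  moreover have "integrable M (\<lambda>x. (f x)\<^sup>2 + (g x)\<^sup>2 - 2 * (f x * g x))"
    using f g L2_mult_integrable[OF f g] by (auto simp: L2_iff)
  ultimately show ?thesis using f g by (auto simp: L2_iff)
qed

lemma Cauchy_Schwarz_integral:
  assumes f: "f \<in> L_var M (\<lambda>_. 2)" and g: "g \<in> L_var M (\<lambda>_. 2)"
  shows "\<bar>\<integral>x. f x * g x \<partial>M\<bar> \<le> L2_norm M f * L2_norm M g"
proof -
  let ?A = "\<integral>x. (f x)\<^sup>2 \<partial>M" and ?B = "\<integral>x. f x * g x \<partial>M" and ?C = "\<integral>x. (g x)\<^sup>2 \<partial>M"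
  have i: "integrable M (\<lambda>x. (f x)\<^sup>2)" "integrable M (\<lambda>x. (g x)\<^sup>2)" "integrable M (\<lambda>x. f x * g x)"
    using f g L2_mult_integrable[OF f g] by (auto simp: L2_iff)
  have quad: "0 \<le> ?A - 2 * l * ?B + l\<^sup>2 * ?C" for l
  proof -
    have "0 \<le> (\<integral>x. (f x - l * g x)\<^sup>2 \<partial>M)" by simp
    also have "(\<lambda>x. (f x - l * g x)\<^sup>2) = (\<lambda>x. (f x)\<^sup>2 - 2 * l * (f x * g x) + l\<^sup>2 * (g x)\<^sup>2)"
      by (auto simp: power2_diff power_mult_distrib)
    also have "(\<integral>x. (f x)\<^sup>2 - 2 * l * (f x * g x) + l\<^sup>2 * (g x)\<^sup>2 \<partial>M) = ?A - 2 * l * ?B + l\<^sup>2 * ?C"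
      using i by simp
    finally show ?thesis .
  qed
  have "?B\<^sup>2 \<le> ?A * ?C"
  proof (cases "?C = 0")
    case True
    have "?B = 0"
    proof (rule ccontr)
      assume "?B \<noteq> 0"
      then show False using quad[of "(?A + 1) / (2 * ?B)"] True by simp
    qed
    then show ?thesis using True by simp
  next
    case False
    then have C: "?C > 0" by (simp add: less_le)
    have "0 \<le> (?A - 2 * (?B / ?C) * ?B + (?B / ?C)\<^sup>2 * ?C) * ?C"
      using quad[of "?B / ?C"] C by (intro mult_nonneg_nonneg) auto
    also have "\<dots> = ?A * ?C - ?B\<^sup>2" using C by (simp add: field_simps power2_eq_square)
    finally show ?thesis by simp
  qed
  then have "sqrt (?B\<^sup>2) \<le> sqrt (?A * ?C)" by (rule real_sqrt_le_mono)
  then show ?thesis by (simp add: L2_norm_def real_sqrt_mult)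
qed

lemma add_powr_le:
  fixes a b r R :: real
  assumes "0 \<le> a" "0 \<le> b" "0 \<le> r" "r \<le> R"
  shows "(a + b) powr r \<le> 2 powr R * (a powr r + b powr r)"
proof -
  have "(a + b) powr r \<le> (2 * max a b) powr r" using assms by (intro powr_mono2) auto
  also have "\<dots> = 2 powr r * max a b powr r" using assms by (simp add: powr_mult)
  also have "\<dots> \<le> 2 powr R * (a powr r + b powr r)"
    using assms by (intro mult_mono powr_mono) (auto simp: max_def)
  finally show ?thesis .
qed

lemma L_var_norm_diff:
  fixes F G :: "'z \<Rightarrow> 'b::euclidean_space"
  assumes F: "F \<in> borel_measurable M" "(\<lambda>x. norm (F x)) \<in> L_var M r"
    and G: "G \<in> borel_measurable M" "(\<lambda>x. norm (G x)) \<in> L_var M r"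
    and r: "r \<in> borel_measurable M" "\<And>x. x \<in> space M \<Longrightarrow> 0 \<le> r x \<and> r x \<le> R"
  shows "(\<lambda>x. norm (F x - G x)) \<in> L_var M r"
proof -
  have "(\<integral>\<^sup>+x. ennreal (norm (F x - G x) powr r x) \<partial>M)
      \<le> (\<integral>\<^sup>+x. ennreal (2 powr R) * (ennreal (norm (F x) powr r x) + ennreal (norm (G x) powr r x)) \<partial>M)"
  proof (rule nn_integral_mono)
    fix x assume "x \<in> space M"
    then have r': "0 \<le> r x" "r x \<le> R" using r(2) by auto
    have "norm (F x - G x) powr r x \<le> (norm (F x) + norm (G x)) powr r x"
      using r' norm_triangle_ineq4 by (intro powr_mono2) auto
    also have "\<dots> \<le> 2 powr R * (norm (F x) powr r x + norm (G x) powr r x)"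
      using r' by (intro add_powr_le) auto
    finally show "ennreal (norm (F x - G x) powr r x)
        \<le> ennreal (2 powr R) * (ennreal (norm (F x) powr r x) + ennreal (norm (G x) powr r x))"
      by (simp add: ennreal_mult[symmetric] ennreal_plus[symmetric] ennreal_leI del: ennreal_plus)
  qed
  also have "\<dots> = ennreal (2 powr R) * ((\<integral>\<^sup>+x. ennreal (norm (F x) powr r x) \<partial>M) + (\<integral>\<^sup>+x. ennreal (norm (G x) powr r x) \<partial>M))"
    using F(1) G(1) r(1) by (subst nn_integral_cmult, measurable, subst nn_integral_add, measurable)
  also have "\<dots> < \<infinity>"
    using F(2) G(2) by (auto simp: musielak_def power_fun_def ennreal_mult_less_top)
  finally show ?thesis using F(1) G(1) by (auto simp: musielak_def power_fun_def)
qed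

lemma musielak_cong_AE:
  assumes "f \<in> musielak M \<Phi>" "g \<in> borel_measurable M" "AE x in M. g x = f x"
  shows "g \<in> musielak M \<Phi>"
proof -
  have "(\<integral>\<^sup>+x. ennreal (\<Phi> x \<bar>g x\<bar>) \<partial>M) = (\<integral>\<^sup>+x. ennreal (\<Phi> x \<bar>f x\<bar>) \<partial>M)"
    using assms(3) by (intro nn_integral_cong_AE) auto
  then show ?thesis using assms by (auto simp: musielak_def)
qed

text \<open>Exhaust \<open>\<Omega>\<close> by compact sets.\<close>
lemma loc_integrable_measurable:
  fixes f :: "'a::euclidean_space \<Rightarrow> 'b::euclidean_space"
  assumes \<Omega>: "open \<Omega>" and f: "loc_integrable \<Omega> f"
  shows "f \<in> borel_measurable (lebesgue_on \<Omega>)"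
proof -
  obtain C :: "nat \<Rightarrow> 'a set" where C: "\<And>n. compact (C n)" "\<And>n. C n \<subseteq> \<Omega>"
      "\<And>n. C n \<subseteq> interior (C (Suc n))" "\<Union>(range C) = \<Omega>"
    by (rule open_Union_compact_subsets[OF \<Omega>]) (rule that)
  have mono: "C n \<subseteq> C m" if "n \<le> m" for n m
  proof (rule lift_Suc_mono_le[of C])
    show "C k \<subseteq> C (Suc k)" for k using C(3)[of k] interior_subset[of "C (Suc k)"] by (rule subset_trans)
  qed (rule that)
  have "(\<lambda>x. indicator (C n) x *\<^sub>R f x) \<in> borel_measurable lebesgue" for n
  proof -
    have "f \<in> borel_measurable (lebesgue_on (C n))"
      using f C(1,2)[of n] by (auto simp: loc_integrable_def)
    then show ?thesis
      using C(1)[of n] borel_measurable_restrict_space_iff[of "C n" lebesgue f] by (simp add: borel_compact)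
  qed
  moreover have "(\<lambda>n. indicator (C n) x *\<^sub>R f x) \<longlonglongrightarrow> indicator \<Omega> x *\<^sub>R f x" for x
  proof (cases "x \<in> \<Omega>")
    case True
    then obtain n where n: "x \<in> C n" using C(4) by blast
    have "\<forall>\<^sub>F m in sequentially. indicator \<Omega> x *\<^sub>R f x = indicator (C m) x *\<^sub>R f x"
      using eventually_ge_at_top[of n]
    proof eventually_elim
      case (elim m)
      then have "x \<in> C m" using n mono[of n m] by blast
      then show ?case using True by simp
    qed
    then show ?thesis by (rule Lim_transform_eventually[OF tendsto_const])
  next
    case False
    then have "x \<notin> C n" for n using C(2) by blast
    then show ?thesis using False by simp
  qed
  ultimately have "(\<lambda>x. indicator \<Omega> x *\<^sub>R f x) \<in> borel_measurable lebesgue"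
    by (rule borel_measurable_LIMSEQ_metric)
  then show ?thesis
    using \<Omega> borel_measurable_restrict_space_iff[of \<Omega> lebesgue f] by simp
qed

lemma weak_grad_is_weak_grad: "is_weak_grad \<Omega> u w \<Longrightarrow> is_weak_grad \<Omega> u (weak_grad \<Omega> u)"
  unfolding weak_grad_def by (rule someI[of "is_weak_grad \<Omega> u"])

lemma weak_grad_measurable:
  "open \<Omega> \<Longrightarrow> is_weak_grad \<Omega> u w \<Longrightarrow> w \<in> borel_measurable (lebesgue_on \<Omega>)"
  by (intro loc_integrable_measurable) (auto simp: is_weak_grad_def)

text \<open>For the exponent 1 the Luxemburg norm is the integral of the absolute value, so the closure in
the definition of \<open>W1_0\<close> can be handled with the triangle inequality for integrals.\<close>
lemma luxemburg_L1:
  assumes "integrable M f"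
  shows "luxemburg M (power_fun (\<lambda>_. 1)) f = (\<integral>x. \<bar>f x\<bar> \<partial>M)"
proof -
  let ?I = "\<integral>x. \<bar>f x\<bar> \<partial>M"
  have "(\<integral>\<^sup>+x. ennreal (power_fun (\<lambda>_. 1) x (\<bar>f x\<bar> / l)) \<partial>M) \<le> 1 \<longleftrightarrow> ?I \<le> l" if "0 < l" for l
  proof -
    have "(\<integral>\<^sup>+x. ennreal (power_fun (\<lambda>_. 1) x (\<bar>f x\<bar> / l)) \<partial>M) = (\<integral>\<^sup>+x. ennreal (\<bar>f x\<bar> / l) \<partial>M)"
      using that by (intro nn_integral_cong) (simp add: power_fun_def)
    also have "\<dots> = ennreal (\<integral>x. \<bar>f x\<bar> / l \<partial>M)"
      using assms that by (intro nn_integral_eq_integral) auto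
    also have "\<dots> = ennreal (?I / l)" by simp
    finally show ?thesis using that by (simp add: field_simps)
  qed
  then have eq: "{l. 0 < l \<and> (\<integral>\<^sup>+x. ennreal (power_fun (\<lambda>_. 1) x (\<bar>f x\<bar> / l)) \<partial>M) \<le> 1} = {l. 0 < l \<and> ?I \<le> l}"
    by blast
  have "0 \<le> ?I" by simp
  have "Inf {l. 0 < l \<and> ?I \<le> l} = ?I"
  proof (rule cInf_eq_non_empty)
    have "?I + 1 \<in> {l. 0 < l \<and> ?I \<le> l}" using \<open>0 \<le> ?I\<close> by (simp add: add_nonneg_pos)
    then show "{l. 0 < l \<and> ?I \<le> l} \<noteq> {}" by blast
    show "?I \<le> l" if "l \<in> {l. 0 < l \<and> ?I \<le> l}" for l using that by simp
    fix y assume y: "\<And>l. l \<in> {l. 0 < l \<and> ?I \<le> l} \<Longrightarrow> y \<le> l"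
    show "y \<le> ?I"
    proof (rule field_le_epsilon)
      fix e :: real assume "0 < e"
      then show "y \<le> ?I + e" using y[of "?I + e"] \<open>0 \<le> ?I\<close> by auto
    qed
  qed
  then show ?thesis by (simp add: luxemburg_def eq)
qed

lemma W1_L1_D:
  assumes "u \<in> W1 \<Omega> (power_fun (\<lambda>_. 1))"
  shows "integrable (lebesgue_on \<Omega>) u" "is_weak_grad \<Omega> u (weak_grad \<Omega> u)"
    "integrable (lebesgue_on \<Omega>) (\<lambda>x. norm (weak_grad \<Omega> u x))"
  using assms weak_grad_is_weak_grad by (auto simp: W1_def L1_iff)

lemma W1_L1_diff:
  assumes \<Omega>: "open \<Omega>" and u: "u \<in> W1 \<Omega> (power_fun (\<lambda>_. 1))" and v: "v \<in> W1 \<Omega> (power_fun (\<lambda>_. 1))"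
  shows "(\<lambda>x. u x - v x) \<in> W1 \<Omega> (power_fun (\<lambda>_. 1))"
    and "W1_norm \<Omega> (power_fun (\<lambda>_. 1)) (\<lambda>x. u x - v x)
      \<le> W1_norm \<Omega> (power_fun (\<lambda>_. 1)) u + W1_norm \<Omega> (power_fun (\<lambda>_. 1)) v"
proof -
  let ?M = "lebesgue_on \<Omega>" and ?w = "\<lambda>x. u x - v x"
  note U = W1_L1_D[OF u] and V = W1_L1_D[OF v]
  have g: "is_weak_grad \<Omega> ?w (\<lambda>x. weak_grad \<Omega> u x - weak_grad \<Omega> v x)"
    using \<Omega> U(2) V(2) by (rule is_weak_grad_diff)
  have ae: "AE x in ?M. weak_grad \<Omega> ?w x = weak_grad \<Omega> u x - weak_grad \<Omega> v x"
    by (rule weak_grad_AE_eq[OF \<Omega> g])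
  have m: "weak_grad \<Omega> ?w \<in> borel_measurable ?M"
    using weak_grad_measurable[OF \<Omega> weak_grad_is_weak_grad[OF g]] .
  have le: "AE x in ?M. norm (weak_grad \<Omega> ?w x) \<le> norm (weak_grad \<Omega> u x) + norm (weak_grad \<Omega> v x)"
    using ae by eventually_elim (simp add: norm_triangle_ineq4)
  have i: "integrable ?M (\<lambda>x. norm (weak_grad \<Omega> ?w x))"
  proof (rule Bochner_Integration.integrable_bound)
    show "integrable ?M (\<lambda>x. norm (weak_grad \<Omega> u x) + norm (weak_grad \<Omega> v x))" using U(3) V(3) by simp
    show "AE x in ?M. norm (norm (weak_grad \<Omega> ?w x)) \<le> norm (norm (weak_grad \<Omega> u x) + norm (weak_grad \<Omega> v x))"
      using le by eventually_elim simp
  qed (use m in auto)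
  have iw: "integrable ?M ?w" using U(1) V(1) by simp
  then show "?w \<in> W1 \<Omega> (power_fun (\<lambda>_. 1))" using i g by (auto simp: W1_def L1_iff)
  have "(\<integral>x. \<bar>?w x\<bar> \<partial>?M) \<le> (\<integral>x. \<bar>u x\<bar> + \<bar>v x\<bar> \<partial>?M)"
    using U(1) V(1) by (intro integral_mono) auto
  moreover have "(\<integral>x. norm (weak_grad \<Omega> ?w x) \<partial>?M) \<le> (\<integral>x. norm (weak_grad \<Omega> u x) + norm (weak_grad \<Omega> v x) \<partial>?M)"
    using le i U(3) V(3) by (intro integral_mono_AE) auto
  ultimately show "W1_norm \<Omega> (power_fun (\<lambda>_. 1)) ?w
      \<le> W1_norm \<Omega> (power_fun (\<lambda>_. 1)) u + W1_norm \<Omega> (power_fun (\<lambda>_. 1)) v"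
    using U V i iw by (simp add: W1_norm_def luxemburg_L1)
qed

lemma test_fun_integrable: "open \<Omega> \<Longrightarrow> \<phi> \<in> test_fun \<Omega> \<Longrightarrow> integrable (lebesgue_on \<Omega>) \<phi>"
  using integrable_loc_times_test(1)[OF _ loc_integrable_continuous, of \<Omega> "\<lambda>_. 1" \<phi>] by simp

lemma test_fun_W1_L1:
  assumes \<Omega>: "open \<Omega>" and \<phi>: "\<phi> \<in> test_fun \<Omega>"
  shows "\<phi> \<in> W1 \<Omega> (power_fun (\<lambda>_. 1))"
proof -
  let ?M = "lebesgue_on \<Omega>"
  note g = is_weak_grad_test_fun[OF \<Omega> \<phi>]
  have "integrable ?M (\<lambda>x. frechet_derivative \<phi> (at x) b)" if "b \<in> Basis" for b
    using integrable_loc_times_test(2)[OF \<Omega> loc_integrable_continuous \<phi> that, of "\<lambda>_. 1"] by simp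
  then have "integrable ?M (classical_grad \<phi>)"
    unfolding classical_grad_def[abs_def] by (intro Bochner_Integration.integrable_sum) auto
  then have "integrable ?M (weak_grad \<Omega> \<phi>)"
    using weak_grad_AE_eq[OF \<Omega> g] weak_grad_measurable[OF \<Omega> weak_grad_is_weak_grad[OF g]]
    by (subst integrable_cong_AE) auto
  then show ?thesis using g test_fun_integrable[OF \<Omega> \<phi>] by (auto simp: W1_def L1_iff)
qed

text \<open>The difference of two approximating test functions approximates the difference.\<close>
lemma W1_0_L1_diff:
  assumes \<Omega>: "open \<Omega>" and u: "u \<in> W1_0 \<Omega> (power_fun (\<lambda>_. 1))" and v: "v \<in> W1_0 \<Omega> (power_fun (\<lambda>_. 1))"
  shows "(\<lambda>x. u x - v x) \<in> W1_0 \<Omega> (power_fun (\<lambda>_. 1))"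
proof -
  let ?N = "W1_norm \<Omega> (power_fun (\<lambda>_. 1))"
  have W: "u \<in> W1 \<Omega> (power_fun (\<lambda>_. 1))" "v \<in> W1 \<Omega> (power_fun (\<lambda>_. 1))"
    using u v by (auto simp: W1_0_def)
  have "\<exists>\<phi>\<in>test_fun \<Omega>. ?N (\<lambda>x. u x - v x - \<phi> x) < \<epsilon>" if "\<epsilon> > 0" for \<epsilon>
  proof -
    from that have "\<epsilon> / 2 > 0" by simp
    obtain \<phi> \<psi> where \<phi>: "\<phi> \<in> test_fun \<Omega>" "?N (\<lambda>x. u x - \<phi> x) < \<epsilon> / 2"
      and \<psi>: "\<psi> \<in> test_fun \<Omega>" "?N (\<lambda>x. v x - \<psi> x) < \<epsilon> / 2"
      using u v \<open>\<epsilon> / 2 > 0\<close> unfolding W1_0_def by blast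
    have "?N (\<lambda>x. (u x - \<phi> x) - (v x - \<psi> x)) \<le> ?N (\<lambda>x. u x - \<phi> x) + ?N (\<lambda>x. v x - \<psi> x)"
      by (rule W1_L1_diff(2)[OF \<Omega> W1_L1_diff(1)[OF \<Omega> W(1) test_fun_W1_L1[OF \<Omega> \<phi>(1)]]
            W1_L1_diff(1)[OF \<Omega> W(2) test_fun_W1_L1[OF \<Omega> \<psi>(1)]]])
    also have "\<dots> < \<epsilon>" using \<phi>(2) \<psi>(2) by simp
    also have "(\<lambda>x. (u x - \<phi> x) - (v x - \<psi> x)) = (\<lambda>x. u x - v x - (\<phi> x - \<psi> x))" by auto
    finally show ?thesis
      using test_fun_diff[OF \<phi>(1) \<psi>(1)] by (intro bexI[of _ "\<lambda>x. \<phi> x - \<psi> x"])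
  qed
  then show ?thesis using W1_L1_diff(1)[OF \<Omega> W] by (auto simp: W1_0_def)
qed

lemma V_space_diff:
  assumes \<Omega>: "open \<Omega>" and r: "r \<in> borel_measurable (lebesgue_on \<Omega>)" "\<And>x. x \<in> \<Omega> \<Longrightarrow> 0 \<le> r x \<and> r x \<le> R"
    and u: "u \<in> V_space \<Omega> r" and v: "v \<in> V_space \<Omega> r"
  shows "(\<lambda>x. u x - v x) \<in> V_space \<Omega> r"
proof -
  let ?M = "lebesgue_on \<Omega>" and ?w = "\<lambda>x. u x - v x"
  have W: "u \<in> W1_0 \<Omega> (power_fun (\<lambda>_. 1))" "v \<in> W1_0 \<Omega> (power_fun (\<lambda>_. 1))"
    using u v by (auto simp: V_space_def)
  then have "u \<in> W1 \<Omega> (power_fun (\<lambda>_. 1))" "v \<in> W1 \<Omega> (power_fun (\<lambda>_. 1))" by (auto simp: W1_0_def)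
  note gu = W1_L1_D(2)[OF this(1)] and gv = W1_L1_D(2)[OF this(2)]
  note g = is_weak_grad_diff[OF \<Omega> gu gv]
  have d: "(\<lambda>x. norm (weak_grad \<Omega> u x - weak_grad \<Omega> v x)) \<in> L_var ?M r"
    using u v r weak_grad_measurable[OF \<Omega> gu] weak_grad_measurable[OF \<Omega> gv]
    by (intro L_var_norm_diff[where R=R]) (auto simp: V_space_def)
  have "(\<lambda>x. norm (weak_grad \<Omega> ?w x)) \<in> L_var ?M r"
    using weak_grad_measurable[OF \<Omega> weak_grad_is_weak_grad[OF g]] weak_grad_AE_eq[OF \<Omega> g]
    by (intro musielak_cong_AE[OF d]) auto
  then show ?thesis
    using W1_0_L1_diff[OF \<Omega> W] L2_diff[of u ?M v] u v by (auto simp: V_space_def)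
qed

lemma V_space_zero:
  assumes \<Omega>: "open \<Omega>"
  shows "(\<lambda>_. 0) \<in> V_space \<Omega> r"
proof -
  let ?M = "lebesgue_on \<Omega>"
  note g = is_weak_grad_zero[OF \<Omega>]
  have ae: "AE x in ?M. weak_grad \<Omega> (\<lambda>_. 0) x = 0" by (rule weak_grad_AE_eq[OF \<Omega> g])
  have z: "(\<lambda>_. 0) \<in> musielak ?M (power_fun r)" for r by (simp add: musielak_def power_fun_def)
  have "W1_norm \<Omega> (power_fun (\<lambda>_. 1)) (\<lambda>_. 0) = 0"
  proof -
    have i: "integrable ?M (\<lambda>x. norm (weak_grad \<Omega> (\<lambda>_. 0) x))"
      using test_fun_W1_L1[OF \<Omega> test_fun_zero] by (rule W1_L1_D)
    have "(\<integral>x. norm (weak_grad \<Omega> (\<lambda>_. 0) x) \<partial>?M) = (\<integral>x. 0 \<partial>?M)"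
      using ae i by (intro integral_cong_AE) auto
    then show ?thesis using i by (simp add: W1_norm_def luxemburg_L1)
  qed
  then have "(\<lambda>_. 0) \<in> W1_0 \<Omega> (power_fun (\<lambda>_. 1))"
    using test_fun_W1_L1[OF \<Omega> test_fun_zero] by (auto simp: W1_0_def intro!: bexI[of _ "\<lambda>_. 0"])
  moreover have "(\<lambda>x. norm (weak_grad \<Omega> (\<lambda>_. 0) x)) \<in> L_var ?M r"
    using weak_grad_measurable[OF \<Omega> weak_grad_is_weak_grad[OF g]] ae
    by (intro musielak_cong_AE[OF z]) auto
  ultimately show ?thesis using z by (auto simp: V_space_def)
qed

section \<open>Functions on the space-time cylinder\<close>

lemma AE_Ioo_iff_Ioc:
  fixes a b :: real
  shows "(AE t in lebesgue_on {a<..<b}. P t) \<longleftrightarrow> (AE t in lebesgue_on {a<..b}. P t)"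
proof -
  have "(AE t in lborel. t \<in> {a<..<b} \<longrightarrow> P t) \<longleftrightarrow> (AE t in lborel. t \<in> {a<..b} \<longrightarrow> P t)"
    by (rule eventually_subst, rule eventually_mono[OF AE_lborel_singleton[of b]]) auto
  then show ?thesis by (simp add: AE_lebesgue_on_iff)
qed

lemma cyl_borel: "open (\<Omega>::'a::euclidean_space set) \<Longrightarrow> cyl \<Omega> T \<in> sets borel"
  by (intro sets_lborel_prod_Times) auto

lemma cyl_lebesgue: "open (\<Omega>::'a::euclidean_space set) \<Longrightarrow> cyl \<Omega> T \<in> sets lebesgue"
  by (rule sets_completionI_sets) (simp add: cyl_borel)

text \<open>Almost every slice is a weak gradient and hence determined up to a null set; joint measurability
allows to conclude for almost every point of the cylinder.\<close>
lemma is_space_grad_unique: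
  fixes \<Omega> :: "'a::euclidean_space set"
  assumes \<Omega>: "open \<Omega>" and F: "is_space_grad \<Omega> T u F" and G: "is_space_grad \<Omega> T u G"
  shows "AE z in lebesgue_on (cyl \<Omega> T). F z = G z"
proof (rule AE_from_slices)
  show "{z \<in> cyl \<Omega> T. F z = G z} \<in> sets lebesgue"
  proof -
    have m: "F \<in> borel_measurable (lebesgue_on (cyl \<Omega> T))" "G \<in> borel_measurable (lebesgue_on (cyl \<Omega> T))"
      using F G by (auto simp: is_space_grad_def)
    have "{z \<in> space (lebesgue_on (cyl \<Omega> T)). F z = G z} \<in> sets (lebesgue_on (cyl \<Omega> T))"
      using m by measurable
    then show ?thesis
      using cyl_lebesgue[OF \<Omega>, of T] by (simp add: sets_restrict_space_iff)
  qed
  have "AE t in lebesgue_on {0<..<T}. AE x in lebesgue_on \<Omega>. F (x, t) = G (x, t)"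
  proof -
    have "AE t in lebesgue_on {0<..<T}. is_weak_grad \<Omega> (\<lambda>x. u (x, t)) (\<lambda>x. F (x, t))"
      "AE t in lebesgue_on {0<..<T}. is_weak_grad \<Omega> (\<lambda>x. u (x, t)) (\<lambda>x. G (x, t))"
      using F G by (auto simp: is_space_grad_def)
    then show ?thesis
      by eventually_elim (rule is_weak_grad_unique[OF \<Omega>])
  qed
  then show "AE t in lebesgue_on {0<..T}. AE x in lebesgue_on \<Omega>. F (x, t) = G (x, t)"
    by (simp add: AE_Ioo_iff_Ioc)
qed (use \<Omega> in auto)

lemma is_space_grad_space_grad: "is_space_grad \<Omega> T u G \<Longrightarrow> is_space_grad \<Omega> T u (space_grad \<Omega> T u)"
  unfolding space_grad_def by (rule someI[of "is_space_grad \<Omega> T u"])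

lemma space_grad_AE_eq:
  assumes "open \<Omega>" "is_space_grad \<Omega> T u G"
  shows "AE z in lebesgue_on (cyl \<Omega> T). space_grad \<Omega> T u z = G z"
  by (rule is_space_grad_unique[OF assms(1) is_space_grad_space_grad[OF assms(2)] assms(2)])

lemma is_space_grad_diff:
  assumes "open \<Omega>" "is_space_grad \<Omega> T u F" "is_space_grad \<Omega> T v G"
  shows "is_space_grad \<Omega> T (\<lambda>z. u z - v z) (\<lambda>z. F z - G z)"
proof -
  have "AE t in lebesgue_on {0<..<T}. is_weak_grad \<Omega> (\<lambda>x. u (x, t)) (\<lambda>x. F (x, t))"
    "AE t in lebesgue_on {0<..<T}. is_weak_grad \<Omega> (\<lambda>x. v (x, t)) (\<lambda>x. G (x, t))"
    using assms by (auto simp: is_space_grad_def)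
  then have "AE t in lebesgue_on {0<..<T}. is_weak_grad \<Omega> (\<lambda>x. u (x, t) - v (x, t)) (\<lambda>x. F (x, t) - G (x, t))"
    by eventually_elim (rule is_weak_grad_diff[OF assms(1)])
  then show ?thesis using assms by (auto simp: is_space_grad_def)
qed

text \<open>The time \<open>\<tau>\<close> itself is kept, so for \<open>\<tau> = T\<close> nothing is cut off on the cylinder, which is closed at \<open>T\<close>.\<close>
definition time_cut :: "real \<Rightarrow> 'a \<times> real \<Rightarrow> real" where
  "time_cut \<tau> z = indicator {..\<tau>} (snd z)"

lemma time_cut_simps: "time_cut \<tau> (x, t) = (if t \<le> \<tau> then 1 else 0)"
  by (simp add: time_cut_def indicator_def)

lemma time_cut_measurable:
  fixes S :: "('a::euclidean_space \<times> real) set"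
  shows "time_cut \<tau> \<in> borel_measurable (lebesgue_on S)"
proof -
  have "(\<lambda>z::'a \<times> real. indicator {..\<tau>} (snd z) :: real) \<in> borel_measurable borel"
    by (simp add: borel_prod[symmetric])
  then have "(time_cut \<tau> :: 'a \<times> real \<Rightarrow> real) \<in> borel_measurable borel"
    by (simp add: time_cut_def[abs_def])
  then show ?thesis by (intro measurable_restrict_space1 measurable_completion) simp
qed

lemma is_space_grad_cut:
  fixes \<Omega> :: "'a::euclidean_space set"
  assumes "open \<Omega>" "is_space_grad \<Omega> T u F"
  shows "is_space_grad \<Omega> T (\<lambda>z. time_cut \<tau> z * u z) (\<lambda>z. time_cut \<tau> z *\<^sub>R F z)"
proof -
  have "AE t in lebesgue_on {0<..<T}. is_weak_grad \<Omega> (\<lambda>x. u (x, t)) (\<lambda>x. F (x, t))"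
    using assms by (auto simp: is_space_grad_def)
  then have "AE t in lebesgue_on {0<..<T}. is_weak_grad \<Omega> (\<lambda>x. time_cut \<tau> (x, t) * u (x, t)) (\<lambda>x. time_cut \<tau> (x, t) *\<^sub>R F (x, t))"
  proof eventually_elim
    case (elim t)
    then show ?case using is_weak_grad_zero[OF assms(1)] by (cases "t \<le> \<tau>") (auto simp: time_cut_simps)
  qed
  moreover have "(\<lambda>z. time_cut \<tau> z *\<^sub>R F z) \<in> borel_measurable (lebesgue_on (cyl \<Omega> T))"
    using assms(2) time_cut_measurable by (intro borel_measurable_scaleR) (auto simp: is_space_grad_def)
  ultimately show ?thesis by (auto simp: is_space_grad_def)
qed

lemma continuous_measurable_cyl:
  fixes \<Omega> :: "'a::euclidean_space set" and r :: "'a \<times> real \<Rightarrow> real"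
  assumes "open \<Omega>" "continuous_on (closure (cyl \<Omega> T)) r"
  shows "r \<in> borel_measurable (lebesgue_on (cyl \<Omega> T))"
  by (rule continuous_imp_measurable_on_sets_lebesgue[OF continuous_on_subset[OF assms(2) closure_subset] cyl_lebesgue[OF assms(1)]])

lemma closure_cyl: "0 < T \<Longrightarrow> closure (cyl \<Omega> T) = closure \<Omega> \<times> {0..T}"
  by (simp add: closure_Times)

lemma continuous_measurable_slice:
  fixes \<Omega> :: "'a::euclidean_space set" and r :: "'a \<times> real \<Rightarrow> real"
  assumes \<Omega>: "open \<Omega>" and c: "continuous_on (closure (cyl \<Omega> T)) r" and T: "0 < T" and t: "t \<in> {0..T}"
  shows "(\<lambda>x. r (x, t)) \<in> borel_measurable (lebesgue_on \<Omega>)"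
proof (rule continuous_imp_measurable_on_sets_lebesgue)
  have "(\<lambda>x. (x, t)) ` \<Omega> \<subseteq> closure (cyl \<Omega> T)"
    using t closure_subset[of \<Omega>] unfolding closure_cyl[OF T] by auto
  then show "continuous_on \<Omega> (\<lambda>x. r (x, t))"
    by (intro continuous_on_compose2[OF c]) (auto intro!: continuous_intros)
qed (use \<Omega> in auto)

lemma W_space_D:
  assumes "u \<in> W_space \<Omega> T r"
  shows "u \<in> L_var (lebesgue_on (cyl \<Omega> T)) (\<lambda>_. 2)"
    "is_space_grad \<Omega> T u (space_grad \<Omega> T u)"
    "space_grad \<Omega> T u \<in> borel_measurable (lebesgue_on (cyl \<Omega> T))"
    "(\<lambda>z. norm (space_grad \<Omega> T u z)) \<in> L_var (lebesgue_on (cyl \<Omega> T)) r"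
proof -
  show "u \<in> L_var (lebesgue_on (cyl \<Omega> T)) (\<lambda>_. 2)"
    "(\<lambda>z. norm (space_grad \<Omega> T u z)) \<in> L_var (lebesgue_on (cyl \<Omega> T)) r"
    using assms by (simp_all add: W_space_def)
  obtain G where "is_space_grad \<Omega> T u G" using assms by (auto simp: W_space_def)
  then show "is_space_grad \<Omega> T u (space_grad \<Omega> T u)" by (rule is_space_grad_space_grad)
  then show "space_grad \<Omega> T u \<in> borel_measurable (lebesgue_on (cyl \<Omega> T))"
    unfolding is_space_grad_def by blast
qed

lemma W_space_diff:
  fixes \<Omega> :: "'a::euclidean_space set" and r :: "'a \<times> real \<Rightarrow> real"
  assumes \<Omega>: "open \<Omega>" and c: "continuous_on (closure (cyl \<Omega> T)) r"
    and r: "\<And>z. z \<in> closure (cyl \<Omega> T) \<Longrightarrow> 0 \<le> r z \<and> r z \<le> R"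
    and u: "u \<in> W_space \<Omega> T r" and v: "v \<in> W_space \<Omega> T r"
  shows "(\<lambda>z. u z - v z) \<in> W_space \<Omega> T r"
    and "AE z in lebesgue_on (cyl \<Omega> T). space_grad \<Omega> T (\<lambda>z. u z - v z) z = space_grad \<Omega> T u z - space_grad \<Omega> T v z"
proof -
  let ?M = "lebesgue_on (cyl \<Omega> T)" and ?w = "\<lambda>z. u z - v z"
  note U = W_space_D[OF u] and V = W_space_D[OF v]
  have r': "0 \<le> r z \<and> r z \<le> R" if "z \<in> cyl \<Omega> T" for z
    using r[of z] that closure_subset[of "cyl \<Omega> T"] by blast
  note g = is_space_grad_diff[OF \<Omega> U(2) V(2)]
  show ae: "AE z in ?M. space_grad \<Omega> T ?w z = space_grad \<Omega> T u z - space_grad \<Omega> T v z"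
    by (rule space_grad_AE_eq[OF \<Omega> g])
  have d: "(\<lambda>z. norm (space_grad \<Omega> T u z - space_grad \<Omega> T v z)) \<in> L_var ?M r"
    using r' by (intro L_var_norm_diff[where R=R] U(3,4) V(3,4) continuous_measurable_cyl[OF \<Omega> c]) auto
  have m: "space_grad \<Omega> T ?w \<in> borel_measurable ?M"
    using is_space_grad_space_grad[OF g] by (simp add: is_space_grad_def)
  have "(\<lambda>z. norm (space_grad \<Omega> T ?w z)) \<in> L_var ?M r"
    using ae m by (intro musielak_cong_AE[OF d]) auto
  moreover have "AE t in lebesgue_on {0<..<T}. (\<lambda>x. ?w (x, t)) \<in> V_space \<Omega> (\<lambda>x. r (x, t))"
  proof -
    have "AE t in lebesgue_on {0<..<T}. t \<in> {0<..<T}" by (subst AE_lebesgue_on_iff) auto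
    moreover have "AE t in lebesgue_on {0<..<T}. (\<lambda>x. u (x, t)) \<in> V_space \<Omega> (\<lambda>x. r (x, t))"
      "AE t in lebesgue_on {0<..<T}. (\<lambda>x. v (x, t)) \<in> V_space \<Omega> (\<lambda>x. r (x, t))"
      using u v by (auto simp: W_space_def)
    ultimately show ?thesis
    proof eventually_elim
      case (elim t)
      then show ?case
        using r' by (intro V_space_diff[where R=R] \<Omega> continuous_measurable_slice[OF \<Omega> c]) auto
    qed
  qed
  ultimately show "?w \<in> W_space \<Omega> T r"
    using L2_diff[OF U(1) V(1)] g by (auto simp: W_space_def)
qed

text \<open>The space of test functions for the equation contains no regularity in time, so that it
admits truncation at any time. This localises the weak formulation to \<open>(0, \<tau>)\<close>.\<close>
lemma W_space_cut:
  fixes \<Omega> :: "'a::euclidean_space set" and r :: "'a \<times> real \<Rightarrow> real"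
  assumes \<Omega>: "open \<Omega>" and u: "u \<in> W_space \<Omega> T r"
  shows "(\<lambda>z. time_cut \<tau> z * u z) \<in> W_space \<Omega> T r"
    and "AE z in lebesgue_on (cyl \<Omega> T). space_grad \<Omega> T (\<lambda>z. time_cut \<tau> z * u z) z = time_cut \<tau> z *\<^sub>R space_grad \<Omega> T u z"
proof -
  let ?M = "lebesgue_on (cyl \<Omega> T)" and ?w = "\<lambda>z. time_cut \<tau> z * u z"
  note U = W_space_D[OF u]
  note g = is_space_grad_cut[OF \<Omega> U(2), of \<tau>]
  show ae: "AE z in ?M. space_grad \<Omega> T ?w z = time_cut \<tau> z *\<^sub>R space_grad \<Omega> T u z"
    by (rule space_grad_AE_eq[OF \<Omega> g])
  have m: "space_grad \<Omega> T ?w \<in> borel_measurable ?M"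
    using is_space_grad_space_grad[OF g] by (simp add: is_space_grad_def)
  have cut: "f \<in> borel_measurable ?M \<Longrightarrow> f \<in> L_var ?M s \<Longrightarrow> (\<lambda>z. time_cut \<tau> z * f z) \<in> L_var ?M s" for f s
  proof -
    assume f: "f \<in> borel_measurable ?M" "f \<in> L_var ?M s"
    have "(\<integral>\<^sup>+z. ennreal (power_fun s z \<bar>time_cut \<tau> z * f z\<bar>) \<partial>?M) \<le> (\<integral>\<^sup>+z. ennreal (power_fun s z \<bar>f z\<bar>) \<partial>?M)"
      by (intro nn_integral_mono) (auto simp: power_fun_def time_cut_def indicator_def)
    also have "\<dots> < \<infinity>" using f by (simp add: musielak_def)
    finally show ?thesis
      using f(1) time_cut_measurable[of \<tau> "cyl \<Omega> T"] by (auto simp: musielak_def)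
  qed
  have "(\<lambda>z. time_cut \<tau> z * norm (space_grad \<Omega> T u z)) \<in> L_var ?M r"
    using U(3,4) by (intro cut) auto
  then have "(\<lambda>z. norm (space_grad \<Omega> T ?w z)) \<in> L_var ?M r"
    by (rule musielak_cong_AE) (use m ae in \<open>auto elim!: eventually_mono simp: time_cut_def\<close>)
  moreover have "?w \<in> L_var ?M (\<lambda>_. 2)" using U(1) by (intro cut) (auto simp: musielak_def)
  moreover have "AE t in lebesgue_on {0<..<T}. (\<lambda>x. ?w (x, t)) \<in> V_space \<Omega> (\<lambda>x. r (x, t))"
  proof -
    have "AE t in lebesgue_on {0<..<T}. (\<lambda>x. u (x, t)) \<in> V_space \<Omega> (\<lambda>x. r (x, t))"
      using u by (auto simp: W_space_def)
    then show ?thesis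
    proof eventually_elim
      case (elim t)
      then show ?case using V_space_zero[OF \<Omega>] by (cases "t \<le> \<tau>") (auto simp: time_cut_simps)
    qed
  qed
  ultimately show "?w \<in> W_space \<Omega> T r" using g by (auto simp: W_space_def)
qed

section \<open>The chain rule for a weak time derivative\<close>

lemma integrable_times_bounded:
  fixes f g :: "'z \<Rightarrow> real"
  assumes f: "integrable M f" and g: "g \<in> borel_measurable M" "\<And>x. \<bar>g x\<bar> \<le> B"
  shows "integrable M (\<lambda>x. f x * g x)"
proof (rule Bochner_Integration.integrable_bound)
  show "integrable M (\<lambda>x. B * f x)" using f by simp
  have "\<bar>f x\<bar> * \<bar>g x\<bar> \<le> \<bar>B\<bar> * \<bar>f x\<bar>" for x
    using g(2)[of x] by (subst mult.commute) (rule mult_right_mono, auto)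
  then show "AE x in M. norm (f x * g x) \<le> norm (B * f x)" by (simp add: abs_mult)
qed (use f g in auto)

text \<open>The identity \<open>\<integral> v W = W\<^sup>2 / 2\<close> for \<open>W' = v\<close>. By symmetry the integrals of \<open>v \<sigma> * v \<rho>\<close> over the two triangles
\<open>\<rho> \<le> \<sigma>\<close> and \<open>\<sigma> \<le> \<rho>\<close> agree, and together they give the square.\<close>
lemma integral_running_integral:
  fixes v :: "real \<Rightarrow> real"
  assumes v: "integrable lborel v"
  defines "W \<equiv> \<lambda>t. \<integral>\<sigma>. indicator {..t} \<sigma> * v \<sigma> \<partial>lborel"
  shows "W \<in> borel_measurable borel"
    and "\<bar>W t\<bar> \<le> (\<integral>\<sigma>. \<bar>v \<sigma>\<bar> \<partial>lborel)"
    and "(\<integral>\<sigma>. indicator {..\<tau>} \<sigma> * (v \<sigma> * W \<sigma>) \<partial>lborel) = 1/2 * (W \<tau>)\<^sup>2"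
proof -
  have [measurable]: "v \<in> borel_measurable borel" using v by auto
  have i: "integrable lborel (\<lambda>\<sigma>. indicator {..t} \<sigma> * v \<sigma>)" for t :: real
    using integrable_mult_indicator[of "{..t}" lborel v] v by simp
  show m: "W \<in> borel_measurable borel"
  proof -
    have "(\<lambda>t. \<integral>\<sigma>. indicator {..t} \<sigma> * v \<sigma> \<partial>lborel) = (\<lambda>t. \<integral>\<sigma>. (if \<sigma> \<le> t then 1 else 0) * v \<sigma> \<partial>lborel)"
      by (intro ext Bochner_Integration.integral_cong) (auto simp: indicator_def)
    also have "\<dots> \<in> borel_measurable borel" by measurable
    finally show ?thesis by (simp add: W_def)
  qed
  show "\<bar>W t\<bar> \<le> (\<integral>\<sigma>. \<bar>v \<sigma>\<bar> \<partial>lborel)" for t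
  proof -
    have "\<bar>W t\<bar> \<le> (\<integral>\<sigma>. \<bar>indicator {..t} \<sigma> * v \<sigma>\<bar> \<partial>lborel)" unfolding W_def by (rule integral_abs_bound)
    also have "\<dots> \<le> (\<integral>\<sigma>. \<bar>v \<sigma>\<bar> \<partial>lborel)"
      using i v by (intro integral_mono) (auto simp: indicator_def)
    finally show ?thesis .
  qed
  define v1 where "v1 \<sigma> = indicator {..\<tau>} \<sigma> * v \<sigma>" for \<sigma>
  have v1: "integrable lborel v1" unfolding v1_def by (rule i)
  have [measurable]: "v1 \<in> borel_measurable borel" using v1 by auto
  let ?f = "\<lambda>(\<sigma>, \<rho>). (if \<rho> \<le> \<sigma> then 1 else 0) * (v1 \<sigma> * v1 \<rho>)"
  let ?g = "\<lambda>(\<sigma>, \<rho>). (if \<sigma> \<le> \<rho> then 1 else 0) * (v1 \<sigma> * v1 \<rho>)"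
  have prod: "integrable (lborel \<Otimes>\<^sub>M lborel) (\<lambda>(\<sigma>, \<rho>). v1 \<sigma> * v1 \<rho>)"
  proof (rule lborel_pair.Fubini_integrable)
    show "integrable lborel (\<lambda>x. \<integral>y. norm (case (x, y) of (\<sigma>, \<rho>) \<Rightarrow> v1 \<sigma> * v1 \<rho>) \<partial>lborel)"
      using v1 by (simp add: abs_mult)
    show "AE x in lborel. integrable lborel (\<lambda>y. case (x, y) of (\<sigma>, \<rho>) \<Rightarrow> v1 \<sigma> * v1 \<rho>)"
      using v1 by simp
  qed measurable
  have f: "integrable (lborel \<Otimes>\<^sub>M lborel) ?f" "integrable (lborel \<Otimes>\<^sub>M lborel) ?g"
    by (rule Bochner_Integration.integrable_bound[OF prod]; auto)+
  have inner: "(\<integral>\<rho>. ?f (\<sigma>, \<rho>) \<partial>lborel) = indicator {..\<tau>} \<sigma> * (v \<sigma> * W \<sigma>)" for \<sigma>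
  proof (cases "\<sigma> \<le> \<tau>")
    case True
    have "(\<integral>\<rho>. ?f (\<sigma>, \<rho>) \<partial>lborel) = (\<integral>\<rho>. v1 \<sigma> * (indicator {..\<sigma>} \<rho> * v \<rho>) \<partial>lborel)"
      using True by (intro Bochner_Integration.integral_cong) (auto simp: v1_def indicator_def)
    then show ?thesis using True by (simp add: v1_def W_def)
  qed (simp add: v1_def)
  let ?A = "\<integral>\<sigma>. indicator {..\<tau>} \<sigma> * (v \<sigma> * W \<sigma>) \<partial>lborel"
  have A1: "(\<integral>z. ?f z \<partial>(lborel \<Otimes>\<^sub>M lborel)) = ?A"
    using lborel_pair.integral_fst'[OF f(1)] by (simp only: inner)
  have A2: "(\<integral>z. ?g z \<partial>(lborel \<Otimes>\<^sub>M lborel)) = ?A"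
  proof -
    have "(\<lambda>(x, y). ?f (y, x)) = ?g" by (auto simp: fun_eq_iff)
    then have "(\<integral>z. ?g z \<partial>(lborel \<Otimes>\<^sub>M lborel)) = (\<integral>z. ?f z \<partial>(lborel \<Otimes>\<^sub>M lborel))"
      using lborel_pair.integral_product_swap[of ?f] borel_measurable_integrable[OF f(1)] by simp
    then show ?thesis using A1 by simp
  qed
  have "?A + ?A = (\<integral>z. ?f z + ?g z \<partial>(lborel \<Otimes>\<^sub>M lborel))"
    using f A1 A2 by simp
  also have "\<dots> = (\<integral>\<sigma>. (\<integral>\<rho>. ?f (\<sigma>, \<rho>) + ?g (\<sigma>, \<rho>) \<partial>lborel) \<partial>lborel)"
    using lborel_pair.integral_fst'[OF Bochner_Integration.integrable_add[OF f]] by simp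
  also have "\<dots> = (\<integral>\<sigma>. (\<integral>\<rho>. v1 \<sigma> * v1 \<rho> \<partial>lborel) \<partial>lborel)"
  proof (rule Bochner_Integration.integral_cong[OF refl])
    fix \<sigma> :: real
    show "(\<integral>\<rho>. ?f (\<sigma>, \<rho>) + ?g (\<sigma>, \<rho>) \<partial>lborel) = (\<integral>\<rho>. v1 \<sigma> * v1 \<rho> \<partial>lborel)"
    proof (rule integral_cong_AE)
      show "AE \<rho> in lborel. ?f (\<sigma>, \<rho>) + ?g (\<sigma>, \<rho>) = v1 \<sigma> * v1 \<rho>"
        using AE_lborel_singleton[of \<sigma>] by eventually_elim auto
      show "(\<lambda>\<rho>. ?f (\<sigma>, \<rho>) + ?g (\<sigma>, \<rho>)) \<in> borel_measurable lborel"
        unfolding prod.case by measurable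
      show "(\<lambda>\<rho>. v1 \<sigma> * v1 \<rho>) \<in> borel_measurable lborel" by measurable
    qed
  qed
  also have "\<dots> = (W \<tau>)\<^sup>2" by (simp add: power2_eq_square) (simp add: v1_def[abs_def] W_def)
  finally show "?A = 1/2 * (W \<tau>)\<^sup>2" by simp
qed

abbreviation step_deriv :: "real \<Rightarrow> real" where
  "step_deriv x \<equiv> frechet_derivative smooth_step (at x) 1"

lemma step_deriv: "(smooth_step has_real_derivative step_deriv x) (at x)"
  using C_diff_real_Suc_D(1)[OF C_diff_smooth_step[of "Suc 0"]] .

lemma step_deriv_continuous: "continuous_on UNIV step_deriv"
  using C_diff_real_Suc_D(2)[OF C_diff_smooth_step[of "Suc 0"]] by simp

lemma step_deriv_outside: "x < 0 \<or> 1 < x \<Longrightarrow> step_deriv x = 0"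
proof -
  assume x: "x < 0 \<or> 1 < x"
  have "\<exists>c S. open S \<and> x \<in> S \<and> (\<forall>y\<in>S. smooth_step y = c)"
  proof (cases "x < 0")
    case True
    then show ?thesis by (intro exI[of _ 0] exI[of _ "{..<0}"]) auto
  next
    case False
    then show ?thesis using x by (intro exI[of _ 1] exI[of _ "{1<..}"]) auto
  qed
  then obtain c S where "open S" "x \<in> S" "\<And>y. y \<in> S \<Longrightarrow> smooth_step y = c" by blast
  then have "(smooth_step has_real_derivative 0) (at x)"
    using has_field_derivative_transform_within_open[OF DERIV_const[of c "at x"], of S smooth_step] by simp
  then show ?thesis using DERIV_unique step_deriv by blast
qed

lemma step_deriv_integral: "integrable lborel step_deriv" "(\<integral>x. step_deriv x \<partial>lborel) = 1"
proof -
  have e: "(\<lambda>x. indicator {0..1} x *\<^sub>R step_deriv x) = step_deriv"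
  proof
    show "indicator {0..1} x *\<^sub>R step_deriv x = step_deriv x" for x
      using step_deriv_outside[of x] by (cases "x \<in> {0..1}") auto
  qed
  have "has_bochner_integral lborel (\<lambda>x. indicator {0..1} x *\<^sub>R step_deriv x) (smooth_step 1 - smooth_step 0)"
    using step_deriv step_deriv_continuous
    by (intro has_bochner_integral_FTC_Icc)
      (auto intro: continuous_on_subset has_vector_derivative_at_within simp: has_real_derivative_iff_has_vector_derivative)
  then have "has_bochner_integral lborel step_deriv 1" unfolding e by simp
  then show "integrable lborel step_deriv" "(\<integral>x. step_deriv x \<partial>lborel) = 1"
    by (auto simp: has_bochner_integral_iff)
qed

text \<open>Rescaled derivatives of the step function are an approximate identity concentrated to the right of
\<open>s\<close>; substitute \<open>\<tau> = s + \<sigma> / (n + 1)\<close>.\<close>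
lemma step_deriv_mollifies:
  fixes k :: "real \<Rightarrow> real"
  assumes k: "continuous_on {0..T} k" and s: "0 < s" "s < T"
  shows "(\<lambda>n. \<integral>\<tau>. k \<tau> * (real (Suc n) * step_deriv (real (Suc n) * (\<tau> - s))) \<partial>lebesgue_on {0<..T}) \<longlonglongrightarrow> k s"
proof -
  define K where "K \<tau> = indicator {0..T} \<tau> * k \<tau>" for \<tau>
  have Km: "K \<in> borel_measurable borel"
  proof -
    have "(\<lambda>\<tau>. indicator {0..T} \<tau> *\<^sub>R k \<tau>) \<in> borel_measurable borel"
      using k by (intro borel_measurable_continuous_on_indicator) auto
    then show ?thesis by (simp add: K_def[abs_def])
  qed
  have "bounded (k ` {0..T})" using k compact_continuous_image compact_imp_bounded by blast
  then obtain B where "\<forall>y\<in>k ` {0..T}. norm y \<le> B" unfolding bounded_iff ..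
  then have B: "\<bar>k \<tau>\<bar> \<le> B" if "\<tau> \<in> {0..T}" for \<tau> using that by simp
  then have "\<bar>k s\<bar> \<le> B" using s by simp
  then have B0: "0 \<le> B" by linarith
  have KB: "\<bar>K \<tau>\<bar> \<le> B" for \<tau> using B[of \<tau>] B0 by (auto simp: K_def indicator_def)
  have eq: "(\<integral>\<tau>. k \<tau> * (real (Suc n) * step_deriv (real (Suc n) * (\<tau> - s))) \<partial>lebesgue_on {0<..T})
      = (\<integral>\<sigma>. K (s + inverse (real (Suc n)) * \<sigma>) * step_deriv \<sigma> \<partial>lborel)" for n
  proof -
    let ?c = "inverse (real (Suc n))"
    have "(\<integral>\<tau>. k \<tau> * (real (Suc n) * step_deriv (real (Suc n) * (\<tau> - s))) \<partial>lebesgue_on {0<..T})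
        = (\<integral>\<tau>. K \<tau> * (real (Suc n) * step_deriv (real (Suc n) * (\<tau> - s))) \<partial>lebesgue)"
    proof (subst integral_restrict_space)
      have "step_deriv (real (Suc n) * (\<tau> - s)) = 0" if "\<tau> \<le> 0" for \<tau>
        using s that by (intro step_deriv_outside) (simp add: mult_pos_neg)
      then have "indicator {0<..T} \<tau> *\<^sub>R (k \<tau> * (real (Suc n) * step_deriv (real (Suc n) * (\<tau> - s))))
          = K \<tau> * (real (Suc n) * step_deriv (real (Suc n) * (\<tau> - s)))" for \<tau>
        by (cases "\<tau> \<le> 0") (simp_all add: K_def indicator_def del: of_nat_Suc)
      then show "(\<integral>\<tau>. indicator {0<..T} \<tau> *\<^sub>R (k \<tau> * (real (Suc n) * step_deriv (real (Suc n) * (\<tau> - s)))) \<partial>lebesgue)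
        = (\<integral>\<tau>. K \<tau> * (real (Suc n) * step_deriv (real (Suc n) * (\<tau> - s))) \<partial>lebesgue)"
        by (simp only:)
    qed auto
    also have "\<dots> = \<bar>?c\<bar> *\<^sub>R (\<integral>\<sigma>. K (s + ?c * \<sigma>) * (real (Suc n) * step_deriv (real (Suc n) * (s + ?c * \<sigma> - s))) \<partial>lebesgue)"
      by (rule lebesgue_integral_real_affine) simp
    also have "\<dots> = (\<integral>\<sigma>. \<bar>?c\<bar> *\<^sub>R (K (s + ?c * \<sigma>) * (real (Suc n) * step_deriv (real (Suc n) * (s + ?c * \<sigma> - s)))) \<partial>lebesgue)"
      by (rule integral_scaleR_right[symmetric])
    also have "\<dots> = (\<integral>\<sigma>. K (s + ?c * \<sigma>) * step_deriv \<sigma> \<partial>lebesgue)"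
    proof (intro Bochner_Integration.integral_cong refl)
      fix \<sigma> :: real
      have "real (Suc n) * (s + ?c * \<sigma> - s) = \<sigma>" by (simp add: field_simps del: of_nat_Suc)
      then show "\<bar>?c\<bar> *\<^sub>R (K (s + ?c * \<sigma>) * (real (Suc n) * step_deriv (real (Suc n) * (s + ?c * \<sigma> - s)))) = K (s + ?c * \<sigma>) * step_deriv \<sigma>"
        by (simp add: field_simps del: of_nat_Suc)
    qed
    also have "\<dots> = (\<integral>\<sigma>. K (s + ?c * \<sigma>) * step_deriv \<sigma> \<partial>lborel)"
    proof (rule integral_completion)
      have [measurable]: "step_deriv \<in> borel_measurable borel" "K \<in> borel_measurable borel"
        using Km borel_measurable_continuous_onI[OF step_deriv_continuous] by auto
      show "(\<lambda>\<sigma>. K (s + ?c * \<sigma>) * step_deriv \<sigma>) \<in> borel_measurable lborel" by measurable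
    qed
    finally show ?thesis .
  qed
  have "(\<lambda>n. \<integral>\<sigma>. K (s + inverse (real (Suc n)) * \<sigma>) * step_deriv \<sigma> \<partial>lborel) \<longlonglongrightarrow> (\<integral>\<sigma>. k s * step_deriv \<sigma> \<partial>lborel)"
  proof (rule integral_dominated_convergence)
    show "integrable lborel (\<lambda>\<sigma>. B * \<bar>step_deriv \<sigma>\<bar>)" using step_deriv_integral(1) by simp
    have [measurable]: "step_deriv \<in> borel_measurable borel" "K \<in> borel_measurable borel"
      using Km borel_measurable_continuous_onI[OF step_deriv_continuous] by auto
    show "(\<lambda>\<sigma>. K (s + inverse (real (Suc n)) * \<sigma>) * step_deriv \<sigma>) \<in> borel_measurable lborel" for n
      by measurable
    show "(\<lambda>\<sigma>. k s * step_deriv \<sigma>) \<in> borel_measurable lborel" by measurable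
    show "AE \<sigma> in lborel. norm (K (s + inverse (real (Suc n)) * \<sigma>) * step_deriv \<sigma>) \<le> B * \<bar>step_deriv \<sigma>\<bar>" for n
      using KB by (intro always_eventually allI) (simp add: abs_mult mult_right_mono del: of_nat_Suc)
    show "AE \<sigma> in lborel. (\<lambda>n. K (s + inverse (real (Suc n)) * \<sigma>) * step_deriv \<sigma>) \<longlonglongrightarrow> k s * step_deriv \<sigma>"
    proof (intro always_eventually allI tendsto_mult tendsto_const)
      fix \<sigma> :: real
      have "continuous_on {0<..<T} k" using k by (rule continuous_on_subset) auto
      then have "isCont k s" using s by (simp add: continuous_on_eq_continuous_at)
      moreover have "\<forall>\<^sub>F \<tau> in nhds s. K \<tau> = k \<tau>"
        using s by (intro eventually_mono[OF eventually_nhds_in_open[of "{0<..<T}"]]) (auto simp: K_def)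
      ultimately have "isCont K s" using isCont_cong by blast
      moreover have "(\<lambda>n. s + inverse (real (Suc n)) * \<sigma>) \<longlonglongrightarrow> s + 0 * \<sigma>"
        by (intro tendsto_intros LIMSEQ_inverse_real_of_nat)
      ultimately have "(\<lambda>n. K (s + inverse (real (Suc n)) * \<sigma>)) \<longlonglongrightarrow> K s"
        using isCont_tendsto_compose[of s K] by simp
      then show "(\<lambda>n. K (s + inverse (real (Suc n)) * \<sigma>)) \<longlonglongrightarrow> k s" using s by (simp add: K_def)
    qed
  qed
  then show ?thesis unfolding eq using step_deriv_integral by simp
qed

lemma test_fun_prod:
  fixes \<psi> :: "'a::euclidean_space \<Rightarrow> real" and \<eta> :: "real \<Rightarrow> real"
  assumes \<psi>: "\<psi> \<in> test_fun D" and \<eta>: "\<eta> \<in> test_fun I"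
  shows "(\<lambda>z. \<psi> (fst z) * \<eta> (snd z)) \<in> test_fun (D \<times> I)"
    and "frechet_derivative (\<lambda>z. \<psi> (fst z) * \<eta> (snd z)) (at z) (0, 1) = \<psi> (fst z) * frechet_derivative \<eta> (at (snd z)) 1"
proof -
  let ?p = "\<lambda>z::'a \<times> real. \<psi> (fst z) * \<eta> (snd z)"
  have C: "C_diff k ?p" for k
    using C_diff_affine[OF bounded_linear_fst test_fun_D(1)[OF \<psi>], of k 0]
      C_diff_affine[OF bounded_linear_snd test_fun_D(1)[OF \<eta>], of k 0]
    by (intro C_diff_mult) simp_all
  let ?A = "closure {x. \<psi> x \<noteq> 0}" and ?B = "closure {t. \<eta> t \<noteq> 0}"
  have AB: "compact ?A" "?A \<subseteq> D" "compact ?B" "?B \<subseteq> I"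
    using test_fun_D(3)[OF \<psi>] test_fun_D(3)[OF \<eta>] by (auto simp: compact_support_in_def)
  have "compact_support_in (D \<times> I) ?p"
  proof (rule compact_support_inI[OF compact_Times[OF AB(1,3)] Sigma_mono[OF AB(2,4)]])
    show "z \<in> ?A \<times> ?B" if "?p z \<noteq> 0" for z
      using that closure_subset[of "{x. \<psi> x \<noteq> 0}"] closure_subset[of "{t. \<eta> t \<noteq> 0}"] by (cases z) auto
  qed
  then show "?p \<in> test_fun (D \<times> I)"
    using C by (simp add: test_fun_def)
  have "((\<lambda>z. \<psi> (fst z)) has_derivative (\<lambda>h. frechet_derivative \<psi> (at (fst z)) (fst h))) (at z)"
    "((\<lambda>z. \<eta> (snd z)) has_derivative (\<lambda>h. frechet_derivative \<eta> (at (snd z)) (snd h))) (at z)"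
    using frechet_derivative_affine[OF test_fun_D(4)[OF \<psi>] bounded_linear_fst, of 0 z]
      frechet_derivative_affine[OF test_fun_D(4)[OF \<eta>] bounded_linear_snd, of 0 z] by simp_all
  from has_derivative_mult[OF this]
  have "frechet_derivative ?p (at z) = (\<lambda>h. \<psi> (fst z) * frechet_derivative \<eta> (at (snd z)) (snd h)
      + frechet_derivative \<psi> (at (fst z)) (fst h) * \<eta> (snd z))"
    by (rule frechet_derivative_at[symmetric])
  moreover have "frechet_derivative \<psi> (at (fst z)) 0 = 0"
    using linear_frechet_derivative[OF test_fun_D(4)[OF \<psi>]] by (rule linear_0)
  ultimately show "frechet_derivative ?p (at z) (0, 1) = \<psi> (fst z) * frechet_derivative \<eta> (at (snd z)) 1"
    by simp
qed

text \<open>Smooth approximations of the indicator of \<open>{s<..t}\<close> in time; their derivatives are approximate identities at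
\<open>s\<close> and \<open>t\<close> with opposite signs.\<close>
definition time_window :: "real \<Rightarrow> real \<Rightarrow> nat \<Rightarrow> real \<Rightarrow> real" where
  "time_window s t n \<tau> = smooth_step (real (Suc n) * (\<tau> - s)) - smooth_step (real (Suc n) * (\<tau> - t))"

lemma time_window_test_fun:
  assumes "0 < s" "s < t" "t + inverse (real (Suc n)) < T"
  shows "time_window s t n \<in> test_fun {0<..<T}"
proof -
  have C: "C_diff k (\<lambda>\<tau>::real. smooth_step (real (Suc n) * (\<tau> - s)))" for k s
    using C_diff_inner[OF C_diff_smooth_step, where ?'a=real and c="real (Suc n)" and d="- real (Suc n) * s" and i=1 and k=k]
    by (simp add: algebra_simps)
  have "time_window s t n \<tau> = 0" if "\<tau> \<notin> {s..t + inverse (real (Suc n))}" for \<tau>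
  proof (cases "\<tau> < s")
    case True
    then have "real (Suc n) * (\<tau> - s) \<le> 0" "real (Suc n) * (\<tau> - t) \<le> 0"
      using assms(2) by (auto simp: mult_le_0_iff)
    then show ?thesis by (simp add: time_window_def del: of_nat_Suc)
  next
    case False
    then have "\<tau> > t + inverse (real (Suc n))" using that by auto
    then have "real (Suc n) * (\<tau> - t) \<ge> 1" by (simp add: field_simps)
    moreover have "real (Suc n) * (\<tau> - t) \<le> real (Suc n) * (\<tau> - s)"
      using assms(2) by (intro mult_left_mono) auto
    ultimately have "1 \<le> real (Suc n) * (\<tau> - s)" "1 \<le> real (Suc n) * (\<tau> - t)" by linarith+
    then show ?thesis by (simp add: time_window_def del: of_nat_Suc)
  qed
  then have supp: "\<tau> \<in> {s..t + inverse (real (Suc n))}" if "time_window s t n \<tau> \<noteq> 0" for \<tau>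
    using that by blast
  have "{s..t + inverse (real (Suc n))} \<subseteq> {0<..<T}" using assms by auto
  then have "compact_support_in {0<..<T} (time_window s t n)"
    by (rule compact_support_inI[OF compact_Icc _ supp])
  moreover have "C_diff k (time_window s t n)" for k
    unfolding time_window_def[abs_def] by (intro C_diff_diff C)
  ultimately show ?thesis by (simp add: test_fun_def)
qed

lemma time_window_derivative:
  "frechet_derivative (time_window s t n) (at \<tau>) 1
     = real (Suc n) * step_deriv (real (Suc n) * (\<tau> - s)) - real (Suc n) * step_deriv (real (Suc n) * (\<tau> - t))"
proof -
  have *: "((\<lambda>\<tau>. smooth_step (real (Suc n) * (\<tau> - s))) has_real_derivative real (Suc n) * step_deriv (real (Suc n) * (\<tau> - s))) (at \<tau>)" for s
    by (rule DERIV_cong[OF DERIV_chain2[OF step_deriv]]) (auto intro!: derivative_eq_intros)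
  have "(time_window s t n has_real_derivative real (Suc n) * step_deriv (real (Suc n) * (\<tau> - s)) - real (Suc n) * step_deriv (real (Suc n) * (\<tau> - t))) (at \<tau>)"
    unfolding time_window_def[abs_def] by (intro DERIV_diff *)
  from frechet_derivative_at[OF this[unfolded has_field_derivative_def]] show ?thesis by (metis mult.right_neutral)
qed

lemma time_window_bound: "\<bar>time_window s t n \<tau>\<bar> \<le> 1"
  using smooth_step_nonneg[of "real (Suc n) * (\<tau> - s)"] smooth_step_nonneg[of "real (Suc n) * (\<tau> - t)"]
    smooth_step_le_1[of "real (Suc n) * (\<tau> - s)"] smooth_step_le_1[of "real (Suc n) * (\<tau> - t)"]
  unfolding time_window_def by linarith

lemma time_window_tendsto:
  assumes "s < t"
  shows "(\<lambda>n. time_window s t n \<tau>) \<longlonglongrightarrow> indicator {s<..t} \<tau>"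
proof -
  have *: "(\<lambda>n. smooth_step (real (Suc n) * (\<tau> - s))) \<longlonglongrightarrow> indicator {s<..} \<tau>" for s
  proof (cases "s < \<tau>")
    case False
    then show ?thesis by (simp add: mult_nonneg_nonpos del: of_nat_Suc)
  next
    case True
    have "\<forall>\<^sub>F n in sequentially. 1 / (\<tau> - s) \<le> real n"
      using filterlim_real_sequentially by (simp add: filterlim_at_top)
    then have "\<forall>\<^sub>F n in sequentially. indicator {s<..} \<tau> = smooth_step (real (Suc n) * (\<tau> - s))"
    proof eventually_elim
      case (elim n)
      then have "1 \<le> real (Suc n) * (\<tau> - s)" using True by (simp add: field_simps) 
      then show ?case using True by (simp del: of_nat_Suc)
    qed
    then show ?thesis by (rule Lim_transform_eventually[OF tendsto_const])
  qed
  have "(\<lambda>n. time_window s t n \<tau>) \<longlonglongrightarrow> indicator {s<..} \<tau> - indicator {t<..} \<tau>"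
    unfolding time_window_def by (intro tendsto_diff *)
  moreover have "indicator {s<..} \<tau> - indicator {t<..} \<tau> = (indicator {s<..t} \<tau> :: real)"
    using assms by (auto simp: indicator_def)
  ultimately show ?thesis by simp
qed

lemma measurable_fst_lebesgue_on:
  fixes f :: "'a::euclidean_space \<Rightarrow> real" and S :: "('a \<times> real) set"
  assumes "f \<in> borel_measurable borel"
  shows "(\<lambda>z. f (fst z)) \<in> borel_measurable (lebesgue_on S)"
proof -
  have "(\<lambda>z::'a \<times> real. f (fst z)) \<in> borel_measurable borel"
    by (intro measurable_compose[OF _ assms]) (simp add: borel_prod[symmetric])
  then show ?thesis by (intro measurable_restrict_space1 measurable_completion) simp
qed

lemma measurable_snd_lebesgue_on:
  fixes f :: "real \<Rightarrow> real" and S :: "('a::euclidean_space \<times> real) set"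
  assumes "f \<in> borel_measurable borel"
  shows "(\<lambda>z. f (snd z)) \<in> borel_measurable (lebesgue_on S)"
proof -
  have "(\<lambda>z::'a \<times> real. f (snd z)) \<in> borel_measurable borel"
    by (intro measurable_compose[OF _ assms]) (simp add: borel_prod[symmetric])
  then show ?thesis by (intro measurable_restrict_space1 measurable_completion) simp
qed

lemma measurable_lborel_fst_snd:
  fixes f :: "'a::euclidean_space \<Rightarrow> real" and g :: "real \<Rightarrow> real"
  assumes "f \<in> borel_measurable borel" "g \<in> borel_measurable borel"
  shows "(\<lambda>z::'a \<times> real. f (fst z) * g (snd z)) \<in> borel_measurable borel"
proof (rule borel_measurable_times)
  show "(\<lambda>z::'a \<times> real. f (fst z)) \<in> borel_measurable borel"
    by (intro measurable_compose[OF _ assms(1)]) (simp add: borel_prod[symmetric])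
  show "(\<lambda>z::'a \<times> real. g (snd z)) \<in> borel_measurable borel"
    by (intro measurable_compose[OF _ assms(2)]) (simp add: borel_prod[symmetric])
qed

lemma test_fun_meas_bounded:
  assumes "\<psi> \<in> test_fun D"
  obtains B where "\<psi> \<in> borel_measurable borel" "\<And>x. \<bar>\<psi> x\<bar> \<le> B" "0 \<le> B"
  using compact_support_bounded[OF test_fun_D(2,3)[OF assms]] borel_measurable_continuous_onI[OF test_fun_D(2)[OF assms]]
  by metis

text \<open>\<open>w'\<close> is a Borel version of \<open>w\<close>, extended by zero. Continuity of \<open>u\<close> in time enters in a weak form only,
as continuity of the integrals against test functions; this form is stable under differences.\<close>
locale weak_time_derivative =
  fixes \<Omega> :: "'a::euclidean_space set" and T :: real and u w w' :: "'a \<times> real \<Rightarrow> real"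
  assumes open_\<Omega>: "open \<Omega>" and T: "0 < T"
    and u_int: "integrable (lebesgue_on (cyl \<Omega> T)) u"
    and w_int: "integrable (lebesgue_on (cyl \<Omega> T)) w"
    and time_deriv: "is_time_deriv \<Omega> T u w"
    and slice_int: "\<And>t. t \<in> {0..T} \<Longrightarrow> integrable (lebesgue_on \<Omega>) (\<lambda>x. u (x, t))"
    and weakly_continuous: "\<And>\<psi>. \<psi> \<in> test_fun \<Omega> \<Longrightarrow>
        continuous_on {0..T} (\<lambda>t. \<integral>x. u (x, t) * \<psi> x \<partial>lebesgue_on \<Omega>)"
    and w'_meas: "w' \<in> borel_measurable borel"
    and w'_outside: "\<And>z. z \<notin> cyl \<Omega> T \<Longrightarrow> w' z = 0"
    and w'_eq: "AE z in lborel. z \<in> cyl \<Omega> T \<longrightarrow> w z = w' z"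
begin

lemma w'_integrable: "integrable lborel w'"
  using lebesgue_on_borel_version(2)[OF cyl_borel[OF open_\<Omega>] w'_meas w'_outside w'_eq] w_int by simp

lemma w'_test_integrable:
  assumes "f \<in> borel_measurable borel" "\<And>x. \<bar>f x\<bar> \<le> B" "g \<in> borel_measurable borel" "\<And>t. \<bar>g t\<bar> \<le> C"
  shows "integrable lborel (\<lambda>z. w' z * (f (fst z) * g (snd z)))"
proof (rule integrable_times_bounded[OF w'_integrable])
  show "(\<lambda>z. f (fst z) * g (snd z)) \<in> borel_measurable lborel"
    using measurable_lborel_fst_snd[OF assms(1,3)] by simp
  show "\<bar>f (fst z) * g (snd z)\<bar> \<le> B * C" for z :: "'a \<times> real"
    unfolding abs_mult using assms(2)[of "fst z"] assms(4)[of "snd z"] by (intro mult_mono) auto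
qed

definition tested :: "('a \<Rightarrow> real) \<Rightarrow> real \<Rightarrow> real" where
  "tested \<psi> t = (\<integral>x. w' (x, t) * \<psi> x \<partial>lborel)"

lemma tested_integrable:
  assumes \<psi>: "\<psi> \<in> test_fun \<Omega>" and g: "g \<in> borel_measurable borel" "\<And>t. \<bar>g t\<bar> \<le> C"
  shows "integrable lborel (\<lambda>t. tested \<psi> t * g t)"
    and "(\<integral>t. tested \<psi> t * g t \<partial>lborel) = (\<integral>z. w' z * (\<psi> (fst z) * g (snd z)) \<partial>lborel)"
proof -
  obtain B where B: "\<psi> \<in> borel_measurable borel" "\<And>x. \<bar>\<psi> x\<bar> \<le> B" "0 \<le> B"
    by (rule test_fun_meas_bounded[OF \<psi>]) (rule that)
  have eq: "(\<integral>x. w' (x, t) * (\<psi> (fst (x, t)) * g (snd (x, t))) \<partial>lborel) = tested \<psi> t * g t" for t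
  proof -
    have "(\<integral>x. w' (x, t) * (\<psi> (fst (x, t)) * g (snd (x, t))) \<partial>lborel) = (\<integral>x. (w' (x, t) * \<psi> x) * g t \<partial>lborel)"
      by (simp add: mult.assoc)
    then show ?thesis by (simp add: tested_def)
  qed
  note F = lborel_Fubini(4,5)[OF w'_test_integrable[OF B(1,2) g]]
  show "integrable lborel (\<lambda>t. tested \<psi> t * g t)"
    "(\<integral>t. tested \<psi> t * g t \<partial>lborel) = (\<integral>z. w' z * (\<psi> (fst z) * g (snd z)) \<partial>lborel)"
    using F unfolding eq by auto
qed

text \<open>Test the definition of the weak derivative with \<open>\<psi> x * time_window s t n \<tau>\<close> and let \<open>n\<close> tend to infinity.
The end points of the time interval are reached afterwards by continuity.\<close>
lemma increment_interior:
  assumes \<psi>: "\<psi> \<in> test_fun \<Omega>" and st: "0 < s" "s < t" "t < T"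
  shows "(\<integral>x. u (x, t) * \<psi> x \<partial>lebesgue_on \<Omega>) - (\<integral>x. u (x, s) * \<psi> x \<partial>lebesgue_on \<Omega>)
    = (\<integral>\<tau>. tested \<psi> \<tau> * indicator {s<..t} \<tau> \<partial>lborel)"
proof -
  let ?h = "\<lambda>t. \<integral>x. u (x, t) * \<psi> x \<partial>lebesgue_on \<Omega>"
  let ?C = "cyl \<Omega> T"
  obtain B where B: "\<psi> \<in> borel_measurable borel" "\<And>x. \<bar>\<psi> x\<bar> \<le> B" "0 \<le> B"
    by (rule test_fun_meas_bounded[OF \<psi>]) (rule that)
  have id: "(\<integral>\<tau>. ?h \<tau> * frechet_derivative \<eta> (at \<tau>) 1 \<partial>lebesgue_on {0<..T}) = - (\<integral>\<tau>. tested \<psi> \<tau> * \<eta> \<tau> \<partial>lborel)"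
    if \<eta>: "\<eta> \<in> test_fun {0<..<T}" for \<eta>
  proof -
    let ?p = "\<lambda>z::'a \<times> real. \<psi> (fst z) * \<eta> (snd z)"
    obtain C where C: "\<eta> \<in> borel_measurable borel" "\<And>x. \<bar>\<eta> x\<bar> \<le> C" "0 \<le> C"
      by (rule test_fun_meas_bounded[OF \<eta>]) (rule that)
    let ?d = "\<lambda>\<tau>. frechet_derivative \<eta> (at \<tau>) 1"
    have dc: "continuous_on UNIV ?d" using test_fun_D(5)[OF \<eta>, of 1] by simp
    obtain E where E: "\<And>x. \<bar>?d x\<bar> \<le> E"
      using compact_support_bounded[OF dc derivative_compact_support[OF test_fun_D(3,4)[OF \<eta>]]] by metis
    have dm: "?d \<in> borel_measurable borel" using dc by (rule borel_measurable_continuous_onI)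
    have "(\<integral>z. u z * frechet_derivative ?p (at z) (0, 1) \<partial>lebesgue_on ?C) = - (\<integral>z. w z * ?p z \<partial>lebesgue_on ?C)"
      using time_deriv test_fun_prod(1)[OF \<psi> \<eta>] by (simp add: is_time_deriv_def)
    then have main: "(\<integral>z. u z * (\<psi> (fst z) * ?d (snd z)) \<partial>lebesgue_on ?C) = - (\<integral>z. w z * ?p z \<partial>lebesgue_on ?C)"
      by (simp only: test_fun_prod(2)[OF \<psi> \<eta>])
    have "integrable (lebesgue_on ?C) (\<lambda>z. u z * (\<psi> (fst z) * ?d (snd z)))"
    proof (rule integrable_times_bounded[OF u_int])
      show "(\<lambda>z. \<psi> (fst z) * ?d (snd z)) \<in> borel_measurable (lebesgue_on ?C)"
        by (intro borel_measurable_times measurable_fst_lebesgue_on[OF B(1)] measurable_snd_lebesgue_on[OF dm])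
      show "\<bar>\<psi> (fst z) * ?d (snd z)\<bar> \<le> B * E" for z :: "'a \<times> real"
        unfolding abs_mult using B(2)[of "fst z"] E[of "snd z"] B(3) by (intro mult_mono) auto
    qed
    from Fubini_lebesgue_on(2)[OF _ _ this]
    have "(\<integral>z. u z * (\<psi> (fst z) * ?d (snd z)) \<partial>lebesgue_on ?C)
        = (\<integral>\<tau>. (\<integral>x. u (x, \<tau>) * (\<psi> x * ?d \<tau>) \<partial>lebesgue_on \<Omega>) \<partial>lebesgue_on {0<..T})"
      using open_\<Omega> by simp
    also have "\<dots> = (\<integral>\<tau>. ?h \<tau> * ?d \<tau> \<partial>lebesgue_on {0<..T})"
    proof (rule Bochner_Integration.integral_cong[OF refl])
      fix \<tau>
      have "(\<integral>x. u (x, \<tau>) * (\<psi> x * ?d \<tau>) \<partial>lebesgue_on \<Omega>) = (\<integral>x. (u (x, \<tau>) * \<psi> x) * ?d \<tau> \<partial>lebesgue_on \<Omega>)"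
        by (simp only: mult.assoc)
      then show "(\<integral>x. u (x, \<tau>) * (\<psi> x * ?d \<tau>) \<partial>lebesgue_on \<Omega>) = ?h \<tau> * ?d \<tau>" by simp
    qed
    finally have L: "(\<integral>z. u z * (\<psi> (fst z) * ?d (snd z)) \<partial>lebesgue_on ?C) = (\<integral>\<tau>. ?h \<tau> * ?d \<tau> \<partial>lebesgue_on {0<..T})" .
    have "(\<integral>z. w z * ?p z \<partial>lebesgue_on ?C) = (\<integral>z. w' z * ?p z \<partial>lborel)"
    proof (rule lebesgue_on_borel_version(3)[OF cyl_borel[OF open_\<Omega>]])
      show "(\<lambda>z. w' z * ?p z) \<in> borel_measurable borel"
        by (intro borel_measurable_times[OF w'_meas] measurable_lborel_fst_snd B C)
      show "AE z in lborel. z \<in> ?C \<longrightarrow> w z * ?p z = w' z * ?p z"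
        using w'_eq by eventually_elim auto
    qed (simp add: w'_outside)
    also have "\<dots> = (\<integral>\<tau>. tested \<psi> \<tau> * \<eta> \<tau> \<partial>lborel)"
      using tested_integrable(2)[OF \<psi> C(1,2)] by simp
    finally show ?thesis using main L by simp
  qed
  note h_cont = weakly_continuous[OF \<psi>]
  let ?N = "\<lambda>n. real (Suc n)"
  let ?m = "\<lambda>s n \<tau>. ?h \<tau> * (?N n * step_deriv (?N n * (\<tau> - s)))"
  have m_int: "integrable (lebesgue_on {0<..T}) (?m s n)" for s n
  proof -
    have "continuous_on {0..T} (?m s n)"
      by (intro continuous_intros h_cont continuous_on_compose2[OF step_deriv_continuous]) auto
    then have "integrable lborel (\<lambda>\<tau>. indicator {0..T} \<tau> *\<^sub>R ?m s n \<tau>)"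
      by (intro borel_integrable_compact) auto
    then have "integrable lborel (\<lambda>\<tau>. indicator {0<..T} \<tau> *\<^sub>R (indicator {0..T} \<tau> *\<^sub>R ?m s n \<tau>))"
      by (rule integrable_mult_indicator[rotated]) simp
    moreover have "(\<lambda>\<tau>. indicator {0<..T} \<tau> *\<^sub>R (indicator {0..T} \<tau> *\<^sub>R ?m s n \<tau>)) = (\<lambda>\<tau>. indicator {0<..T} \<tau> *\<^sub>R ?m s n \<tau>)"
      by (auto simp: indicator_def fun_eq_iff)
    ultimately have i: "integrable lborel (\<lambda>\<tau>. indicator {0<..T} \<tau> *\<^sub>R ?m s n \<tau>)" by (simp only:)
    then have "integrable lebesgue (\<lambda>\<tau>. indicator {0<..T} \<tau> *\<^sub>R ?m s n \<tau>)"
      using integrable_completion[OF borel_measurable_integrable[OF i]] by simp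
    then show ?thesis using integrable_restrict_space[of "{0<..T}" lebesgue "?m s n"] by simp
  qed
  have lhs: "(\<lambda>n. (\<integral>\<tau>. ?m s n \<tau> \<partial>lebesgue_on {0<..T}) - (\<integral>\<tau>. ?m t n \<tau> \<partial>lebesgue_on {0<..T})) \<longlonglongrightarrow> ?h s - ?h t"
    using st by (intro tendsto_diff step_deriv_mollifies h_cont) auto
  have rhs: "(\<lambda>n. - (\<integral>\<tau>. tested \<psi> \<tau> * time_window s t n \<tau> \<partial>lborel))
      \<longlonglongrightarrow> - (\<integral>\<tau>. tested \<psi> \<tau> * indicator {s<..t} \<tau> \<partial>lborel)"
  proof (intro tendsto_minus integral_dominated_convergence)
    have i1: "integrable lborel (\<lambda>\<tau>. tested \<psi> \<tau>)"
      using tested_integrable(1)[OF \<psi>, of "\<lambda>_. 1" 1] by simp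
    then show "integrable lborel (\<lambda>\<tau>. \<bar>tested \<psi> \<tau>\<bar>)" by simp
    have [measurable]: "tested \<psi> \<in> borel_measurable borel" using i1 by auto
    have [measurable]: "smooth_step \<in> borel_measurable borel"
      using C_diff_smooth_step by (intro borel_measurable_continuous_onI C_diff_continuous)
    show "(\<lambda>\<tau>. tested \<psi> \<tau> * indicator {s<..t} \<tau>) \<in> borel_measurable lborel" by measurable
    show "(\<lambda>\<tau>. tested \<psi> \<tau> * time_window s t n \<tau>) \<in> borel_measurable lborel" for n
      unfolding time_window_def by measurable
    show "AE \<tau> in lborel. (\<lambda>n. tested \<psi> \<tau> * time_window s t n \<tau>) \<longlonglongrightarrow> tested \<psi> \<tau> * indicator {s<..t} \<tau>"
      using st by (intro always_eventually allI tendsto_mult tendsto_const time_window_tendsto) auto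
    show "AE \<tau> in lborel. norm (tested \<psi> \<tau> * time_window s t n \<tau>) \<le> \<bar>tested \<psi> \<tau>\<bar>" for n
      using time_window_bound[of s t n] by (intro always_eventually allI) (simp add: abs_mult mult_left_le)
  qed
  have eq: "\<forall>\<^sub>F n in sequentially. (\<integral>\<tau>. ?m s n \<tau> \<partial>lebesgue_on {0<..T}) - (\<integral>\<tau>. ?m t n \<tau> \<partial>lebesgue_on {0<..T})
      = - (\<integral>\<tau>. tested \<psi> \<tau> * time_window s t n \<tau> \<partial>lborel)"
  proof -
    have "\<forall>\<^sub>F n in sequentially. inverse (?N n) < T - t"
      using LIMSEQ_inverse_real_of_nat st by (intro order_tendstoD(2)[of _ 0]) auto
    then show ?thesis
    proof eventually_elim
      case (elim n)
      then have "time_window s t n \<in> test_fun {0<..<T}" using st by (intro time_window_test_fun) auto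
      from id[OF this] have "(\<integral>\<tau>. ?h \<tau> * (?N n * step_deriv (?N n * (\<tau> - s)) - ?N n * step_deriv (?N n * (\<tau> - t))) \<partial>lebesgue_on {0<..T})
        = - (\<integral>\<tau>. tested \<psi> \<tau> * time_window s t n \<tau> \<partial>lborel)"
        by (simp only: time_window_derivative)
      then show ?case
        using m_int[where s=s and n=n] m_int[where s=t and n=n] by (simp only: right_diff_distrib Bochner_Integration.integral_diff)
    qed
  qed
  have "?h s - ?h t = - (\<integral>\<tau>. tested \<psi> \<tau> * indicator {s<..t} \<tau> \<partial>lborel)"
    by (rule tendsto_unique[OF sequentially_bot Lim_transform_eventually[OF lhs eq] rhs])
  then show ?thesis by simp
qed

lemma increment:
  assumes \<psi>: "\<psi> \<in> test_fun \<Omega>" and t: "t \<in> {0..T}"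
  shows "(\<integral>x. u (x, t) * \<psi> x \<partial>lebesgue_on \<Omega>) - (\<integral>x. u (x, 0) * \<psi> x \<partial>lebesgue_on \<Omega>)
    = (\<integral>\<tau>. tested \<psi> \<tau> * indicator {..t} \<tau> \<partial>lborel)"
proof (cases "t = 0")
  case True
  have "tested \<psi> \<tau> * indicator {..0} \<tau> = 0" for \<tau>
    using w'_outside by (auto simp: tested_def indicator_def)
  then show ?thesis unfolding True by (simp only: diff_self integral_zero)
next
  case False
  then have t: "0 < t" "t \<le> T" using t by auto
  let ?h = "\<lambda>t. \<integral>x. u (x, t) * \<psi> x \<partial>lebesgue_on \<Omega>"
  (* inner approximation of (0, t); the index shift by 2 makes a k < t / 2 for all k *)
  define a where "a k = t * inverse (real (Suc (k + 2)))" for k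
  define b where "b k = t - a k" for k
  have a: "0 < a k" "a k < b k" "b k < T" "a k \<le> t" for k
  proof -
    have "inverse (real (Suc (k + 2))) \<le> 1/3" by (simp add: field_simps)
    then have "a k \<le> t * (1/3)" unfolding a_def using t by (intro mult_left_mono) auto
    moreover show "0 < a k" using t by (simp add: a_def)
    ultimately show "a k < b k" "b k < T" "a k \<le> t" using t by (auto simp: b_def)
  qed
  have "(\<lambda>k. inverse (real (Suc (k + 2)))) \<longlonglongrightarrow> 0"
    using LIMSEQ_ignore_initial_segment[OF LIMSEQ_inverse_real_of_nat, of 2] by simp
  then have "(\<lambda>k. t * inverse (real (Suc (k + 2)))) \<longlonglongrightarrow> t * 0" by (intro tendsto_intros)
  then have a_lim: "a \<longlonglongrightarrow> 0" by (simp add: a_def[abs_def])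
  then have b_lim: "b \<longlonglongrightarrow> t" unfolding b_def[abs_def] by (auto intro!: tendsto_eq_intros)
  have h_lim: "(\<lambda>k. ?h (c k)) \<longlonglongrightarrow> ?h l" if "c \<longlonglongrightarrow> l" "\<And>k. c k \<in> {0..T}" "l \<in> {0..T}" for c l
    using weakly_continuous[OF \<psi>] that unfolding continuous_on_sequentially by (auto simp: o_def)
  have ab: "a k \<in> {0..T}" "b k \<in> {0..T}" for k
    using a(1)[of k] a(2)[of k] a(3)[of k] by auto
  have "(\<lambda>k. ?h (b k) - ?h (a k)) \<longlonglongrightarrow> ?h t - ?h 0"
    using t ab by (intro tendsto_diff h_lim a_lim b_lim) auto
  moreover have "(\<lambda>k. \<integral>\<tau>. tested \<psi> \<tau> * indicator {a k<..b k} \<tau> \<partial>lborel) \<longlonglongrightarrow> (\<integral>\<tau>. tested \<psi> \<tau> * indicator {..t} \<tau> \<partial>lborel)"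
  proof (rule integral_dominated_convergence)
    have i1: "integrable lborel (\<lambda>\<tau>. tested \<psi> \<tau>)"
      using tested_integrable(1)[OF \<psi>, of "\<lambda>_. 1" 1] by simp
    then show "integrable lborel (\<lambda>\<tau>. \<bar>tested \<psi> \<tau>\<bar>)" by simp
    have [measurable]: "tested \<psi> \<in> borel_measurable borel" using i1 by auto
    show "(\<lambda>\<tau>. tested \<psi> \<tau> * indicator {..t} \<tau>) \<in> borel_measurable lborel" by measurable
    show "(\<lambda>\<tau>. tested \<psi> \<tau> * indicator {a k<..b k} \<tau>) \<in> borel_measurable lborel" for k by measurable
    show "AE \<tau> in lborel. norm (tested \<psi> \<tau> * indicator {a k<..b k} \<tau>) \<le> \<bar>tested \<psi> \<tau>\<bar>" for k
      by (intro always_eventually allI) (auto simp: indicator_def)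
    show "AE \<tau> in lborel. (\<lambda>k. tested \<psi> \<tau> * indicator {a k<..b k} \<tau>) \<longlonglongrightarrow> tested \<psi> \<tau> * indicator {..t} \<tau>"
      using AE_lborel_singleton[of t]
    proof eventually_elim
      case (elim \<tau>)
      consider "\<tau> \<le> 0" | "0 < \<tau>" "\<tau> < t" | "t < \<tau>" using elim by linarith
      then show ?case
      proof cases
        case 1
        then have "tested \<psi> \<tau> = 0" using w'_outside by (auto simp: tested_def)
        then show ?thesis by simp
      next
        case 2
        have "\<forall>\<^sub>F k in sequentially. a k < \<tau>" "\<forall>\<^sub>F k in sequentially. \<tau> < b k"
          using order_tendstoD(2)[OF a_lim 2(1)] order_tendstoD(1)[OF b_lim 2(2)] by auto
        then have "\<forall>\<^sub>F k in sequentially. tested \<psi> \<tau> * indicator {..t} \<tau> = tested \<psi> \<tau> * indicator {a k<..b k} \<tau>"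
          by eventually_elim (use 2 in \<open>auto simp: indicator_def\<close>)
        then show ?thesis by (rule Lim_transform_eventually[OF tendsto_const])
      next
        case 3
        have "b k \<le> t" for k using a(1)[of k] by (simp add: b_def)
        then have "\<tau> \<notin> {a k<..b k}" for k using 3 by (metis greaterThanAtMost_iff not_le order_trans)
        then show ?thesis using 3 by simp
      qed
    qed
  qed
  moreover have "?h (b k) - ?h (a k) = (\<integral>\<tau>. tested \<psi> \<tau> * indicator {a k<..b k} \<tau> \<partial>lborel)" for k
    using a by (intro increment_interior[OF \<psi>])
  ultimately show ?thesis using LIMSEQ_unique by auto
qed

end

lemma lborel_to_lebesgue_on:
  fixes f :: "'a::euclidean_space \<Rightarrow> real"
  assumes A: "A \<in> sets borel" and f: "f \<in> borel_measurable borel" and out: "\<And>x. x \<notin> A \<Longrightarrow> f x = 0"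
  shows "integrable (lebesgue_on A) f \<longleftrightarrow> integrable lborel f"
    and "(\<integral>x. f x \<partial>lebesgue_on A) = (\<integral>x. f x \<partial>lborel)"
  by (rule lebesgue_on_borel_version[OF A f out]; simp)+

lemma integrable_imp_loc_integrable:
  fixes f :: "'a::euclidean_space \<Rightarrow> real"
  assumes \<Omega>: "\<Omega> \<in> sets lebesgue" and f: "integrable (lebesgue_on \<Omega>) f"
  shows "loc_integrable \<Omega> f"
  unfolding loc_integrable_def
proof (intro allI impI)
  fix K assume K: "compact K \<and> K \<subseteq> \<Omega>"
  then have KL: "K \<in> sets lebesgue" by (simp add: borel_compact)
  have "integrable lebesgue (\<lambda>x. indicator \<Omega> x *\<^sub>R f x)"
    using f \<Omega> integrable_restrict_space[of \<Omega> lebesgue f] by simp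
  then have "integrable lebesgue (\<lambda>x. indicator K x *\<^sub>R (indicator \<Omega> x *\<^sub>R f x))"
    using KL by (rule integrable_mult_indicator[rotated])
  moreover have "(\<lambda>x. indicator K x *\<^sub>R (indicator \<Omega> x *\<^sub>R f x)) = (\<lambda>x. indicator K x *\<^sub>R f x)"
    using K by (auto simp: indicator_def fun_eq_iff)
  ultimately show "integrable (lebesgue_on K) f"
    using KL integrable_restrict_space[of K lebesgue f] by simp
qed

context weak_time_derivative
begin

definition accumulated :: "'a \<times> real \<Rightarrow> real" where
  "accumulated z = (\<integral>\<sigma>. indicator {..snd z} \<sigma> * w' (fst z, \<sigma>) \<partial>lborel)"

lemma accumulated_measurable: "accumulated \<in> borel_measurable borel"
proof -
  have [measurable]: "(fst :: 'a \<times> real \<Rightarrow> 'a) \<in> borel_measurable borel" "(snd :: 'a \<times> real \<Rightarrow> real) \<in> borel_measurable borel"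
    by (auto intro!: borel_measurable_continuous_onI continuous_intros)
  have [measurable]: "w' \<in> borel_measurable borel" by (rule w'_meas)
  have "(\<lambda>z. \<integral>\<sigma>. (if \<sigma> \<le> snd z then 1 else 0) * w' (fst z, \<sigma>) \<partial>lborel) \<in> borel_measurable borel"
    by measurable
  moreover have "accumulated = (\<lambda>z. \<integral>\<sigma>. (if \<sigma> \<le> snd z then 1 else 0) * w' (fst z, \<sigma>) \<partial>lborel)"
    unfolding accumulated_def[abs_def]
    by (intro ext Bochner_Integration.integral_cong) (auto simp: indicator_def)
  ultimately show ?thesis by simp
qed

lemma accumulated_slice_measurable: "(\<lambda>x. accumulated (x, t)) \<in> borel_measurable borel"
  by (intro measurable_compose[OF _ accumulated_measurable]) (simp add: borel_prod[symmetric])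

lemma accumulated_outside: "x \<notin> \<Omega> \<Longrightarrow> accumulated (x, t) = 0"
  using w'_outside by (simp add: accumulated_def)

lemma accumulated_integrable: "integrable lborel (\<lambda>x. accumulated (x, t))"
proof -
  have i: "integrable lborel (\<lambda>z. w' z * (1 * indicator {..t} (snd z)))"
    using w'_test_integrable[of "\<lambda>_. 1" 1 "indicator {..t}" 1] by (simp add: indicator_def)
  have "(\<integral>\<sigma>. w' (x, \<sigma>) * (1 * indicator {..t} (snd (x, \<sigma>))) \<partial>lborel) = accumulated (x, t)" for x
    unfolding accumulated_def by (intro Bochner_Integration.integral_cong) auto
  then show ?thesis using lborel_Fubini(2)[OF i] by simp
qed

text \<open>The fundamental theorem of calculus for a weak derivative, at each single time and for almost every
point in space. It follows from \<open>increment\<close> because test functions separate integrable functions.\<close>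
lemma slice_representation:
  assumes t: "t \<in> {0..T}"
  shows "AE x in lebesgue_on \<Omega>. u (x, t) = u (x, 0) + accumulated (x, t)"
proof -
  let ?W = "\<lambda>x. accumulated (x, t)"
  have \<Omega>b: "\<Omega> \<in> sets borel" using open_\<Omega> by simp
  have iW: "integrable (lebesgue_on \<Omega>) ?W"
    using lborel_to_lebesgue_on(1)[OF \<Omega>b accumulated_slice_measurable accumulated_outside] accumulated_integrable by simp
  have i: "integrable (lebesgue_on \<Omega>) (\<lambda>x. u (x, t))" "integrable (lebesgue_on \<Omega>) (\<lambda>x. u (x, 0))"
    using slice_int t T by auto
  have loc: "loc_integrable \<Omega> (\<lambda>x. u (x, t))" "loc_integrable \<Omega> (\<lambda>x. u (x, 0))" "loc_integrable \<Omega> ?W"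
    using integrable_imp_loc_integrable[of \<Omega>] i iW \<Omega>b by auto
  have "AE x in lebesgue_on \<Omega>. u (x, t) - u (x, 0) - ?W x = 0"
  proof (rule fundamental_lemma[OF open_\<Omega>])
    show "loc_integrable \<Omega> (\<lambda>x. u (x, t) - u (x, 0) - ?W x)"
      by (intro loc_integrable_diff loc)
    fix \<psi> assume \<psi>: "\<psi> \<in> test_fun \<Omega>"
    obtain B where B: "\<psi> \<in> borel_measurable borel" "\<And>x. \<bar>\<psi> x\<bar> \<le> B" "0 \<le> B"
      by (rule test_fun_meas_bounded[OF \<psi>]) (rule that)
    have "(\<integral>x. ?W x * \<psi> x \<partial>lebesgue_on \<Omega>) = (\<integral>x. ?W x * \<psi> x \<partial>lborel)"
      using accumulated_slice_measurable B(1) accumulated_outside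
      by (intro lborel_to_lebesgue_on(2)[OF \<Omega>b] borel_measurable_times) auto
    also have "\<dots> = (\<integral>x. (\<integral>\<sigma>. w' (x, \<sigma>) * (\<psi> (fst (x, \<sigma>)) * indicator {..t} (snd (x, \<sigma>))) \<partial>lborel) \<partial>lborel)"
    proof (rule Bochner_Integration.integral_cong[OF refl])
      fix x
      have "(\<integral>\<sigma>. w' (x, \<sigma>) * (\<psi> (fst (x, \<sigma>)) * indicator {..t} (snd (x, \<sigma>))) \<partial>lborel)
          = (\<integral>\<sigma>. \<psi> x * (indicator {..t} \<sigma> * w' (x, \<sigma>)) \<partial>lborel)"
        by (intro Bochner_Integration.integral_cong) auto
      then show "?W x * \<psi> x = (\<integral>\<sigma>. w' (x, \<sigma>) * (\<psi> (fst (x, \<sigma>)) * indicator {..t} (snd (x, \<sigma>))) \<partial>lborel)"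
        by (simp add: accumulated_def mult.commute)
    qed
    also have "\<dots> = (\<integral>z. w' z * (\<psi> (fst z) * indicator {..t} (snd z)) \<partial>lborel)"
      using w'_test_integrable[OF B(1,2), of "indicator {..t}" 1] by (intro lborel_Fubini(3)) (simp add: indicator_def)
    also have "\<dots> = (\<integral>\<tau>. tested \<psi> \<tau> * indicator {..t} \<tau> \<partial>lborel)"
      by (rule tested_integrable(2)[OF \<psi>, symmetric, of _ 1]) (auto simp: indicator_def)
    also have "\<dots> = (\<integral>x. u (x, t) * \<psi> x \<partial>lebesgue_on \<Omega>) - (\<integral>x. u (x, 0) * \<psi> x \<partial>lebesgue_on \<Omega>)"
      using increment[OF \<psi> t] by simp
    finally show "(\<integral>x. (u (x, t) - u (x, 0) - ?W x) * \<psi> x \<partial>lebesgue_on \<Omega>) = 0"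
      using integrable_loc_times_test(1)[OF open_\<Omega> loc(1) \<psi>] integrable_loc_times_test(1)[OF open_\<Omega> loc(2) \<psi>]
        integrable_loc_times_test(1)[OF open_\<Omega> loc(3) \<psi>]
      by (simp add: left_diff_distrib)
  qed
  then show ?thesis by eventually_elim simp
qed

text \<open>For almost every \<open>x\<close> the function \<open>t \<mapsto> u (x, t)\<close> is an initial value plus a running integral of \<open>w'\<close>, so
\<open>integral_running_integral\<close> gives the identity on the time line through \<open>x\<close>. Integrate over \<open>x\<close>.\<close>
theorem energy_identity:
  assumes u2: "u \<in> L_var (lebesgue_on (cyl \<Omega> T)) (\<lambda>_. 2)" and w2: "w \<in> L_var (lebesgue_on (cyl \<Omega> T)) (\<lambda>_. 2)"
    and slice2: "\<And>t. t \<in> {0..T} \<Longrightarrow> (\<lambda>x. u (x, t)) \<in> L_var (lebesgue_on \<Omega>) (\<lambda>_. 2)"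
    and \<tau>: "\<tau> \<in> {0..T}"
  shows "(\<integral>z. time_cut \<tau> z * (w z * u z) \<partial>lebesgue_on (cyl \<Omega> T))
    = 1/2 * (\<integral>x. (u (x, \<tau>))\<^sup>2 \<partial>lebesgue_on \<Omega>) - 1/2 * (\<integral>x. (u (x, 0))\<^sup>2 \<partial>lebesgue_on \<Omega>)"
proof -
  let ?C = "cyl \<Omega> T"
  have \<Omega>b: "\<Omega> \<in> sets borel" using open_\<Omega> by simp
  note Cb = cyl_borel[OF open_\<Omega>, of T]
  have 0: "0 \<in> {0..T}" using T by simp
  obtain u0 where u0: "u0 \<in> borel_measurable borel" "\<And>x. x \<notin> \<Omega> \<Longrightarrow> u0 x = 0" "AE x in lborel. x \<in> \<Omega> \<longrightarrow> u (x, 0) = u0 x"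
  proof (rule borel_version[OF \<Omega>b])
    show "(\<lambda>x. u (x, 0)) \<in> borel_measurable (lebesgue_on \<Omega>)" using slice2[OF 0] by (simp add: L2_iff)
  qed (rule that)
  define U where "U z = u0 (fst z) + accumulated z" for z
  have [measurable]: "(fst :: 'a \<times> real \<Rightarrow> 'a) \<in> borel_measurable borel" "(snd :: 'a \<times> real \<Rightarrow> real) \<in> borel_measurable borel"
    by (auto intro!: borel_measurable_continuous_onI continuous_intros)
  have [measurable]: "accumulated \<in> borel_measurable borel" "w' \<in> borel_measurable borel" "u0 \<in> borel_measurable borel"
    by (rule accumulated_measurable, rule w'_meas, rule u0(1))
  have [measurable]: "U \<in> borel_measurable borel" unfolding U_def[abs_def] by measurable
  have Um: "(\<lambda>x. U (x, t)) \<in> borel_measurable borel" for t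
    unfolding U_def using accumulated_slice_measurable u0(1) by simp
  have U_out: "x \<notin> \<Omega> \<Longrightarrow> U (x, t) = 0" for x t
    by (simp add: U_def u0(2) accumulated_outside)
  have slice: "AE x in lebesgue_on \<Omega>. u (x, t) = U (x, t)" if t: "t \<in> {0..T}" for t
  proof -
    have "AE x in lebesgue_on \<Omega>. u (x, 0) = u0 x" using u0(3) unfolding AE_lebesgue_on_iff[OF \<Omega>b] .
    with slice_representation[OF t] show ?thesis by eventually_elim (simp add: U_def)
  qed
  have uU: "AE z in lebesgue_on ?C. u z = U z"
  proof (rule AE_from_slices)
    have "u \<in> borel_measurable (lebesgue_on ?C)" "U \<in> borel_measurable (lebesgue_on ?C)"
      using u2 by (auto simp: L2_iff intro!: measurable_restrict_space1 measurable_completion)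
    then have "{z \<in> space (lebesgue_on ?C). u z = U z} \<in> sets (lebesgue_on ?C)" by measurable
    then show "{z \<in> ?C. u z = U z} \<in> sets lebesgue"
      using cyl_lebesgue[OF open_\<Omega>, of T] by (simp add: sets_restrict_space_iff)
    show "AE t in lebesgue_on {0<..T}. AE x in lebesgue_on \<Omega>. u (x, t) = U (x, t)"
    proof (rule AE_I2)
      fix t assume "t \<in> space (lebesgue_on {0<..T})"
      then show "AE x in lebesgue_on \<Omega>. u (x, t) = U (x, t)" by (intro slice) simp
    qed
  qed (use \<Omega>b in auto)
  define F where "F z = indicator {..\<tau>} (snd z) * (w' z * U z)" for z :: "'a \<times> real"
  have Fm: "F \<in> borel_measurable borel"
  proof -
    have "(\<lambda>z. (if snd z \<le> \<tau> then 1 else 0) * (w' z * U z)) \<in> borel_measurable borel" by measurable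
    moreover have "F = (\<lambda>z. (if snd z \<le> \<tau> then 1 else 0) * (w' z * U z))" by (auto simp: F_def indicator_def)
    ultimately show ?thesis by simp
  qed
  have F_out: "z \<notin> ?C \<Longrightarrow> F z = 0" for z by (simp add: F_def w'_outside)
  have F_eq: "AE z in lborel. z \<in> ?C \<longrightarrow> time_cut \<tau> z * (w z * u z) = F z"
  proof -
    have "AE z in lborel. z \<in> ?C \<longrightarrow> u z = U z" using uU unfolding AE_lebesgue_on_iff[OF Cb] .
    with w'_eq show ?thesis by eventually_elim (auto simp: F_def time_cut_def)
  qed
  have "integrable (lebesgue_on ?C) (\<lambda>z. w z * u z * time_cut \<tau> z)"
  proof (rule integrable_times_bounded[OF L2_mult_integrable[OF w2 u2] time_cut_measurable])
    show "\<bar>time_cut \<tau> z\<bar> \<le> 1" for z :: "'a \<times> real" by (simp add: time_cut_def indicator_def)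
  qed
  then have "integrable (lebesgue_on ?C) (\<lambda>z. time_cut \<tau> z * (w z * u z))" by (simp add: mult.commute)
  then have Fi: "integrable lborel F"
    using lebesgue_on_borel_version(2)[OF Cb Fm F_out F_eq] by simp
  have inner: "AE x in lborel. (\<integral>\<sigma>. F (x, \<sigma>) \<partial>lborel) = 1/2 * (U (x, \<tau>))\<^sup>2 - 1/2 * (u0 x)\<^sup>2"
    using lborel_Fubini(1)[OF w'_integrable]
  proof eventually_elim
    case (elim x)
    let ?v = "\<lambda>\<sigma>. w' (x, \<sigma>)" and ?A = "\<lambda>\<sigma>. accumulated (x, \<sigma>)"
    have A: "accumulated (x, t) = (\<integral>\<sigma>. indicator {..t} \<sigma> * ?v \<sigma> \<partial>lborel)" for t by (simp add: accumulated_def)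
    note R = integral_running_integral[OF elim, folded A]
    have i1: "integrable lborel (\<lambda>\<sigma>. indicator {..\<tau>} \<sigma> * ?v \<sigma>)"
      using integrable_mult_indicator[of "{..\<tau>}" lborel ?v] elim by simp
    have "integrable lborel (\<lambda>\<sigma>. (indicator {..\<tau>} \<sigma> * ?v \<sigma>) * ?A \<sigma>)"
      using R(1) by (intro integrable_times_bounded[OF i1 _ R(2)]) simp
    then have i2: "integrable lborel (\<lambda>\<sigma>. indicator {..\<tau>} \<sigma> * (?v \<sigma> * ?A \<sigma>))" by (simp add: mult.assoc)
    have "(\<integral>\<sigma>. F (x, \<sigma>) \<partial>lborel) = (\<integral>\<sigma>. u0 x * (indicator {..\<tau>} \<sigma> * ?v \<sigma>) + indicator {..\<tau>} \<sigma> * (?v \<sigma> * ?A \<sigma>) \<partial>lborel)"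
      by (intro Bochner_Integration.integral_cong) (auto simp: F_def U_def algebra_simps)
    also have "\<dots> = u0 x * ?A \<tau> + 1/2 * (?A \<tau>)\<^sup>2"
    proof -
      have "(\<integral>\<sigma>. u0 x * (indicator {..\<tau>} \<sigma> * ?v \<sigma>) \<partial>lborel) = u0 x * ?A \<tau>" by (simp add: A)
      then show ?thesis
        by (subst Bochner_Integration.integral_add[OF integrable_mult_right[OF i1] i2]) (simp only: R(3))
    qed
    also have "\<dots> = 1/2 * (U (x, \<tau>))\<^sup>2 - 1/2 * (u0 x)\<^sup>2"
      by (simp add: U_def power2_sum field_simps)
    finally show ?case .
  qed
  have sq: "integrable lborel (\<lambda>x. (U (x, t))\<^sup>2) \<and> (\<integral>x. (U (x, t))\<^sup>2 \<partial>lborel) = (\<integral>x. (u (x, t))\<^sup>2 \<partial>lebesgue_on \<Omega>)"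
    if t: "t \<in> {0..T}" for t
  proof -
    have m: "(\<lambda>x. (U (x, t))\<^sup>2) \<in> borel_measurable borel" using Um by simp
    have o: "x \<notin> \<Omega> \<Longrightarrow> (U (x, t))\<^sup>2 = 0" for x by (simp add: U_out)
    have "AE x in lborel. x \<in> \<Omega> \<longrightarrow> u (x, t) = U (x, t)" using slice[OF t] unfolding AE_lebesgue_on_iff[OF \<Omega>b] .
    then have ae: "AE x in lborel. x \<in> \<Omega> \<longrightarrow> (u (x, t))\<^sup>2 = (U (x, t))\<^sup>2" by eventually_elim simp
    show ?thesis
      using lebesgue_on_borel_version(2,3)[OF \<Omega>b m o ae] slice2[OF t] by (simp add: L2_iff)
  qed
  have U0: "U (x, 0) = u0 x" for x
  proof -
    have "accumulated (x, 0) = (\<integral>\<sigma>. 0 \<partial>(lborel :: real measure))"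
      unfolding accumulated_def
      by (intro Bochner_Integration.integral_cong) (auto simp: indicator_def w'_outside)
    then show ?thesis by (simp add: U_def)
  qed
  have "(\<integral>z. time_cut \<tau> z * (w z * u z) \<partial>lebesgue_on ?C) = (\<integral>z. F z \<partial>lborel)"
    by (rule lebesgue_on_borel_version(3)[OF Cb Fm F_out F_eq])
  also have "\<dots> = (\<integral>x. (\<integral>\<sigma>. F (x, \<sigma>) \<partial>lborel) \<partial>lborel)" using lborel_Fubini(3)[OF Fi] by simp
  also have "\<dots> = (\<integral>x. 1/2 * (U (x, \<tau>))\<^sup>2 - 1/2 * (u0 x)\<^sup>2 \<partial>lborel)"
    using inner lborel_Fubini(2)[OF Fi] Um[of \<tau>] u0(1) by (intro integral_cong_AE) auto
  also have "\<dots> = 1/2 * (\<integral>x. (U (x, \<tau>))\<^sup>2 \<partial>lborel) - 1/2 * (\<integral>x. (u0 x)\<^sup>2 \<partial>lborel)"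
    using sq[OF \<tau>] sq[OF 0] by (simp add: U0)
  finally show ?thesis using sq[OF \<tau>] sq[OF 0] by (simp add: U0)
qed

end

section \<open>The setting of the double phase problem\<close>

lemma L2_norm_sq: "(L2_norm M f)\<^sup>2 = (\<integral>x. (f x)\<^sup>2 \<partial>M)"
  unfolding L2_norm_def by (intro real_sqrt_pow2) simp

lemma L2_integrable_finite:
  assumes "finite_measure M" "f \<in> L_var M (\<lambda>_. 2)"
  shows "integrable M f"
proof (rule Bochner_Integration.integrable_bound)
  show "integrable M (\<lambda>x. 1 + (f x)\<^sup>2)"
    using assms finite_measure.integrable_const[OF assms(1)]
    by (intro Bochner_Integration.integrable_add) (auto simp: L2_iff)
  show "f \<in> borel_measurable M" using assms by (simp add: L2_iff)
  have "\<bar>y\<bar> \<le> \<bar>1 + y\<^sup>2\<bar>" for y :: real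
    using sum_squares_bound[of 1 "\<bar>y\<bar>"] by simp
  then show "AE x in M. norm (f x) \<le> norm (1 + (f x)\<^sup>2)" by simp
qed

lemma test_fun_L2: 
  assumes "open \<Omega>" "\<psi> \<in> test_fun \<Omega>" shows "\<psi> \<in> L_var (lebesgue_on \<Omega>) (\<lambda>_. 2)"
  using test_fun_integrable[OF assms(1) test_fun_mult[OF assms(2,2)]] test_fun_integrable[OF assms]
  by (auto simp: L2_iff power2_eq_square)

lemma C_L2_weakly_continuous:
  assumes \<Omega>: "open \<Omega>" and u: "u \<in> C_L2 \<Omega> T" and \<psi>: "\<psi> \<in> test_fun \<Omega>"
  shows "continuous_on {0..T} (\<lambda>t. \<integral>x. u (x, t) * \<psi> x \<partial>lebesgue_on \<Omega>)"
  unfolding continuous_on_def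
proof
  let ?M = "lebesgue_on \<Omega>" and ?h = "\<lambda>t. \<integral>x. u (x, t) * \<psi> x \<partial>lebesgue_on \<Omega>"
  note \<psi>2 = test_fun_L2[OF \<Omega> \<psi>]
  fix t assume t: "t \<in> {0..T}"
  have u2: "(\<lambda>x. u (x, s)) \<in> L_var ?M (\<lambda>_. 2)" if "s \<in> {0..T}" for s
    using u that by (auto simp: C_L2_def)
  have le: "norm (?h s - ?h t) \<le> L2_norm ?M (\<lambda>x. u (x, s) - u (x, t)) * L2_norm ?M \<psi>" if s: "s \<in> {0..T}" for s
  proof -
    have "?h s - ?h t = (\<integral>x. (u (x, s) - u (x, t)) * \<psi> x \<partial>?M)"
      using L2_mult_integrable[OF u2[OF s] \<psi>2] L2_mult_integrable[OF u2[OF t] \<psi>2] by (simp add: left_diff_distrib)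
    then have "norm (?h s - ?h t) = \<bar>\<integral>x. (u (x, s) - u (x, t)) * \<psi> x \<partial>?M\<bar>" by (metis real_norm_def)
    also have "\<dots> \<le> L2_norm ?M (\<lambda>x. u (x, s) - u (x, t)) * L2_norm ?M \<psi>"
      by (rule Cauchy_Schwarz_integral[OF L2_diff[OF u2[OF s] u2[OF t]] \<psi>2])
    finally show ?thesis .
  qed
  have "((\<lambda>s. L2_norm ?M (\<lambda>x. u (x, s) - u (x, t)) * L2_norm ?M \<psi>) \<longlongrightarrow> 0 * L2_norm ?M \<psi>) (at t within {0..T})"
    using u t by (intro tendsto_mult tendsto_const) (simp add: C_L2_def)
  then have lim: "((\<lambda>s. L2_norm ?M (\<lambda>x. u (x, s) - u (x, t)) * L2_norm ?M \<psi>) \<longlongrightarrow> 0) (at t within {0..T})"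
    by (simp only: mult_zero_left)
  have "\<forall>\<^sub>F s in at t within {0..T}. norm (?h s - ?h t) \<le> L2_norm ?M (\<lambda>x. u (x, s) - u (x, t)) * L2_norm ?M \<psi>"
    unfolding eventually_at_filter using le by (intro always_eventually allI impI)
  then have "((\<lambda>s. ?h s - ?h t) \<longlongrightarrow> 0) (at t within {0..T})"
    using lim by (rule Lim_null_comparison)
  then show "(?h \<longlongrightarrow> ?h t) (at t within {0..T})" by (simp add: LIM_zero_iff)
qed

lemma is_time_deriv_diff:
  fixes \<Omega> :: "'a::euclidean_space set"
  assumes i: "integrable (lebesgue_on (cyl \<Omega> T)) u1" "integrable (lebesgue_on (cyl \<Omega> T)) u2"
      "integrable (lebesgue_on (cyl \<Omega> T)) w1" "integrable (lebesgue_on (cyl \<Omega> T)) w2"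
    and 1: "is_time_deriv \<Omega> T u1 w1" and 2: "is_time_deriv \<Omega> T u2 w2"
  shows "is_time_deriv \<Omega> T (\<lambda>z. u1 z - u2 z) (\<lambda>z. w1 z - w2 z)"
  unfolding is_time_deriv_def
proof (intro conjI ballI)
  show "loc_integrable (\<Omega> \<times> {0<..<T}) (\<lambda>z. u1 z - u2 z)" "loc_integrable (\<Omega> \<times> {0<..<T}) (\<lambda>z. w1 z - w2 z)"
    using 1 2 by (auto simp: is_time_deriv_def intro: loc_integrable_diff)
  fix \<phi> :: "'a \<times> real \<Rightarrow> real" assume \<phi>: "\<phi> \<in> test_fun (\<Omega> \<times> {0<..<T})"
  let ?M = "lebesgue_on (cyl \<Omega> T)" and ?d = "\<lambda>z. frechet_derivative \<phi> (at z) (0, 1)"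
  have lm: "f \<in> borel_measurable ?M" if "f \<in> borel_measurable borel" for f :: "'a \<times> real \<Rightarrow> real"
    using that by (intro measurable_restrict_space1 measurable_completion) simp
  have b: "(0, 1) \<in> (Basis :: ('a \<times> real) set)" by (simp add: Basis_prod_def)
  have int1: "integrable ?M (\<lambda>z. f z * \<phi> z)" if "integrable ?M f" for f
  proof -
    obtain B where "\<phi> \<in> borel_measurable borel" "\<And>x. \<bar>\<phi> x\<bar> \<le> B" "0 \<le> B"
      by (rule test_fun_meas_bounded[OF \<phi>]) (rule that)
    then show ?thesis using that by (intro integrable_times_bounded lm)
  qed
  have dc: "continuous_on UNIV ?d" by (rule test_fun_D(5)[OF \<phi> b])
  have int2: "integrable ?M (\<lambda>z. f z * ?d z)" if f: "integrable ?M f" for f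
  proof -
    obtain B where B: "\<And>x. \<bar>?d x\<bar> \<le> B" "0 \<le> B"
      by (rule compact_support_bounded[OF dc derivative_compact_support[OF test_fun_D(3,4)[OF \<phi>]]]) (rule that)
    show ?thesis
      by (rule integrable_times_bounded[OF f lm[OF borel_measurable_continuous_onI[OF dc]] B(1)])
  qed
  have "(\<integral>z. u1 z * ?d z \<partial>?M) = - (\<integral>z. w1 z * \<phi> z \<partial>?M)" "(\<integral>z. u2 z * ?d z \<partial>?M) = - (\<integral>z. w2 z * \<phi> z \<partial>?M)"
    using 1 2 \<phi> by (auto simp: is_time_deriv_def)
  then show "(\<integral>z. (u1 z - u2 z) * ?d z \<partial>?M) = - (\<integral>z. (w1 z - w2 z) * \<phi> z \<partial>?M)"
    using int1[OF i(3)] int1[OF i(4)] int2[OF i(1)] int2[OF i(2)] by (simp add: left_diff_distrib)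
qed

lemma AE_snd_neq: "AE z in lborel. snd (z :: 'a::euclidean_space \<times> real) \<noteq> t"
proof -
  have "closed {z :: 'a \<times> real. snd z = t}"
    by (intro closed_Collect_eq continuous_intros)
  then have N: "{z :: 'a \<times> real. snd z = t} \<in> sets borel" by (rule borel_closed)
  have "AE y in lborel. AE x in (lborel :: 'a measure). (x, y) \<notin> {z. snd z = t}"
    using AE_lborel_singleton[of t] by eventually_elim auto
  then show ?thesis using AE_lborel_swap[OF N] by simp
qed

text \<open>The two domains of integration differ by a subset of the null set \<open>\<Omega> \<times> {\<tau>}\<close>.\<close>
lemma integral_time_cut:
  fixes \<Omega> :: "'a::euclidean_space set" and h :: "'a \<times> real \<Rightarrow> real"
  assumes \<Omega>: "open \<Omega>" and h: "h \<in> borel_measurable (lebesgue_on (cyl \<Omega> T))" and \<tau>: "\<tau> \<in> {0..T}"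
  shows "(\<integral>z. h z \<partial>lebesgue_on (\<Omega> \<times> {0<..<\<tau>})) = (\<integral>z. time_cut \<tau> z * h z \<partial>lebesgue_on (cyl \<Omega> T))"
proof -
  let ?C = "cyl \<Omega> T" and ?D = "\<Omega> \<times> {0<..<\<tau>}"
  have D: "?D \<in> sets lebesgue"
    using sets_lborel_prod_Times[of \<Omega> "{0<..<\<tau>}"] \<Omega> by (intro sets_completionI_sets) simp
  note C = cyl_lebesgue[OF \<Omega>, of T]
  have m: "(\<lambda>z. indicator ?C z *\<^sub>R h z) \<in> borel_measurable lebesgue"
    using h C borel_measurable_restrict_space_iff[of ?C lebesgue h] by simp

  have "(\<lambda>z. indicator ?D z *\<^sub>R (indicator ?C z *\<^sub>R h z)) \<in> borel_measurable lebesgue"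
    using D by (intro borel_measurable_scaleR[OF _ m] borel_measurable_indicator)
  moreover have "(\<lambda>z. indicator ?D z *\<^sub>R (indicator ?C z *\<^sub>R h z)) = (\<lambda>z. indicator ?D z *\<^sub>R h z)"
    using \<tau> by (auto simp: indicator_def fun_eq_iff)
  ultimately have mD: "(\<lambda>z. indicator ?D z *\<^sub>R h z) \<in> borel_measurable lebesgue" by (simp only:)
  have "(\<lambda>z. time_cut \<tau> z * h z) \<in> borel_measurable (lebesgue_on ?C)"
    using h time_cut_measurable by (rule borel_measurable_times[rotated])
  then have mC: "(\<lambda>z. indicator ?C z *\<^sub>R (time_cut \<tau> z * h z)) \<in> borel_measurable lebesgue"
    using C borel_measurable_restrict_space_iff[of ?C lebesgue "\<lambda>z. time_cut \<tau> z * h z"] by simp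
  have "(\<integral>z. h z \<partial>lebesgue_on ?D) = (\<integral>z. indicator ?D z *\<^sub>R h z \<partial>lebesgue)"
    using D by (intro integral_restrict_space) simp
  also have "\<dots> = (\<integral>z. indicator ?C z *\<^sub>R (time_cut \<tau> z * h z) \<partial>lebesgue)"
  proof (rule integral_cong_AE[OF mD mC])
    show "AE z in lebesgue. indicator ?D z *\<^sub>R h z = indicator ?C z *\<^sub>R (time_cut \<tau> z * h z)"
      using AE_completion[OF AE_snd_neq[of \<tau>]]
    proof eventually_elim
      case (elim z)
      obtain x t where "z = (x, t)" by (cases z)
      then show ?case using elim \<tau> by (auto simp: indicator_def time_cut_def)
    qed
  qed
  also have "\<dots> = (\<integral>z. time_cut \<tau> z * h z \<partial>lebesgue_on ?C)"
    using C by (intro integral_restrict_space[symmetric]) simp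
  finally show ?thesis .
qed

text \<open>The constant \<open>C\<close> may depend on \<open>\<epsilon>\<close>, which is what absorption arguments provide.\<close>
lemma tendsto_0_ennreal_if:
  fixes X :: "nat \<Rightarrow> ennreal" and d :: "nat \<Rightarrow> real"
  assumes d: "d \<longlonglongrightarrow> 0" and X: "\<And>\<epsilon>. 0 < \<epsilon> \<Longrightarrow> \<exists>C. \<forall>k. X k \<le> ennreal (C * d k + \<epsilon>)"
  shows "X \<longlonglongrightarrow> 0"
proof (rule order_tendstoI)
  fix y :: ennreal assume "0 < y"
  then obtain y' where y': "0 < y'" "y' < y" using dense by blast
  then obtain e where e: "y' = ennreal e" "0 < e"
    by (cases y') (auto simp: ennreal_less_zero_iff)
  obtain C where C: "\<And>k. X k \<le> ennreal (C * d k + e / 2)" using X[of "e / 2"] e by auto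
  have "(\<lambda>k. C * d k + e / 2) \<longlonglongrightarrow> C * 0 + e / 2" by (intro tendsto_intros d)
  from order_tendstoD(2)[OF this, of e] have "\<forall>\<^sub>F k in sequentially. C * d k + e / 2 < e" using e by simp
  then show "\<forall>\<^sub>F k in sequentially. X k < y"
  proof eventually_elim
    case (elim k)
    have "X k \<le> ennreal e" using C[of k] elim by (meson ennreal_leI less_imp_le order_trans)
    then show ?case using y'(2) e(1) by simp
  qed
qed simp

text \<open>What the data provide on the compact closure of the cylinder: continuity, ellipticity and bounds. The numbers \<open>m\<close> and \<open>R\<close> bound both exponents, and \<open>A\<close> bounds both coefficients.\<close>
locale double_phase =
  fixes \<Omega> :: "'a::euclidean_space set" and T :: real and p q a b :: "'a \<times> real \<Rightarrow> real" and m R \<alpha> A :: real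
  assumes \<Omega>: "open \<Omega>" "bounded \<Omega>" and T: "0 < T"
    and cont: "continuous_on (closure (cyl \<Omega> T)) p" "continuous_on (closure (cyl \<Omega> T)) q"
      "continuous_on (closure (cyl \<Omega> T)) a" "continuous_on (closure (cyl \<Omega> T)) b"
    and m: "1 < m"
    and exps: "\<And>z. z \<in> closure (cyl \<Omega> T) \<Longrightarrow> m \<le> p z \<and> p z \<le> R \<and> m \<le> q z \<and> q z \<le> R"
    and coeffs: "\<And>z. z \<in> closure (cyl \<Omega> T) \<Longrightarrow> 0 \<le> a z \<and> a z \<le> A \<and> 0 \<le> b z \<and> b z \<le> A"
    and \<alpha>: "0 < \<alpha>" and nondeg: "\<And>z. z \<in> closure (cyl \<Omega> T) \<Longrightarrow> \<alpha> \<le> a z + b z"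
begin

abbreviation "M \<equiv> lebesgue_on (cyl \<Omega> T)"
abbreviation "s_max \<equiv> (\<lambda>z. max (p z) (q z))"
abbreviation "grad \<equiv> space_grad \<Omega> T"
abbreviation "F \<equiv> flux_coeff p q a b"

lemma cyl_in_closure: "z \<in> cyl \<Omega> T \<Longrightarrow> z \<in> closure (cyl \<Omega> T)"
  using closure_subset[of "cyl \<Omega> T"] by blast

lemma finite_M: "finite_measure M"
proof (rule finite_measure_lebesgue_on)
  have "bounded (cyl \<Omega> T)" using \<Omega>(2) by (intro bounded_Times) auto
  then show "cyl \<Omega> T \<in> lmeasurable"
    using cyl_lebesgue[OF \<Omega>(1)] by (intro bounded_set_imp_lmeasurable)
qed

lemma finite_\<Omega>: "finite_measure (lebesgue_on \<Omega>)"
  using \<Omega> by (intro finite_measure_lebesgue_on bounded_set_imp_lmeasurable) auto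

lemma data_measurable [measurable]: "p \<in> borel_measurable M" "q \<in> borel_measurable M" "a \<in> borel_measurable M" "b \<in> borel_measurable M"
  using cont by (auto intro: continuous_measurable_cyl[OF \<Omega>(1)])

lemma s_max_cont: "continuous_on (closure (cyl \<Omega> T)) s_max"
  by (intro continuous_intros cont)

lemma s_max_bounds: "z \<in> closure (cyl \<Omega> T) \<Longrightarrow> 0 \<le> s_max z \<and> s_max z \<le> R"
  using exps[of z] m by auto

definition flux :: "'a \<times> real \<Rightarrow> 'a \<Rightarrow> 'a" where
  "flux z \<xi> = F z \<xi> *\<^sub>R \<xi>"

text \<open>The quantity that monotonicity makes nonnegative; in the form \<open>gap_flux\<close> it arises when the difference of
two equations is tested with the difference of the solutions.\<close>
definition gap :: "'a \<times> real \<Rightarrow> 'a \<Rightarrow> 'a \<Rightarrow> real" where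
  "gap z \<xi> \<eta> = a z * mono_gap (p z) \<xi> \<eta> + b z * mono_gap (q z) \<xi> \<eta>"

lemma gap_flux: "(flux z \<xi> - flux z \<eta>) \<bullet> (\<xi> - \<eta>) = gap z \<xi> \<eta>"
  by (simp add: gap_def flux_def mono_gap_def flux_coeff_def algebra_simps inner_diff_left inner_add_left)

lemma gap_nonneg: "z \<in> cyl \<Omega> T \<Longrightarrow> 0 \<le> gap z \<xi> \<eta>"
  unfolding gap_def using coeffs[OF cyl_in_closure, of z] exps[OF cyl_in_closure, of z] m
  by (intro add_nonneg_nonneg mult_nonneg_nonneg mono_gap_nonneg) auto

lemma F_norm_sq: "F z \<xi> * (norm \<xi>)\<^sup>2 = a z * norm \<xi> powr p z + b z * norm \<xi> powr q z"
  by (simp add: flux_coeff_def distrib_right mult.assoc norm_powr_mult_sq)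

lemma flux_inner_self: "flux z \<xi> \<bullet> \<xi> = F z \<xi> * (norm \<xi>)\<^sup>2"
  by (simp add: flux_def power2_norm_eq_inner)

lemma flux_measurable:
  assumes [measurable]: "G \<in> borel_measurable M"
  shows "(\<lambda>z. flux z (G z)) \<in> borel_measurable M"
  unfolding flux_def flux_coeff_def by measurable

text \<open>Young's inequality in a crude form: replace both arguments by their maximum, then the exponent \<open>r\<close>
by the larger one \<open>s\<close>.\<close>
lemma powr_pair_bound:
  fixes x y r s :: real
  assumes "1 < r" "r \<le> s" "0 \<le> x" "0 \<le> y"
  shows "x powr (r - 1) * y \<le> 2 + x powr s + y powr s"
proof -
  have le1: "t powr r \<le> 1 + t powr s" if "0 \<le> t" for t :: real
  proof (cases "1 \<le> t")
    case True
    then show ?thesis using powr_mono[OF assms(2) True] by simp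
  next
    case False
    then have "t powr r \<le> 1 powr r" using that assms by (intro powr_mono2) auto
    then show ?thesis by (simp add: add_increasing2)
  qed
  have "x powr (r - 1) * y \<le> max x y powr (r - 1) * max x y"
    using assms by (intro mult_mono powr_mono2) auto
  also have "\<dots> = max x y powr r"
    using norm_powr_minus_1[of "max x y" "r + 1 :: real"] assms
    by (cases "max x y = 0") (auto simp: powr_diff)
  also have "\<dots> \<le> x powr r + y powr r" by (simp add: max_def)
  also have "\<dots> \<le> (1 + x powr s) + (1 + y powr s)" using le1 assms by (intro add_mono) auto
  finally show ?thesis by simp
qed

text \<open>Every pairing of a flux with a gradient is absolutely integrable. The sums of integrals in the
equation can therefore be split and recombined freely.\<close>
lemma flux_integrable:
  assumes G: "G \<in> borel_measurable M" "(\<lambda>z. norm (G z)) \<in> L_var M s_max"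
    and H: "H \<in> borel_measurable M" "(\<lambda>z. norm (H z)) \<in> L_var M s_max"
  shows "integrable M (\<lambda>z. flux z (G z) \<bullet> H z)"
proof (rule Bochner_Integration.integrable_bound)
  have powi: "integrable M (\<lambda>z. norm (K z) powr s_max z)"
    if "K \<in> borel_measurable M" "(\<lambda>z. norm (K z)) \<in> L_var M s_max" for K :: "'a \<times> real \<Rightarrow> 'a"
  proof (rule integrableI_bounded)
    show "(\<lambda>z. norm (K z) powr s_max z) \<in> borel_measurable M" using that(1) by measurable
    show "(\<integral>\<^sup>+z. ennreal (norm (norm (K z) powr s_max z)) \<partial>M) < \<infinity>"
      using that(2) by (simp add: musielak_def power_fun_def)
  qed
  show "integrable M (\<lambda>z. (2 * A) * (2 + norm (G z) powr s_max z + norm (H z) powr s_max z))"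
    using powi[OF G] powi[OF H] finite_measure.integrable_const[OF finite_M]
    by (intro integrable_mult_right Bochner_Integration.integrable_add)
  show "(\<lambda>z. flux z (G z) \<bullet> H z) \<in> borel_measurable M"
    using flux_measurable[OF G(1)] H(1) by (rule borel_measurable_inner)
  show "AE z in M. norm (flux z (G z) \<bullet> H z) \<le> norm ((2 * A) * (2 + norm (G z) powr s_max z + norm (H z) powr s_max z))"
  proof (rule AE_I2)
    fix z assume "z \<in> space M"
    then have z: "z \<in> closure (cyl \<Omega> T)" using cyl_in_closure by simp
    note e = exps[OF z] and c = coeffs[OF z]
    let ?B = "2 + norm (G z) powr s_max z + norm (H z) powr s_max z"
    have F0: "0 \<le> F z (G z)" using c by (simp add: flux_coeff_def)
    have "\<bar>flux z (G z) \<bullet> H z\<bar> \<le> norm (flux z (G z)) * norm (H z)" by (rule Cauchy_Schwarz_ineq2)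
    also have "norm (flux z (G z)) = F z (G z) * norm (G z)" using F0 by (simp add: flux_def)
    also have "\<dots> = a z * norm (G z) powr (p z - 1) + b z * norm (G z) powr (q z - 1)"
      by (simp add: flux_coeff_def distrib_right mult.assoc norm_powr_minus_1)
    also have "\<dots> * norm (H z) = a z * (norm (G z) powr (p z - 1) * norm (H z)) + b z * (norm (G z) powr (q z - 1) * norm (H z))"
      by (simp add: distrib_right mult.assoc)
    also have "\<dots> \<le> A * ?B + A * ?B"
      using e c m by (intro add_mono mult_mono powr_pair_bound) auto
    also have "\<dots> = (2 * A) * ?B" by simp
    finally show "norm (flux z (G z) \<bullet> H z) \<le> norm ((2 * A) * ?B)" by simp
  qed
qed

definition solves :: "('a \<Rightarrow> real) \<Rightarrow> ('a \<times> real \<Rightarrow> real) \<Rightarrow> ('a \<times> real \<Rightarrow> real) \<Rightarrow> bool" where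
  "solves u0 f u \<longleftrightarrow> admissible \<Omega> T p q a b u0 f \<and> strong_solution \<Omega> T p q a b u0 f u \<and> u \<in> C_L2 \<Omega> T"

text \<open>The first term of the Musielak function has an exponent that is at least 2.\<close>
lemma admissible_u0_L2:
  assumes "admissible \<Omega> T p q a b u0 f"
  shows "u0 \<in> L_var (lebesgue_on \<Omega>) (\<lambda>_. 2)"
proof -
  let ?N = "lebesgue_on \<Omega>" and ?s = "\<lambda>x. max 2 (min (p (x, 0)) (q (x, 0)))"
  have u0: "u0 \<in> borel_measurable ?N" "(\<integral>\<^sup>+x. ennreal (H_init p q a b x \<bar>u0 x\<bar>) \<partial>?N) < \<infinity>"
    using assms by (auto simp: admissible_def W1_0_def W1_def musielak_def)
  have in_cl: "(x, 0) \<in> closure (cyl \<Omega> T)" if "x \<in> \<Omega>" for x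
    using that closure_subset[of \<Omega>] T unfolding closure_cyl[OF T] by auto
  have [measurable]: "(\<lambda>x. p (x, 0)) \<in> borel_measurable ?N" "(\<lambda>x. q (x, 0)) \<in> borel_measurable ?N"
    using cont T by (auto intro: continuous_measurable_slice[OF \<Omega>(1)])
  note [measurable] = u0(1)
  have "(\<integral>\<^sup>+x. ennreal (\<bar>u0 x\<bar> powr 2) \<partial>?N) \<le> (\<integral>\<^sup>+x. 1 + ennreal (\<bar>u0 x\<bar> powr ?s x) \<partial>?N)"
  proof (rule nn_integral_mono)
    fix x
    have "\<bar>u0 x\<bar> powr 2 \<le> 1 + \<bar>u0 x\<bar> powr ?s x"
    proof (cases "1 \<le> \<bar>u0 x\<bar>")
      case True
      then show ?thesis using powr_mono[of 2 "?s x" "\<bar>u0 x\<bar>"] by simp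
    next
      case False
      then have "\<bar>u0 x\<bar> powr 2 \<le> 1 powr 2" by (intro powr_mono2) auto
      then show ?thesis by (simp add: add_increasing2)
    qed
    then show "ennreal (\<bar>u0 x\<bar> powr 2) \<le> 1 + ennreal (\<bar>u0 x\<bar> powr ?s x)"
      by (metis ennreal_1 ennreal_leI ennreal_plus powr_ge_zero zero_le_one)
  qed
  also have "\<dots> = emeasure ?N (space ?N) + (\<integral>\<^sup>+x. ennreal (\<bar>u0 x\<bar> powr ?s x) \<partial>?N)"
    by (subst nn_integral_add) auto
  also have "(\<integral>\<^sup>+x. ennreal (\<bar>u0 x\<bar> powr ?s x) \<partial>?N) \<le> (\<integral>\<^sup>+x. ennreal (H_init p q a b x \<bar>u0 x\<bar>) \<partial>?N)"
  proof (rule nn_integral_mono)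
    fix x assume "x \<in> space ?N"
    then have "0 \<le> a (x, 0)" "0 \<le> b (x, 0)" using coeffs[OF in_cl, of x] by auto
    then show "ennreal (\<bar>u0 x\<bar> powr ?s x) \<le> ennreal (H_init p q a b x \<bar>u0 x\<bar>)"
      unfolding H_init_def by (intro ennreal_leI) (simp add: add.assoc)
  qed
  finally have "(\<integral>\<^sup>+x. ennreal (\<bar>u0 x\<bar> powr 2) \<partial>?N) \<le> emeasure ?N (space ?N) + (\<integral>\<^sup>+x. ennreal (H_init p q a b x \<bar>u0 x\<bar>) \<partial>?N)"
    by (simp add: add_left_mono)
  also have "\<dots> < \<infinity>" using u0(2) finite_measure.emeasure_finite[OF finite_\<Omega>] by (simp add: less_top)
  finally show ?thesis using u0(1) by (simp add: musielak_def power_fun_def)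
qed

context
  fixes u0 f u
  assumes sol: "solves u0 f u"
begin

lemma sol_W: "u \<in> W_space \<Omega> T s_max"
  using sol by (simp add: solves_def strong_solution_def)

lemma sol_L2: "u \<in> L_var M (\<lambda>_. 2)" "f \<in> L_var M (\<lambda>_. 2)" "time_deriv \<Omega> T u \<in> L_var M (\<lambda>_. 2)" "u0 \<in> L_var (lebesgue_on \<Omega>) (\<lambda>_. 2)"
  "t \<in> {0..T} \<Longrightarrow> (\<lambda>x. u (x, t)) \<in> L_var (lebesgue_on \<Omega>) (\<lambda>_. 2)"
  using W_space_D(1)[OF sol_W] sol admissible_u0_L2
  by (auto simp: solves_def strong_solution_def admissible_def L2_W12_0_def C_L2_def)

lemma sol_time_deriv: "is_time_deriv \<Omega> T u (time_deriv \<Omega> T u)"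
proof -
  obtain w where "is_time_deriv \<Omega> T u w" using sol by (auto simp: solves_def strong_solution_def)
  then show ?thesis unfolding time_deriv_def by (rule someI[of "is_time_deriv \<Omega> T u"])
qed

lemma sol_grad: "grad u \<in> borel_measurable M" "(\<lambda>z. norm (grad u z)) \<in> L_var M s_max"
  using W_space_D(3,4)[OF sol_W] by auto

lemma sol_weakly_continuous:
  "\<psi> \<in> test_fun \<Omega> \<Longrightarrow> continuous_on {0..T} (\<lambda>t. \<integral>x. u (x, t) * \<psi> x \<partial>lebesgue_on \<Omega>)"
  using sol by (intro C_L2_weakly_continuous[OF \<Omega>(1)]) (auto simp: solves_def)

text \<open>The initial condition fixes the limit of \<open>\<integral> u \<psi>\<close> at time 0, and continuity in time identifies
the limit with the value of the representative at time 0.\<close>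
lemma sol_initial: "AE x in lebesgue_on \<Omega>. u (x, 0) = u0 x"
proof -
  let ?N = "lebesgue_on \<Omega>"
  have \<Omega>L: "\<Omega> \<in> sets lebesgue" using \<Omega>(1) by simp
  have 0: "0 \<in> {0..T}" using T by simp
  have loc: "loc_integrable \<Omega> (\<lambda>x. u (x, t))" if "t \<in> {0..T}" for t
    using L2_integrable_finite[OF finite_\<Omega> sol_L2(5)[OF that]] by (rule integrable_imp_loc_integrable[OF \<Omega>L])
  have loc0: "loc_integrable \<Omega> u0"
    using L2_integrable_finite[OF finite_\<Omega> sol_L2(4)] by (rule integrable_imp_loc_integrable[OF \<Omega>L])
  have "AE x in ?N. u (x, 0) - u0 x = 0"
  proof (rule fundamental_lemma[OF \<Omega>(1)])
    show "loc_integrable \<Omega> (\<lambda>x. u (x, 0) - u0 x)" by (intro loc_integrable_diff loc[OF 0] loc0)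
    fix \<psi> assume \<psi>: "\<psi> \<in> test_fun \<Omega>"
    have split: "(\<integral>x. (u (x, t) - u0 x) * \<psi> x \<partial>?N) = (\<integral>x. u (x, t) * \<psi> x \<partial>?N) - (\<integral>x. u0 x * \<psi> x \<partial>?N)" if "t \<in> {0..T}" for t
      using integrable_loc_times_test(1)[OF \<Omega>(1) loc[OF that] \<psi>] integrable_loc_times_test(1)[OF \<Omega>(1) loc0 \<psi>]
      by (simp add: left_diff_distrib)
    have "((\<lambda>t. \<integral>x. u (x, t) * \<psi> x \<partial>?N) \<longlongrightarrow> (\<integral>x. u (x, 0) * \<psi> x \<partial>?N)) (at 0 within {0..T})"
      using sol_weakly_continuous[OF \<psi>] 0 by (simp add: continuous_on_def)
    moreover have "at 0 within {0..T} = at_right 0" using T by (simp add: at_within_Icc_at_right)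
    ultimately have "((\<lambda>t. (\<integral>x. u (x, t) * \<psi> x \<partial>?N) - (\<integral>x. u0 x * \<psi> x \<partial>?N))
        \<longlongrightarrow> (\<integral>x. u (x, 0) * \<psi> x \<partial>?N) - (\<integral>x. u0 x * \<psi> x \<partial>?N)) (at_right 0)"
      by (intro tendsto_diff tendsto_const) simp
    moreover have "\<forall>\<^sub>F t in at_right 0. (\<integral>x. u (x, t) * \<psi> x \<partial>?N) - (\<integral>x. u0 x * \<psi> x \<partial>?N) = (\<integral>x. (u (x, t) - u0 x) * \<psi> x \<partial>?N)"
      using eventually_at_right_real[OF T] by eventually_elim (simp add: split)
    ultimately have "((\<lambda>t. \<integral>x. (u (x, t) - u0 x) * \<psi> x \<partial>?N) \<longlongrightarrow> (\<integral>x. (u (x, 0) - u0 x) * \<psi> x \<partial>?N)) (at_right 0)"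
      unfolding split[OF 0] by (rule Lim_transform_eventually)
    moreover have "((\<lambda>t. \<integral>x. (u (x, t) - u0 x) * \<psi> x \<partial>?N) \<longlongrightarrow> 0) (at_right 0)"
      using sol test_fun_D(1)[OF \<psi>, of 1] test_fun_D(3)[OF \<psi>] by (auto simp: solves_def strong_solution_def)
    ultimately show "(\<integral>x. (u (x, 0) - u0 x) * \<psi> x \<partial>?N) = 0"
      using tendsto_unique[OF trivial_limit_at_right_real] by blast
  qed
  then show ?thesis by eventually_elim simp
qed

lemma time_cut_integrable: "integrable M h \<Longrightarrow> integrable M (\<lambda>z. time_cut \<tau> z * h z)" for h :: "'a \<times> real \<Rightarrow> real"
  using integrable_times_bounded[OF _ time_cut_measurable[of \<tau> "cyl \<Omega> T"], of h 1]
  by (simp add: time_cut_def indicator_def mult.commute)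

lemma sol_weak_form:
  assumes \<phi>: "\<phi> \<in> W_space \<Omega> T s_max"
  shows "(\<integral>z. time_cut \<tau> z * (time_deriv \<Omega> T u z * \<phi> z) \<partial>M)
      + (\<integral>z. time_cut \<tau> z * (flux z (grad u z) \<bullet> grad \<phi> z) \<partial>M) = (\<integral>z. time_cut \<tau> z * (f z * \<phi> z) \<partial>M)"
proof -
  let ?\<phi> = "\<lambda>z. time_cut \<tau> z * \<phi> z"
  note cut = W_space_cut[OF \<Omega>(1) \<phi>, of \<tau>]
  have "(\<integral>z. time_deriv \<Omega> T u z * ?\<phi> z \<partial>M) + (\<integral>z. flux z (grad u z) \<bullet> grad ?\<phi> z \<partial>M) = (\<integral>z. f z * ?\<phi> z \<partial>M)"
    using sol cut(1) by (auto simp: solves_def strong_solution_def flux_def)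
  moreover have "(\<integral>z. flux z (grad u z) \<bullet> grad ?\<phi> z \<partial>M) = (\<integral>z. time_cut \<tau> z * (flux z (grad u z) \<bullet> grad \<phi> z) \<partial>M)"
  proof (rule integral_cong_AE)
    note fm = flux_measurable[OF sol_grad(1)]
    show "(\<lambda>z. flux z (grad u z) \<bullet> grad ?\<phi> z) \<in> borel_measurable M"
      using fm W_space_D(3)[OF cut(1)] by (rule borel_measurable_inner)
    show "(\<lambda>z. time_cut \<tau> z * (flux z (grad u z) \<bullet> grad \<phi> z)) \<in> borel_measurable M"
      using time_cut_measurable borel_measurable_inner[OF fm W_space_D(3)[OF \<phi>]] by (rule borel_measurable_times)
    show "AE z in M. flux z (grad u z) \<bullet> grad ?\<phi> z = time_cut \<tau> z * (flux z (grad u z) \<bullet> grad \<phi> z)"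
      using cut(2) by eventually_elim simp
  qed
  moreover have "(\<integral>z. h z * ?\<phi> z \<partial>M) = (\<integral>z. time_cut \<tau> z * (h z * \<phi> z) \<partial>M)" for h
    by (intro Bochner_Integration.integral_cong refl) (simp add: mult.left_commute)
  ultimately show ?thesis by simp
qed

end

end

section \<open>Energy equality and continuous dependence\<close>

context double_phase
begin

lemma W_s_max_diff:
  assumes "u \<in> W_space \<Omega> T s_max" "v \<in> W_space \<Omega> T s_max"
  shows "(\<lambda>z. u z - v z) \<in> W_space \<Omega> T s_max"
    and "AE z in M. grad (\<lambda>z. u z - v z) z = grad u z - grad v z"
  by (rule W_space_diff[OF \<Omega>(1) s_max_cont _ assms]; erule s_max_bounds)+

lemma energy_identity_cyl:
  assumes "u \<in> L_var M (\<lambda>_. 2)" "w \<in> L_var M (\<lambda>_. 2)" "is_time_deriv \<Omega> T u w"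
    and "\<And>t. t \<in> {0..T} \<Longrightarrow> (\<lambda>x. u (x, t)) \<in> L_var (lebesgue_on \<Omega>) (\<lambda>_. 2)"
    and "\<And>\<psi>. \<psi> \<in> test_fun \<Omega> \<Longrightarrow> continuous_on {0..T} (\<lambda>t. \<integral>x. u (x, t) * \<psi> x \<partial>lebesgue_on \<Omega>)"
    and "\<tau> \<in> {0..T}"
  shows "(\<integral>z. time_cut \<tau> z * (w z * u z) \<partial>M)
    = 1/2 * (\<integral>x. (u (x, \<tau>))\<^sup>2 \<partial>lebesgue_on \<Omega>) - 1/2 * (\<integral>x. (u (x, 0))\<^sup>2 \<partial>lebesgue_on \<Omega>)"
proof -
  have "w \<in> borel_measurable M" using assms(2) by (simp add: L2_iff)
  then obtain w' where w': "w' \<in> borel_measurable borel" "\<And>z. z \<notin> cyl \<Omega> T \<Longrightarrow> w' z = 0"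
      "AE z in lborel. z \<in> cyl \<Omega> T \<longrightarrow> w z = w' z"
    by (rule borel_version[OF cyl_borel[OF \<Omega>(1)]]) (rule that)
  have "weak_time_derivative \<Omega> T u w w'"
    by (intro weak_time_derivative.intro \<Omega>(1) T L2_integrable_finite[OF finite_M] L2_integrable_finite[OF finite_\<Omega>] assms w')
  from weak_time_derivative.energy_identity[OF this assms(1,2,4,6)] show ?thesis .
qed

lemma energy_equality:
  assumes sol: "solves u0 f u" and \<tau>: "\<tau> \<in> {0..T}"
  shows "1/2 * (L2_norm (lebesgue_on \<Omega>) (\<lambda>x. u (x, \<tau>)))\<^sup>2 + (\<integral>z. F z (grad u z) * (norm (grad u z))\<^sup>2 \<partial>lebesgue_on (\<Omega> \<times> {0<..<\<tau>}))
     = 1/2 * (L2_norm (lebesgue_on \<Omega>) u0)\<^sup>2 + (\<integral>z. u z * f z \<partial>lebesgue_on (\<Omega> \<times> {0<..<\<tau>}))"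
proof -
  note L2 = sol_L2[OF sol] and g = sol_grad[OF sol]
  have "(\<integral>z. time_cut \<tau> z * (time_deriv \<Omega> T u z * u z) \<partial>M)
    = 1/2 * (\<integral>x. (u (x, \<tau>))\<^sup>2 \<partial>lebesgue_on \<Omega>) - 1/2 * (\<integral>x. (u (x, 0))\<^sup>2 \<partial>lebesgue_on \<Omega>)"
    by (rule energy_identity_cyl[OF L2(1,3) sol_time_deriv[OF sol] L2(5) sol_weakly_continuous[OF sol] \<tau>])
  moreover have "(\<integral>x. (u (x, 0))\<^sup>2 \<partial>lebesgue_on \<Omega>) = (\<integral>x. (u0 x)\<^sup>2 \<partial>lebesgue_on \<Omega>)"
  proof (rule integral_cong_AE)
    show "(\<lambda>x. (u (x, 0))\<^sup>2) \<in> borel_measurable (lebesgue_on \<Omega>)" "(\<lambda>x. (u0 x)\<^sup>2) \<in> borel_measurable (lebesgue_on \<Omega>)"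
      using L2(4) L2(5)[of 0] T by (auto simp: L2_iff)
    show "AE x in lebesgue_on \<Omega>. (u (x, 0))\<^sup>2 = (u0 x)\<^sup>2" using sol_initial[OF sol] by eventually_elim simp
  qed
  moreover have "(\<integral>z. F z (grad u z) * (norm (grad u z))\<^sup>2 \<partial>lebesgue_on (\<Omega> \<times> {0<..<\<tau>}))
      = (\<integral>z. time_cut \<tau> z * (flux z (grad u z) \<bullet> grad u z) \<partial>M)"
    using integral_time_cut[OF \<Omega>(1) borel_measurable_integrable[OF flux_integrable[OF g g]] \<tau>]
    by (simp only: flux_inner_self)
  moreover have "(\<integral>z. u z * f z \<partial>lebesgue_on (\<Omega> \<times> {0<..<\<tau>})) = (\<integral>z. time_cut \<tau> z * (f z * u z) \<partial>M)"
    using integral_time_cut[OF \<Omega>(1) borel_measurable_integrable[OF L2_mult_integrable[OF L2(1,2)]] \<tau>]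
    by (simp only: mult.commute[of "u _"])
  ultimately show ?thesis
    using sol_weak_form[OF sol sol_W[OF sol], of \<tau>] unfolding L2_norm_sq by simp
qed

lemma gap_integrable:
  assumes "solves u0 f u" "solves v0 g v"
  shows "integrable M (\<lambda>z. gap z (grad u z) (grad v z))"
proof -
  note G = sol_grad[OF assms(1)] and H = sol_grad[OF assms(2)]
  have "(\<lambda>z. gap z (grad u z) (grad v z)) = (\<lambda>z. flux z (grad u z) \<bullet> grad u z - flux z (grad u z) \<bullet> grad v z
      - flux z (grad v z) \<bullet> grad u z + flux z (grad v z) \<bullet> grad v z)"
    by (simp add: gap_flux[symmetric] inner_diff_left inner_diff_right fun_eq_iff)
  then show ?thesis
    using flux_integrable[OF G G] flux_integrable[OF G H] flux_integrable[OF H G] flux_integrable[OF H H] by simp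
qed

text \<open>Subtract the two weak formulations, both tested with \<open>u - v\<close> cut off at \<open>\<tau>\<close>.\<close>
lemma difference_energy:
  assumes u: "solves u0 f u" and v: "solves v0 g v" and \<tau>: "\<tau> \<in> {0..T}"
  shows "1/2 * (\<integral>x. (u (x, \<tau>) - v (x, \<tau>))\<^sup>2 \<partial>lebesgue_on \<Omega>) + (\<integral>z. time_cut \<tau> z * gap z (grad u z) (grad v z) \<partial>M)
     = 1/2 * (\<integral>x. (u0 x - v0 x)\<^sup>2 \<partial>lebesgue_on \<Omega>) + (\<integral>z. time_cut \<tau> z * ((f z - g z) * (u z - v z)) \<partial>M)"
proof -
  let ?w = "\<lambda>z. u z - v z" and ?ut = "time_deriv \<Omega> T u" and ?vt = "time_deriv \<Omega> T v"
  note U = sol_L2[OF u] and V = sol_L2[OF v] and G = sol_grad[OF u] and H = sol_grad[OF v]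
  note W = W_s_max_diff[OF sol_W[OF u] sol_W[OF v]]
  have w2: "?w \<in> L_var M (\<lambda>_. 2)" by (rule L2_diff[OF U(1) V(1)])
  have energy: "(\<integral>z. time_cut \<tau> z * ((?ut z - ?vt z) * ?w z) \<partial>M)
    = 1/2 * (\<integral>x. (u (x, \<tau>) - v (x, \<tau>))\<^sup>2 \<partial>lebesgue_on \<Omega>) - 1/2 * (\<integral>x. (u (x, 0) - v (x, 0))\<^sup>2 \<partial>lebesgue_on \<Omega>)"
  proof (rule energy_identity_cyl[OF w2 L2_diff[OF U(3) V(3)] _ _ _ \<tau>])
    show "is_time_deriv \<Omega> T ?w (\<lambda>z. ?ut z - ?vt z)"
      by (intro is_time_deriv_diff L2_integrable_finite[OF finite_M] U(1,3) V(1,3) sol_time_deriv[OF u] sol_time_deriv[OF v])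
    show "(\<lambda>x. ?w (x, t)) \<in> L_var (lebesgue_on \<Omega>) (\<lambda>_. 2)" if "t \<in> {0..T}" for t
      by (rule L2_diff[OF U(5)[OF that] V(5)[OF that]])
    fix \<psi> assume \<psi>: "\<psi> \<in> test_fun \<Omega>"
    note \<psi>2 = test_fun_L2[OF \<Omega>(1) \<psi>]
    have "continuous_on {0..T} (\<lambda>t. (\<integral>x. u (x, t) * \<psi> x \<partial>lebesgue_on \<Omega>) - (\<integral>x. v (x, t) * \<psi> x \<partial>lebesgue_on \<Omega>))"
      by (intro continuous_intros sol_weakly_continuous[OF u \<psi>] sol_weakly_continuous[OF v \<psi>])
    also have "?this \<longleftrightarrow> continuous_on {0..T} (\<lambda>t. \<integral>x. ?w (x, t) * \<psi> x \<partial>lebesgue_on \<Omega>)"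
    proof (rule continuous_on_cong[OF refl])
      fix t assume t: "t \<in> {0..T}"
      show "(\<integral>x. u (x, t) * \<psi> x \<partial>lebesgue_on \<Omega>) - (\<integral>x. v (x, t) * \<psi> x \<partial>lebesgue_on \<Omega>) = (\<integral>x. ?w (x, t) * \<psi> x \<partial>lebesgue_on \<Omega>)"
        unfolding left_diff_distrib
        by (rule Bochner_Integration.integral_diff[OF L2_mult_integrable[OF U(5)[OF t] \<psi>2] L2_mult_integrable[OF V(5)[OF t] \<psi>2], symmetric])
    qed
    finally show "continuous_on {0..T} (\<lambda>t. \<integral>x. ?w (x, t) * \<psi> x \<partial>lebesgue_on \<Omega>)" .
  qed
  have initial: "(\<integral>x. (u (x, 0) - v (x, 0))\<^sup>2 \<partial>lebesgue_on \<Omega>) = (\<integral>x. (u0 x - v0 x)\<^sup>2 \<partial>lebesgue_on \<Omega>)"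
  proof (rule integral_cong_AE)
    have "(\<lambda>x. u (x, 0) - v (x, 0)) \<in> L_var (lebesgue_on \<Omega>) (\<lambda>_. 2)" "(\<lambda>x. u0 x - v0 x) \<in> L_var (lebesgue_on \<Omega>) (\<lambda>_. 2)"
      using T by (intro L2_diff U(4,5) V(4,5); simp)+
    then show "(\<lambda>x. (u (x, 0) - v (x, 0))\<^sup>2) \<in> borel_measurable (lebesgue_on \<Omega>)" "(\<lambda>x. (u0 x - v0 x)\<^sup>2) \<in> borel_measurable (lebesgue_on \<Omega>)"
      by (auto simp: L2_iff)
    show "AE x in lebesgue_on \<Omega>. (u (x, 0) - v (x, 0))\<^sup>2 = (u0 x - v0 x)\<^sup>2"
      using sol_initial[OF u] sol_initial[OF v] by eventually_elim simp
  qed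
  note fw = sol_weak_form[OF u W(1), of \<tau>] and gw = sol_weak_form[OF v W(1), of \<tau>]
  note Wg = W_space_D(3,4)[OF W(1)]
  note cut = time_cut_integrable[OF u]
  have d1: "(\<integral>z. time_cut \<tau> z * ((h z - k z) * ?w z) \<partial>M) = (\<integral>z. time_cut \<tau> z * (h z * ?w z) \<partial>M) - (\<integral>z. time_cut \<tau> z * (k z * ?w z) \<partial>M)"
    if "h \<in> L_var M (\<lambda>_. 2)" "k \<in> L_var M (\<lambda>_. 2)" for h k
    unfolding left_diff_distrib[of "h _"] right_diff_distrib[of "time_cut _ _"]
    by (rule Bochner_Integration.integral_diff[OF cut[OF L2_mult_integrable[OF that(1) w2]] cut[OF L2_mult_integrable[OF that(2) w2]]])
  have "(\<integral>z. time_cut \<tau> z * gap z (grad u z) (grad v z) \<partial>M)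
      = (\<integral>z. time_cut \<tau> z * (flux z (grad u z) \<bullet> grad ?w z) - time_cut \<tau> z * (flux z (grad v z) \<bullet> grad ?w z) \<partial>M)"
  proof (rule integral_cong_AE)
    show "(\<lambda>z. time_cut \<tau> z * gap z (grad u z) (grad v z)) \<in> borel_measurable M"
      using cut[OF gap_integrable[OF u v]] by auto
    show "(\<lambda>z. time_cut \<tau> z * (flux z (grad u z) \<bullet> grad ?w z) - time_cut \<tau> z * (flux z (grad v z) \<bullet> grad ?w z)) \<in> borel_measurable M"
      using cut[OF flux_integrable[OF G Wg]] cut[OF flux_integrable[OF H Wg]] by (intro borel_measurable_diff) auto
    show "AE z in M. time_cut \<tau> z * gap z (grad u z) (grad v z)
        = time_cut \<tau> z * (flux z (grad u z) \<bullet> grad ?w z) - time_cut \<tau> z * (flux z (grad v z) \<bullet> grad ?w z)"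
      using W(2) by eventually_elim (simp add: gap_flux[symmetric] inner_diff_left right_diff_distrib)
  qed
  also have "\<dots> = (\<integral>z. time_cut \<tau> z * (flux z (grad u z) \<bullet> grad ?w z) \<partial>M) - (\<integral>z. time_cut \<tau> z * (flux z (grad v z) \<bullet> grad ?w z) \<partial>M)"
    by (rule Bochner_Integration.integral_diff[OF cut[OF flux_integrable[OF G Wg]] cut[OF flux_integrable[OF H Wg]]])
  finally show ?thesis
    using fw gw energy initial d1[OF U(3) V(3)] d1[OF U(2) V(2)] by linarith
qed

text \<open>Let \<open>Y\<close> be the square of the \<open>L\<^sup>2\<close> norm of \<open>u - v\<close> on the cylinder. Young's inequality with the weight \<open>T\<close> bounds
the source term by \<open>T \<delta> + Y / (4 T)\<close>. Dropping the nonnegative gap and integrating the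
energy identity over \<open>(0, T)\<close> gives \<open>Y \<le> T (1 + 2 T) \<delta> + Y / 2\<close>; absorb \<open>Y / 2\<close> and go back to the identity.\<close>
lemma stability:
  assumes u: "solves u0 f u" and v: "solves v0 g v"
    and \<delta>: "(\<integral>x. (u0 x - v0 x)\<^sup>2 \<partial>lebesgue_on \<Omega>) \<le> \<delta>" "(\<integral>z. (f z - g z)\<^sup>2 \<partial>M) \<le> \<delta>"
  shows "\<tau> \<in> {0..T} \<Longrightarrow> (\<integral>x. (u (x, \<tau>) - v (x, \<tau>))\<^sup>2 \<partial>lebesgue_on \<Omega>) \<le> 2 * (1 + 2 * T) * \<delta>"
    and "(\<integral>z. gap z (grad u z) (grad v z) \<partial>M) \<le> (1 + 2 * T) * \<delta>"
proof -
  let ?w = "\<lambda>z. u z - v z" and ?h = "\<lambda>z. f z - g z"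
  let ?D = "\<lambda>\<tau>. \<integral>x. (?w (x, \<tau>))\<^sup>2 \<partial>lebesgue_on \<Omega>" and ?Y = "\<integral>z. (?w z)\<^sup>2 \<partial>M"
  let ?gap = "\<lambda>z. gap z (grad u z) (grad v z)"
  note U = sol_L2[OF u] and V = sol_L2[OF v]
  note w2 = L2_diff[OF U(1) V(1)] and h2 = L2_diff[OF U(2) V(2)]
  have i: "integrable M (\<lambda>z. (?w z)\<^sup>2)" "integrable M (\<lambda>z. (?h z)\<^sup>2)" using w2 h2 by (auto simp: L2_iff)
  note hw = L2_mult_integrable[OF h2 w2]
  have young: "x * y \<le> T * x\<^sup>2 + 1 / (4 * T) * y\<^sup>2" "0 \<le> T * x\<^sup>2 + 1 / (4 * T) * y\<^sup>2" for x y
  proof -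
    have "0 \<le> (2 * T * x - y)\<^sup>2 / (4 * T)" using T by simp
    also have "\<dots> = T * x\<^sup>2 + 1 / (4 * T) * y\<^sup>2 - x * y" using T by (simp add: power2_eq_square field_simps)
    finally show "x * y \<le> T * x\<^sup>2 + 1 / (4 * T) * y\<^sup>2" by simp
    show "0 \<le> T * x\<^sup>2 + 1 / (4 * T) * y\<^sup>2" using T by simp
  qed
  have source: "(\<integral>z. time_cut \<tau> z * (?h z * ?w z) \<partial>M) \<le> T * \<delta> + 1 / (4 * T) * ?Y" for \<tau>
  proof -
    have "(\<integral>z. time_cut \<tau> z * (?h z * ?w z) \<partial>M) \<le> (\<integral>z. T * (?h z)\<^sup>2 + 1 / (4 * T) * (?w z)\<^sup>2 \<partial>M)"
    proof (rule integral_mono)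
      show "integrable M (\<lambda>z. time_cut \<tau> z * (?h z * ?w z))" by (rule time_cut_integrable[OF u hw])
      show "integrable M (\<lambda>z. T * (?h z)\<^sup>2 + 1 / (4 * T) * (?w z)\<^sup>2)" using i by simp
      show "time_cut \<tau> z * (?h z * ?w z) \<le> T * (?h z)\<^sup>2 + 1 / (4 * T) * (?w z)\<^sup>2" for z
        using young[of "?h z" "?w z"] by (auto simp: time_cut_def indicator_def)
    qed
    also have "\<dots> = T * (\<integral>z. (?h z)\<^sup>2 \<partial>M) + 1 / (4 * T) * ?Y" using i by simp
    also have "\<dots> \<le> T * \<delta> + 1 / (4 * T) * ?Y" using \<delta>(2) T by (intro add_right_mono mult_left_mono) auto
    finally show ?thesis .
  qed
  have gap0: "0 \<le> (\<integral>z. time_cut \<tau> z * ?gap z \<partial>M)" for \<tau>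
  proof (rule Bochner_Integration.integral_nonneg_AE, rule AE_I2)
    show "0 \<le> time_cut \<tau> z * ?gap z" if "z \<in> space M" for z
      using gap_nonneg[of z] that by (intro mult_nonneg_nonneg) (auto simp: time_cut_def)
  qed
  have D: "?D \<tau> \<le> (1 + 2 * T) * \<delta> + 1 / (2 * T) * ?Y" if "\<tau> \<in> {0..T}" for \<tau>
    using difference_energy[OF u v that] gap0[of \<tau>] source[of \<tau>] \<delta>(1) by (simp add: algebra_simps)
  have "?Y = (\<integral>\<tau>. ?D \<tau> \<partial>lebesgue_on {0<..T})"
    using Fubini_lebesgue_on(2)[OF _ _ i(1)] \<Omega>(1) by simp
  also have "\<dots> \<le> (\<integral>\<tau>. (1 + 2 * T) * \<delta> + 1 / (2 * T) * ?Y \<partial>lebesgue_on {0<..T})"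
  proof (rule integral_mono)
    show "integrable (lebesgue_on {0<..T}) ?D" using Fubini_lebesgue_on(1)[OF _ _ i(1)] \<Omega>(1) by simp
    have "finite_measure (lebesgue_on {0<..T})" by (intro finite_measure_lebesgue_on bounded_set_imp_lmeasurable) auto
    then show "integrable (lebesgue_on {0<..T}) (\<lambda>\<tau>. (1 + 2 * T) * \<delta> + 1 / (2 * T) * ?Y)"
      by (rule finite_measure.integrable_const)
  qed (use D in auto)
  also have "\<dots> = T * ((1 + 2 * T) * \<delta> + 1 / (2 * T) * ?Y)"
    using T by (simp add: measure_restrict_space)
  also have "\<dots> = T * ((1 + 2 * T) * \<delta>) + 1/2 * ?Y"
    using T by (simp add: distrib_left)
  finally have Y: "?Y \<le> 2 * T * ((1 + 2 * T) * \<delta>)" by simp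
  then have Y': "1 / (2 * T) * ?Y \<le> (1 + 2 * T) * \<delta>" using T by (simp add: field_simps)
  show "?D \<tau> \<le> 2 * (1 + 2 * T) * \<delta>" if "\<tau> \<in> {0..T}" using D[OF that] Y' by (simp add: algebra_simps)
  have "(\<integral>z. ?gap z \<partial>M) = (\<integral>z. time_cut T z * ?gap z \<partial>M)"
    by (intro Bochner_Integration.integral_cong refl) (auto simp: time_cut_def)
  moreover have "0 \<le> ?D T" by simp
  moreover have "1 / (4 * T) * ?Y = 1/2 * (1 / (2 * T) * ?Y)" by simp
  moreover have "T \<in> {0..T}" using T by simp
  moreover have "(1 + 2 * T) * \<delta> = \<delta> + 2 * (T * \<delta>)" by (simp add: algebra_simps)
  ultimately show "(\<integral>z. ?gap z \<partial>M) \<le> (1 + 2 * T) * \<delta>"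
    using difference_energy[OF u v, of T] source[of T] \<delta>(1) Y' by linarith
qed

text \<open>Integrate \<open>norm_diff_powr_le_mono_gap\<close> with the weights \<open>a\<close> and \<open>b\<close>. The gap is controlled by
\<open>stability\<close>, and the error term is a small multiple of the energy of the fixed solution \<open>u\<close>.\<close>
lemma gradient_stability:
  assumes u: "solves u0 f u" and \<epsilon>: "0 < \<epsilon>"
  obtains C where "\<And>v0 g v \<delta>. solves v0 g v \<Longrightarrow> (\<integral>x. (u0 x - v0 x)\<^sup>2 \<partial>lebesgue_on \<Omega>) \<le> \<delta> \<Longrightarrow> (\<integral>z. (f z - g z)\<^sup>2 \<partial>M) \<le> \<delta> \<Longrightarrow>
     (\<integral>\<^sup>+z. ennreal (F z (grad (\<lambda>z. u z - v z) z) * (norm (grad (\<lambda>z. u z - v z) z))\<^sup>2) \<partial>M) \<le> ennreal (C * \<delta> + \<epsilon>)"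
proof -
  note G = sol_grad[OF u]
  let ?E = "\<integral>z. flux z (grad u z) \<bullet> grad u z \<partial>M"
  have F0: "z \<in> space M \<Longrightarrow> 0 \<le> F z \<xi> * (norm \<xi>)\<^sup>2" for z \<xi>
    unfolding F_norm_sq using coeffs[OF cyl_in_closure, of z] by simp
  have E0: "0 \<le> ?E"
    by (rule Bochner_Integration.integral_nonneg_AE, rule AE_I2) (simp only: flux_inner_self F0)
  (* the summand 1 covers a solution of energy zero *)
  define e where "e = \<epsilon> / (1 + ?E)"
  have e: "0 < e" "e * ?E \<le> \<epsilon>"
    using \<epsilon> E0 by (auto simp: e_def field_simps)
  obtain C where C: "0 \<le> C" "\<And>r (\<xi>::'a) \<eta>. m \<le> r \<Longrightarrow> r \<le> R \<Longrightarrow> norm (\<xi> - \<eta>) powr r \<le> C * mono_gap r \<xi> \<eta> + e * norm \<xi> powr r"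
    by (rule norm_diff_powr_le_mono_gap[OF m e(1)]) (rule that)
  show ?thesis
  proof (rule that[of "C * (1 + 2 * T)"])
    fix v0 g v \<delta>
    assume v: "solves v0 g v" and \<delta>: "(\<integral>x. (u0 x - v0 x)\<^sup>2 \<partial>lebesgue_on \<Omega>) \<le> \<delta>" "(\<integral>z. (f z - g z)\<^sup>2 \<partial>M) \<le> \<delta>"
    let ?w = "\<lambda>z. u z - v z" and ?gap = "\<lambda>z. gap z (grad u z) (grad v z)"
    note W = W_s_max_diff[OF sol_W[OF u] sol_W[OF v]]
    have "(\<integral>\<^sup>+z. ennreal (F z (grad ?w z) * (norm (grad ?w z))\<^sup>2) \<partial>M)
        \<le> (\<integral>\<^sup>+z. ennreal (C * ?gap z + e * (flux z (grad u z) \<bullet> grad u z)) \<partial>M)"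
    proof (rule nn_integral_mono_AE)
      have "AE z in M. z \<in> space M" by (rule AE_space)
      then show "AE z in M. ennreal (F z (grad ?w z) * (norm (grad ?w z))\<^sup>2) \<le> ennreal (C * ?gap z + e * (flux z (grad u z) \<bullet> grad u z))"
        using W(2)
      proof eventually_elim
        case (elim z)
        then have z: "z \<in> closure (cyl \<Omega> T)" using cyl_in_closure by simp
        let ?x = "grad u z" and ?y = "grad v z"
        have "a z * norm (?x - ?y) powr p z + b z * norm (?x - ?y) powr q z
          \<le> a z * (C * mono_gap (p z) ?x ?y + e * norm ?x powr p z) + b z * (C * mono_gap (q z) ?x ?y + e * norm ?x powr q z)"
          using exps[OF z] coeffs[OF z] C(2) by (intro add_mono mult_left_mono) auto
        also have "\<dots> = C * ?gap z + e * (flux z ?x \<bullet> ?x)"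
          unfolding flux_inner_self F_norm_sq gap_def by (simp add: algebra_simps)
        finally show ?case unfolding elim(2) F_norm_sq by (rule ennreal_leI)
      qed
    qed
    also have "\<dots> = ennreal (\<integral>z. C * ?gap z + e * (flux z (grad u z) \<bullet> grad u z) \<partial>M)"
    proof (rule nn_integral_eq_integral)
      show "integrable M (\<lambda>z. C * ?gap z + e * (flux z (grad u z) \<bullet> grad u z))"
        using gap_integrable[OF u v] flux_integrable[OF G G] by simp
      show "AE z in M. 0 \<le> C * ?gap z + e * (flux z (grad u z) \<bullet> grad u z)"
      proof (rule AE_I2)
        fix z assume z: "z \<in> space M"
        then have "0 \<le> ?gap z" by (intro gap_nonneg) simp
        moreover have "0 \<le> flux z (grad u z) \<bullet> grad u z" unfolding flux_inner_self by (rule F0[OF z])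
        ultimately show "0 \<le> C * ?gap z + e * (flux z (grad u z) \<bullet> grad u z)"
          using C(1) e(1) by (intro add_nonneg_nonneg mult_nonneg_nonneg) auto
      qed
    qed
    also have "\<dots> \<le> ennreal (C * (1 + 2 * T) * \<delta> + \<epsilon>)"
    proof (rule ennreal_leI)
      have "(\<integral>z. C * ?gap z + e * (flux z (grad u z) \<bullet> grad u z) \<partial>M) = C * (\<integral>z. ?gap z \<partial>M) + e * ?E"
        using gap_integrable[OF u v] flux_integrable[OF G G] by simp
      also have "\<dots> \<le> C * ((1 + 2 * T) * \<delta>) + \<epsilon>"
        using stability(2)[OF u v \<delta>] C(1) e(2) by (intro add_mono mult_left_mono)
      finally show "(\<integral>z. C * ?gap z + e * (flux z (grad u z) \<bullet> grad u z) \<partial>M) \<le> C * (1 + 2 * T) * \<delta> + \<epsilon>"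
        by (simp add: mult.assoc)
    qed
    finally show "(\<integral>\<^sup>+z. ennreal (F z (grad ?w z) * (norm (grad ?w z))\<^sup>2) \<partial>M) \<le> ennreal (C * (1 + 2 * T) * \<delta> + \<epsilon>)" .
  qed
qed

text \<open>Small gradients contribute at most \<open>\<rho>\<close>. For a gradient larger than \<open>\<rho>\<close>, raising the exponent from the
minimum to \<open>p\<close> or \<open>q\<close> costs at most the factor \<open>\<rho>\<^sup>-\<^sup>R\<close>, and the coefficients add up to at least \<open>\<alpha>\<close>.\<close>
lemma powr_min_le_energy:
  assumes z: "z \<in> cyl \<Omega> T" and \<rho>: "0 < \<rho>" "\<rho> \<le> 1"
  shows "norm \<xi> powr min (p z) (q z) \<le> \<rho> + \<rho> powr (- R) / \<alpha> * (F z \<xi> * (norm \<xi>)\<^sup>2)"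
proof -
  note e = exps[OF cyl_in_closure[OF z]] and c = coeffs[OF cyl_in_closure[OF z]] and n = nondeg[OF cyl_in_closure[OF z]]
  let ?s = "min (p z) (q z)" and ?t = "norm \<xi>"
  have s: "1 < ?s" "0 \<le> R" using e m by auto
  have E0: "0 \<le> F z \<xi> * ?t\<^sup>2" unfolding F_norm_sq using c by simp
  show ?thesis
  proof (cases "?t \<le> \<rho>")
    case True
    then have "?t powr ?s \<le> \<rho> powr ?s" using s by (intro powr_mono2) auto
    also have "\<dots> \<le> \<rho> powr 1" using \<rho> s by (intro powr_mono') auto
    also have "\<rho> powr 1 = \<rho>" using \<rho> by simp
    finally show ?thesis using E0 \<alpha> by (simp add: add_increasing2)
  next
    case False
    have le: "?t powr ?s \<le> \<rho> powr (- R) * ?t powr r" if r: "?s \<le> r" "r \<le> R" for r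
    proof -
      have "?t powr (?s - r) \<le> \<rho> powr (?s - r)" using False \<rho> r by (intro powr_mono2') auto
      also have "\<dots> \<le> \<rho> powr (- R)" using \<rho> r s by (intro powr_mono') auto
      finally have "?t powr (?s - r) * ?t powr r \<le> \<rho> powr (- R) * ?t powr r" by (intro mult_right_mono) auto
      then show ?thesis by (simp add: powr_add[symmetric])
    qed
    have "\<alpha> * ?t powr ?s \<le> (a z + b z) * ?t powr ?s" using n by (intro mult_right_mono) auto
    also have "\<dots> = a z * ?t powr ?s + b z * ?t powr ?s" by (simp add: distrib_right)
    also have "\<dots> \<le> a z * (\<rho> powr (- R) * ?t powr p z) + b z * (\<rho> powr (- R) * ?t powr q z)"
      using c e by (intro add_mono mult_left_mono le) auto
    also have "\<dots> = \<rho> powr (- R) * (F z \<xi> * ?t\<^sup>2)" unfolding F_norm_sq by (simp add: algebra_simps)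
    finally have "?t powr ?s \<le> \<rho> powr (- R) / \<alpha> * (F z \<xi> * ?t\<^sup>2)" using \<alpha> by (simp add: field_simps)
    then show ?thesis using \<rho> by simp
  qed
qed

lemma continuous_dependence:
  assumes u: "solves u0 f u" and v: "\<And>k. solves (v0 k) (g k) (v k)"
    and lim: "(\<lambda>k. L2_norm (lebesgue_on \<Omega>) (\<lambda>x. u0 x - v0 k x) + L2_norm M (\<lambda>z. f z - g k z)) \<longlonglongrightarrow> 0"
  shows "(\<lambda>k::nat. (SUP t\<in>{0<..<T}. ennreal ((L2_norm (lebesgue_on \<Omega>) (\<lambda>x. u (x, t) - v k (x, t)))\<^sup>2))
      + (\<integral>\<^sup>+z. ennreal (F z (grad (\<lambda>z. u z - v k z) z) * (norm (grad (\<lambda>z. u z - v k z) z))\<^sup>2) \<partial>M)) \<longlonglongrightarrow> 0"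
    and "(\<lambda>k. \<integral>\<^sup>+z. ennreal (norm (grad (\<lambda>z. u z - v k z) z) powr min (p z) (q z)) \<partial>M) \<longlonglongrightarrow> 0"
proof -
  let ?N = "lebesgue_on \<Omega>"
  define \<delta> where "\<delta> k = (L2_norm ?N (\<lambda>x. u0 x - v0 k x) + L2_norm M (\<lambda>z. f z - g k z))\<^sup>2" for k
  have \<delta>: "(\<integral>x. (u0 x - v0 k x)\<^sup>2 \<partial>?N) \<le> \<delta> k" "(\<integral>z. (f z - g k z)\<^sup>2 \<partial>M) \<le> \<delta> k" for k
    unfolding L2_norm_sq[symmetric] \<delta>_def by (intro power_mono; simp add: L2_norm_def)+
  have \<delta>0: "0 \<le> \<delta> k" for k by (simp add: \<delta>_def)
  have \<delta>_lim: "\<delta> \<longlonglongrightarrow> 0" using tendsto_power[OF lim, of 2] by (simp add: \<delta>_def[abs_def])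
  let ?S = "\<lambda>k. SUP t\<in>{0<..<T}. ennreal ((L2_norm ?N (\<lambda>x. u (x, t) - v k (x, t)))\<^sup>2)"
  let ?E = "\<lambda>k. \<integral>\<^sup>+z. ennreal (F z (grad (\<lambda>z. u z - v k z) z) * (norm (grad (\<lambda>z. u z - v k z) z))\<^sup>2) \<partial>M"
  have S: "?S k \<le> ennreal (2 * (1 + 2 * T) * \<delta> k)" for k
    unfolding L2_norm_sq using stability(1)[OF u v \<delta>] by (intro SUP_least ennreal_leI) auto
  have E: "\<exists>C. \<forall>k. ?E k \<le> ennreal (C * \<delta> k + \<epsilon>)" if \<epsilon>: "0 < \<epsilon>" for \<epsilon>
  proof -
    obtain C where "\<And>v0 g v \<delta>. solves v0 g v \<Longrightarrow> (\<integral>x. (u0 x - v0 x)\<^sup>2 \<partial>lebesgue_on \<Omega>) \<le> \<delta> \<Longrightarrow> (\<integral>z. (f z - g z)\<^sup>2 \<partial>M) \<le> \<delta> \<Longrightarrow>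
     (\<integral>\<^sup>+z. ennreal (F z (grad (\<lambda>z. u z - v z) z) * (norm (grad (\<lambda>z. u z - v z) z))\<^sup>2) \<partial>M) \<le> ennreal (C * \<delta> + \<epsilon>)"
      by (rule gradient_stability[OF u \<epsilon>]) (rule that)
    from this[OF v \<delta>] show ?thesis by blast
  qed
  show "(\<lambda>k. ?S k + ?E k) \<longlonglongrightarrow> 0"
  proof (rule tendsto_0_ennreal_if[OF \<delta>_lim])
    fix \<epsilon> :: real assume "0 < \<epsilon>"
    then obtain C where C: "\<And>k. ?E k \<le> ennreal (C * \<delta> k + \<epsilon>)" using E by blast
    have "?S k + ?E k \<le> ennreal ((2 * (1 + 2 * T) + max C 0) * \<delta> k + \<epsilon>)" for k
    proof -
      have "?S k + ?E k \<le> ennreal (2 * (1 + 2 * T) * \<delta> k) + ennreal (max C 0 * \<delta> k + \<epsilon>)"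
      proof (intro add_mono S order_trans[OF C] ennreal_leI add_right_mono mult_right_mono)
      qed (use \<delta>0 in auto)
      also have "\<dots> = ennreal (2 * (1 + 2 * T) * \<delta> k + (max C 0 * \<delta> k + \<epsilon>))"
        using T \<delta>0[of k] \<open>0 < \<epsilon>\<close> by (intro ennreal_plus[symmetric]) auto
      finally show ?thesis by (simp add: algebra_simps)
    qed
    then show "\<exists>C. \<forall>k. ?S k + ?E k \<le> ennreal (C * \<delta> k + \<epsilon>)" by blast
  qed
  show "(\<lambda>k. \<integral>\<^sup>+z. ennreal (norm (grad (\<lambda>z. u z - v k z) z) powr min (p z) (q z)) \<partial>M) \<longlonglongrightarrow> 0"
  proof (rule tendsto_0_ennreal_if[OF \<delta>_lim])
    fix \<epsilon> :: real assume \<epsilon>: "0 < \<epsilon>"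
    define V where "V = measure M (cyl \<Omega> T)"
    have V: "emeasure M (cyl \<Omega> T) = ennreal V" "0 \<le> V"
      unfolding V_def using finite_measure.emeasure_eq_measure[OF finite_M] by auto
    (* half of \<epsilon> is spent on small gradients, the other half on the error in the energy *)
    define \<rho> where "\<rho> = min 1 (\<epsilon> / (2 * (1 + V)))"
    have \<rho>: "0 < \<rho>" "\<rho> \<le> 1" using \<epsilon> V(2) by (auto simp: \<rho>_def)
    have "\<rho> * V \<le> \<epsilon> / (2 * (1 + V)) * V" using V(2) by (intro mult_right_mono) (auto simp: \<rho>_def)
    also have "\<dots> \<le> \<epsilon> / 2" using \<epsilon> V(2) by (simp add: field_simps)
    finally have \<rho>V: "\<rho> * V \<le> \<epsilon> / 2" .
    define L where "L = \<rho> powr (- R) / \<alpha>"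
    have L: "0 < L" using \<rho> \<alpha> by (simp add: L_def)
    obtain C where C: "\<And>k. ?E k \<le> ennreal (C * \<delta> k + \<epsilon> / (2 * L))" using E[of "\<epsilon> / (2 * L)"] \<epsilon> L by auto
    have "(\<integral>\<^sup>+z. ennreal (norm (grad (\<lambda>z. u z - v k z) z) powr min (p z) (q z)) \<partial>M) \<le> ennreal (L * max C 0 * \<delta> k + \<epsilon>)" for k
    proof -
      let ?w = "grad (\<lambda>z. u z - v k z)"
      note W = W_s_max_diff(1)[OF sol_W[OF u] sol_W[OF v[of k]]]
      note [measurable] = W_space_D(3)[OF W]
      have mE: "(\<lambda>z. F z (?w z) * (norm (?w z))\<^sup>2) \<in> borel_measurable M"
        unfolding flux_coeff_def by measurable
      have F0: "0 \<le> F z (?w z) * (norm (?w z))\<^sup>2" if "z \<in> space M" for z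
        unfolding F_norm_sq using coeffs[OF cyl_in_closure, of z] that by simp
      have "(\<integral>\<^sup>+z. ennreal (norm (?w z) powr min (p z) (q z)) \<partial>M)
          \<le> (\<integral>\<^sup>+z. ennreal \<rho> + ennreal L * ennreal (F z (?w z) * (norm (?w z))\<^sup>2) \<partial>M)"
      proof (rule nn_integral_mono)
        fix z assume z: "z \<in> space M"
        have "norm (?w z) powr min (p z) (q z) \<le> \<rho> + L * (F z (?w z) * (norm (?w z))\<^sup>2)"
          unfolding L_def using z \<rho> by (intro powr_min_le_energy) auto
        then have "ennreal (norm (?w z) powr min (p z) (q z)) \<le> ennreal (\<rho> + L * (F z (?w z) * (norm (?w z))\<^sup>2))"
          by (rule ennreal_leI)
        also have "\<dots> = ennreal \<rho> + ennreal L * ennreal (F z (?w z) * (norm (?w z))\<^sup>2)"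
          using \<rho> L F0[OF z] by (simp add: ennreal_plus ennreal_mult[symmetric])
        finally show "ennreal (norm (?w z) powr min (p z) (q z)) \<le> ennreal \<rho> + ennreal L * ennreal (F z (?w z) * (norm (?w z))\<^sup>2)" .
      qed
      also have "\<dots> = ennreal \<rho> * ennreal V + ennreal L * ?E k"
        using mE by (subst nn_integral_add) (auto simp: nn_integral_cmult V(1))
      also have "\<dots> \<le> ennreal \<rho> * ennreal V + ennreal L * ennreal (max C 0 * \<delta> k + \<epsilon> / (2 * L))"
      proof (intro add_left_mono mult_left_mono order_trans[OF C] ennreal_leI add_right_mono mult_right_mono)
      qed (use \<delta>0 in auto)
      also have "\<dots> = ennreal (\<rho> * V + L * (max C 0 * \<delta> k + \<epsilon> / (2 * L)))"
      proof -
        have "0 \<le> max C 0 * \<delta> k + \<epsilon> / (2 * L)" using L \<epsilon> \<delta>0[of k] by simp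
        then show ?thesis
          using \<rho> L V(2) by (simp add: ennreal_mult[symmetric] ennreal_plus[symmetric] del: ennreal_plus)
      qed
      also have "\<dots> \<le> ennreal (L * max C 0 * \<delta> k + \<epsilon>)"
        using \<rho>V L by (intro ennreal_leI) (simp add: field_simps)
      finally show ?thesis .
    qed
    then show "\<exists>C. \<forall>k. (\<integral>\<^sup>+z. ennreal (norm (grad (\<lambda>z. u z - v k z) z) powr min (p z) (q z)) \<partial>M) \<le> ennreal (C * \<delta> k + \<epsilon>)" by blast
  qed
qed

end

theorem theorem2p2:
  fixes \<Omega> :: "(real ^ 'n) set"
    and T p_minus p_plus q_minus q_plus \<alpha> :: real
    and p q a b :: "(real ^ 'n) \<times> real \<Rightarrow> real"
  assumes "CARD('n) \<ge> 2"
    and "bounded_C2_domain \<Omega>"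
    and "0 < T"
    and "\<exists>L. L-lipschitz_on (closure (cyl \<Omega> T)) p"
    and "\<exists>L. L-lipschitz_on (closure (cyl \<Omega> T)) q"
    and "2 * real CARD('n) / (real CARD('n) + 2) < p_minus"
    and "\<forall>z\<in>closure (cyl \<Omega> T). p_minus \<le> p z \<and> p z \<le> p_plus"
    and "2 * real CARD('n) / (real CARD('n) + 2) < q_minus"
    and "\<forall>z\<in>closure (cyl \<Omega> T). q_minus \<le> q z \<and> q z \<le> q_plus"
    and "(SUP z\<in>closure (cyl \<Omega> T). \<bar>p z - q z\<bar>) < 2 / (real CARD('n) + 2)"
    and "\<exists>L. L-lipschitz_on (closure (cyl \<Omega> T)) a"
    and "\<exists>L. L-lipschitz_on (closure (cyl \<Omega> T)) b"
    and "\<forall>z\<in>closure (cyl \<Omega> T). 0 \<le> a z \<and> 0 \<le> b z"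
    and "0 < \<alpha>"
    and "\<forall>z\<in>closure (cyl \<Omega> T). \<alpha> \<le> a z + b z"
  shows "(\<forall>u0 f u. admissible \<Omega> T p q a b u0 f \<and>
            strong_solution \<Omega> T p q a b u0 f u \<and> u \<in> C_L2 \<Omega> T \<longrightarrow>
          (\<forall>t\<in>{0..T}.
             1/2 * (L2_norm (lebesgue_on \<Omega>) (\<lambda>x. u (x, t)))\<^sup>2
               + (\<integral>z. flux_coeff p q a b z (space_grad \<Omega> T u z)
                      * (norm (space_grad \<Omega> T u z))\<^sup>2 \<partial>lebesgue_on (\<Omega> \<times> {0<..<t}))
             = 1/2 * (L2_norm (lebesgue_on \<Omega>) u0)\<^sup>2
               + (\<integral>z. u z * f z \<partial>lebesgue_on (\<Omega> \<times> {0<..<t}))))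
       \<and> (\<forall>u0 f u (v0 :: nat \<Rightarrow> real ^ 'n \<Rightarrow> real) g v.
            admissible \<Omega> T p q a b u0 f \<and>
            strong_solution \<Omega> T p q a b u0 f u \<and> u \<in> C_L2 \<Omega> T \<and>
            (\<forall>k. admissible \<Omega> T p q a b (v0 k) (g k) \<and>
                 strong_solution \<Omega> T p q a b (v0 k) (g k) (v k) \<and> v k \<in> C_L2 \<Omega> T) \<and>
            (\<lambda>k. L2_norm (lebesgue_on \<Omega>) (\<lambda>x. u0 x - v0 k x)
                + L2_norm (lebesgue_on (cyl \<Omega> T)) (\<lambda>z. f z - g k z)) \<longlonglongrightarrow> 0 \<longrightarrow>
          (\<lambda>k. (SUP t\<in>{0<..<T}.
                  ennreal ((L2_norm (lebesgue_on \<Omega>) (\<lambda>x. u (x, t) - v k (x, t)))\<^sup>2))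
               + (\<integral>\<^sup>+z. ennreal (flux_coeff p q a b z (space_grad \<Omega> T (\<lambda>z. u z - v k z) z)
                    * (norm (space_grad \<Omega> T (\<lambda>z. u z - v k z) z))\<^sup>2)
                    \<partial>lebesgue_on (cyl \<Omega> T))) \<longlonglongrightarrow> 0 \<and>
          (\<lambda>k. \<integral>\<^sup>+z. ennreal (norm (space_grad \<Omega> T (\<lambda>z. u z - v k z) z) powr min (p z) (q z))
                 \<partial>lebesgue_on (cyl \<Omega> T)) \<longlonglongrightarrow> 0)"
proof -
  let ?K = "closure (cyl \<Omega> T)"
  have cont: "continuous_on ?K p" "continuous_on ?K q" "continuous_on ?K a" "continuous_on ?K b"
    using assms(4,5,11,12) by (auto intro: lipschitz_on_continuous_on)
  have \<Omega>: "open \<Omega>" "bounded \<Omega>" using assms(2) by (auto simp: bounded_C2_domain_def)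
  have K: "compact ?K" using \<Omega>(2) by (simp add: closure_cyl[OF assms(3)] compact_Times)
  have "bounded (a ` ?K \<union> b ` ?K)"
    using compact_imp_bounded[OF compact_continuous_image[OF cont(3) K]] compact_imp_bounded[OF compact_continuous_image[OF cont(4) K]]
    by simp
  then obtain A where A: "\<forall>y\<in>a ` ?K \<union> b ` ?K. norm y \<le> A" unfolding bounded_iff by (rule exE)
  have AK: "0 \<le> a z \<and> a z \<le> A \<and> 0 \<le> b z \<and> b z \<le> A" if "z \<in> ?K" for z
    using A assms(13) that by (auto simp: ball_Un)
  have "1 \<le> 2 * real CARD('n) / (real CARD('n) + 2)" using assms(1) by (simp add: field_simps)
  then have m: "1 < min p_minus q_minus" using assms(6,8) by linarith
  interpret double_phase \<Omega> T p q a b "min p_minus q_minus" "max p_plus q_plus" \<alpha> A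
  proof (unfold_locales)
    show "open \<Omega>" "bounded \<Omega>" "0 < T" "1 < min p_minus q_minus" "0 < \<alpha>" by fact+
    show "continuous_on ?K p" "continuous_on ?K q" "continuous_on ?K a" "continuous_on ?K b" by fact+
    show "min p_minus q_minus \<le> p z \<and> p z \<le> max p_plus q_plus \<and> min p_minus q_minus \<le> q z \<and> q z \<le> max p_plus q_plus" if "z \<in> ?K" for z
    proof -
      have "p_minus \<le> p z" "p z \<le> p_plus" "q_minus \<le> q z" "q z \<le> q_plus" using assms(7,9) that by auto
      then show ?thesis by auto
    qed
    show "0 \<le> a z \<and> a z \<le> A \<and> 0 \<le> b z \<and> b z \<le> A" if "z \<in> ?K" for z using AK[OF that] .
    show "\<alpha> \<le> a z + b z" if "z \<in> ?K" for z using assms(15) that by blast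
  qed
  show ?thesis
    apply (intro conjI allI impI ballI; elim conjE)
    subgoal by (rule energy_equality) (simp_all add: solves_def)
    subgoal by (rule continuous_dependence(1)[rotated 2]) (assumption, simp_all add: solves_def)
    subgoal by (rule continuous_dependence(2)[rotated 2]) (assumption, simp_all add: solves_def)
    done
qed

end
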